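(* Let $\mathsf{R}$ be an ordered ring with $\mathbb{Q}\subseteq\mathsf{R}$, let $\mathsf{C}=\mathsf{R}(\mathrm{i})$ with $\mathrm{i}^2=-1$, and let $\mathcal{A}$ be a unital $^*$-algebra over $\mathsf{C}$. Let $P_0\in M_n(\mathcal{A})$ satisfy $P_0=P_0^2=P_0^*$, and let $\mathcal{E}=P_0\mathcal{A}^n$, endowed with its $\mathcal{A}$-valued, $\mathcal{A}$-right linear Hermitian inner product $h_0(x,y)=\sum_{i=1}^n x_i^*y_i$ inherited from $\mathcal{A}^n$. Let $\boldsymbol{\mathcal{A}}=(\mathcal{A}[[\lambda]],\star)$ be a Hermitian deformation of $\mathcal{A}$. Then: (1) There exists a deformation $\bullet$ of the right module structure of $\mathcal{E}$ with respect to $\star$, as well as a deformation $\boldsymbol{h}$ of $h_0$ (with respect to $\bullet$). Any two such pairs of deformations are isometrically equivalent (and in particular any two such $\bullet$ are equivalent). (2) The right $\boldsymbol{\mathcal{A}}$-module $(\mathcal{E}[[\lambda]],\bullet)$ is finitely generated and projective. (3) $\bullet$ induces a Hermitian deformation $\star'$ of $\mathcal{B}=\mathrm{End}_{\mathcal{A}}(\mathcal{E})$ such that $(\mathcal{B}[[\lambda]],\star')\cong\mathrm{End}_{\boldsymbol{\mathcal{A}}}(\mathcal{E}[[\lambda]],\bullet)$ with a deformed bimodule structure, and $\star'$ is uniquely determined up to equivalence.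
   Context: An ordered ring $\mathsf{R}$ is a commutative associative unital ring with a subset $\mathsf{P}$ of positive elements, closed under addition and multiplication, such that $\mathsf{R}=-\mathsf{P}\,\dot\cup\,\{0\}\,\dot\cup\,\mathsf{P}$. Then $\mathsf{R}[[\lambda]]$ is ordered by declaring $\sum_{r\ge r_0}\lambda^r a_r>0$ if $a_{r_0}>0$; and $\mathsf{C}[[\lambda]]=\mathsf{R}[[\lambda]](\mathrm{i})$ with $\overline{\lambda}=\lambda$. A $^*$-algebra over $\mathsf{C}$ is an associative $\mathsf{C}$-algebra with an antilinear involutive anti-automorphism $A\mapsto A^*$. $M_n(\mathcal{A})$ carries its usual $^*$-involution. A linear functional $\omega$ is positive if $\omega(A^*A)\ge 0$ for all $A$; a Hermitian element $A=A^*$ is positive, $A\in\mathcal{A}^+$, if $\omega(A)\ge0$ for all positive linear functionals $\omega$. A Hermitian deformation of $\mathcal{A}$ is a formal associative deformation $A\star B=AB+\sum_{r\ge1}\lambda^rC_r(A,B)$ on $\mathcal{A}[[\lambda]]$ ($\mathsf{C}[[\lambda]]$-bilinear) such that $(A\star B)^*=B^*\star A^*$. It is regarded as a $^*$-algebra over $\mathsf{C}[[\lambda]]$. Two deformations $\star',\star''$ of an algebra are equivalent if there is $T=\mathrm{id}+\sum_{r\ge1}\lambda^rT_r$ with linear $T_r$ such that $T(A\star'B)=T(A)\star''T(B)$. An $\mathcal{A}$-valued, $\mathcal{A}$-right linear Hermitian inner product on a right $\mathcal{A}$-module $\mathcal{E}$ is a map $h:\mathcal{E}\times\mathcal{E}\to\mathcal{A}$,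 $\mathsf{C}$-linear in the second argument, with $h(x,y)=h(y,x)^*$, $h(x,y\cdot A)=h(x,y)A$ and $h(x,x)\in\mathcal{A}^+$. A deformation of the right module structure of $\mathcal{E}$ with respect to $\star$ is a right $\boldsymbol{\mathcal{A}}$-module structure on $\mathcal{E}[[\lambda]]$ of the form $x\bullet A=x\cdot A+\sum_{r\ge1}\lambda^r\rho_r(x,A)$ ($\mathsf{C}[[\lambda]]$-bilinear). A deformation of $h_0$ is an $\boldsymbol{\mathcal{A}}$-valued, $\boldsymbol{\mathcal{A}}$-right linear Hermitian inner product $\boldsymbol{h}=h_0+\sum_{r\ge1}\lambda^rh_r$ on $(\mathcal{E}[[\lambda]],\bullet)$. Two deformations $\bullet,\bullet'$ are equivalent if there is $T=\mathrm{id}+\sum_{r\ge1}\lambda^rT_r$ on $\mathcal{E}[[\lambda]]$ with $T(x\bullet A)=T(x)\bullet'A$; pairs $(\bullet,\boldsymbol{h})$, $(\bullet',\boldsymbol{h}')$ are isometrically equivalent if such a $T$ can be chosen with $\boldsymbol{h}'(Tx,Ty)=\boldsymbol{h}(x,y)$. $\mathcal{B}=\mathrm{End}_{\mathcal{A}}(\mathcal{E})=P_0M_n(\mathcal{A})P_0$ is a $^*$-algebra with the involution inherited from $M_n(\mathcal{A})$. "With a deformed bimodule structure" means that the algebra isomorphism $(\mathcal{B}[[\lambda]],\star')\to\mathrm{End}_{\boldsymbol{\mathcal{A}}}(\mathcal{E}[[\lambda]],\bullet)$ is such that the resulting left action of $(\mathcal{B}[[\lambda]],\star')$ on $\mathcal{E}[[\lambda]]$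 by $\bullet$-right linear endomorphisms coincides in order $\lambda^0$ with the original left action of $\mathcal{B}$ on $\mathcal{E}$. Uniqueness of $\star'$ up to equivalence is among deformations with this property. *)

theory Defs
  imports
    "HOL-Computational_Algebra.Formal_Power_Series"
    "HOL-Analysis.Finite_Cartesian_Product"
    "HOL-Library.FuncSet"
begin

section \<open>Scalars\<close>

text \<open>An ordered ring \<open>R\<close> is a type of class \<^class>\<open>linordered_idom\<close>: the trichotomy together with the
  closure of the positive elements under products excludes zero divisors, and \<open>0 \<noteq> 1\<close> holds as soon
  as \<open>R\<close> contains the rationals.\<close>

definition contains_rat :: "'r::comm_ring_1 itself \<Rightarrow> bool" where
  "contains_rat _ \<longleftrightarrow> (\<exists>\<iota> :: rat \<Rightarrow> 'r. inj \<iota> \<and> \<iota> 1 = 1 \<and>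
     (\<forall>p q. \<iota> (p + q) = \<iota> p + \<iota> q) \<and> (\<forall>p q. \<iota> (p * q) = \<iota> p * \<iota> q))"

subsection \<open>The ring \<open>C = R(i)\<close>\<close>

datatype 'r cext = CExt (cre: 'r) (cim: 'r)

instantiation cext :: (comm_ring_1) comm_ring_1
begin

definition "0 = CExt 0 0"
definition "1 = CExt 1 0"
definition "z + w = CExt (cre z + cre w) (cim z + cim w)"
definition "- z = CExt (- cre z) (- cim z)"
definition "z - w = CExt (cre z - cre w) (cim z - cim w)" for z w :: "'a cext"
definition "z * w = CExt (cre z * cre w - cim z * cim w) (cre z * cim w + cim z * cre w)"

instance
  by standard
    (simp_all add: zero_cext_def one_cext_def plus_cext_def uminus_cext_def minus_cext_def
      times_cext_def cext.expand algebra_simps)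

end

definition cconj :: "'r::uminus cext \<Rightarrow> 'r cext" where
  "cconj z = CExt (cre z) (- cim z)"

text \<open>\<open>z \<ge> 0\<close> in \<open>C\<close> means that \<open>z\<close> lies in \<open>R\<close> and is nonnegative there.\<close>

definition cnonneg :: "'r::linordered_idom cext \<Rightarrow> bool" where
  "cnonneg z \<longleftrightarrow> cim z = 0 \<and> 0 \<le> cre z"

subsection \<open>The order on \<open>R[[\<lambda>]]\<close>\<close>

text \<open>With this instance \<open>C[[\<lambda>]] = R[[\<lambda>]](i)\<close> is the type \<open>'r fps cext\<close>, and the notions below that
  depend on an ordered ring apply verbatim to \<open>R[[\<lambda>]]\<close> in place of \<open>R\<close>.\<close>

definition fps_pos :: "'r::linordered_idom fps \<Rightarrow> bool" where
  "fps_pos f \<longleftrightarrow> (\<exists>n. 0 < fps_nth f n \<and> (\<forall>m<n. fps_nth f m = 0))"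

lemma fps_pos_add:
  assumes "fps_pos f" "fps_pos g" shows "fps_pos (f + g)"
proof -
  from assms obtain m n where
    m: "0 < fps_nth f m" "\<And>k. k < m \<Longrightarrow> fps_nth f k = 0" and
    n: "0 < fps_nth g n" "\<And>k. k < n \<Longrightarrow> fps_nth g k = 0"
    unfolding fps_pos_def by auto
  consider "m < n" | "m = n" | "n < m" by linarith
  then show ?thesis
  proof cases
    case 1 then show ?thesis unfolding fps_pos_def using m n by (intro exI[of _ m]) auto
  next
    case 2 then show ?thesis unfolding fps_pos_def using m n by (intro exI[of _ m]) auto
  next
    case 3 then show ?thesis unfolding fps_pos_def using m n by (intro exI[of _ n]) auto
  qed
qed

lemma fps_pos_mult:
  assumes "fps_pos f" "fps_pos g" shows "fps_pos (f * g)"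
proof -
  from assms obtain m n where
    m: "0 < fps_nth f m" "\<And>k. k < m \<Longrightarrow> fps_nth f k = 0" and
    n: "0 < fps_nth g n" "\<And>k. k < n \<Longrightarrow> fps_nth g k = 0"
    unfolding fps_pos_def by auto
  have "fps_nth (f * g) k = 0" if "k < m + n" for k
    unfolding fps_mult_nth
  proof (rule sum.neutral, safe)
    fix i assume "i \<in> {0..k}"
    then have "i < m \<or> k - i < n" using that by auto
    then show "fps_nth f i * fps_nth g (k - i) = 0" using m n by auto
  qed
  moreover have "fps_nth (f * g) (m + n) = fps_nth f m * fps_nth g n"
  proof -
    have "fps_nth f i * fps_nth g (m + n - i) = 0" if "i \<in> {0..m + n} - {m}" for i
    proof -
      have "i < m \<or> m + n - i < n" using that by auto
      then show ?thesis using m n by auto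
    qed
    then have "(\<Sum>i\<in>{0..m + n}. fps_nth f i * fps_nth g (m + n - i)) =
        (\<Sum>i\<in>{m}. fps_nth f i * fps_nth g (m + n - i))"
      by (intro sum.mono_neutral_right) auto
    then show ?thesis by (simp add: fps_mult_nth)
  qed
  ultimately show ?thesis
    unfolding fps_pos_def using m n by (intro exI[of _ "m + n"]) auto
qed

lemma fps_pos_cases: "f = 0 \<or> fps_pos f \<or> fps_pos (- f)"
proof (cases "f = 0")
  case False
  then obtain n where "fps_nth f n \<noteq> 0" "\<forall>m<n. fps_nth f m = 0"
    using fps_nonzero_nth_minimal by blast
  then show ?thesis
    unfolding fps_pos_def by (cases "0 < fps_nth f n") (auto intro!: exI[of _ n])
qed simp

lemma not_fps_pos_0: "\<not> fps_pos 0"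
  by (simp add: fps_pos_def)

lemma fps_pos_asym: "fps_pos f \<Longrightarrow> \<not> fps_pos (- f)"
  using fps_pos_add[of f "- f"] not_fps_pos_0 by auto

instantiation fps :: (linordered_idom) linordered_idom
begin

definition less_fps_def: "f < g \<longleftrightarrow> fps_pos (g - f)" for f g :: "'a fps"
definition less_eq_fps_def: "f \<le> g \<longleftrightarrow> f = g \<or> fps_pos (g - f)" for f g :: "'a fps"
definition abs_fps_def: "\<bar>f\<bar> = (if f < 0 then - f else f)" for f :: "'a fps"
definition sgn_fps_def: "sgn f = (if f = 0 then 0 else if 0 < f then 1 else - 1)" for f :: "'a fps"

instance
proof
  fix f g h :: "'a fps"
  show "f < g \<longleftrightarrow> f \<le> g \<and> \<not> g \<le> f"
    using fps_pos_asym[of "g - f"] not_fps_pos_0 by (auto simp: less_fps_def less_eq_fps_def)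
  show "f \<le> f" by (simp add: less_eq_fps_def)
  show "f \<le> g \<Longrightarrow> g \<le> h \<Longrightarrow> f \<le> h"
    using fps_pos_add[of "g - f" "h - g"] by (auto simp: less_eq_fps_def)
  show "f \<le> g \<Longrightarrow> g \<le> f \<Longrightarrow> f = g"
    using fps_pos_asym[of "g - f"] by (auto simp: less_eq_fps_def)
  show "f \<le> g \<or> g \<le> f"
    using fps_pos_cases[of "g - f"] by (auto simp: less_eq_fps_def)
  show "f \<le> g \<Longrightarrow> h + f \<le> h + g" by (auto simp: less_eq_fps_def)
  show "f < g \<Longrightarrow> 0 < h \<Longrightarrow> h * f < h * g"
    using fps_pos_mult[of h "g - f"] by (auto simp: less_fps_def algebra_simps)
qed (auto simp: abs_fps_def sgn_fps_def)

end

section \<open>\<open>C\<close>-modules and \<open>*\<close>-algebras\<close>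

text \<open>Modules and algebras are carried by subsets of an abelian group type, with the addition of that
  type. All operations are constrained on the carriers only.\<close>

definition c_module :: "'x::ab_group_add set \<Rightarrow> ('c::comm_ring_1 \<Rightarrow> 'x \<Rightarrow> 'x) \<Rightarrow> bool" where
  "c_module X s \<longleftrightarrow> 0 \<in> X \<and> (\<forall>x\<in>X. \<forall>y\<in>X. x + y \<in> X) \<and> (\<forall>x\<in>X. - x \<in> X) \<and>
     (\<forall>c. \<forall>x\<in>X. s c x \<in> X) \<and>
     (\<forall>c. \<forall>x\<in>X. \<forall>y\<in>X. s c (x + y) = s c x + s c y) \<and>
     (\<forall>c d. \<forall>x\<in>X. s (c + d) x = s c x + s d x) \<and>
     (\<forall>c d. \<forall>x\<in>X. s (c * d) x = s c (s d x)) \<and>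
     (\<forall>x\<in>X. s 1 x = x)"

definition linear_map ::
    "('c \<Rightarrow> 'x \<Rightarrow> 'x) \<Rightarrow> ('c \<Rightarrow> 'y \<Rightarrow> 'y) \<Rightarrow> 'x::plus set \<Rightarrow> 'y::plus set \<Rightarrow> ('x \<Rightarrow> 'y) \<Rightarrow> bool" where
  "linear_map sX sY X Y f \<longleftrightarrow> (\<forall>x\<in>X. f x \<in> Y) \<and> (\<forall>x\<in>X. \<forall>y\<in>X. f (x + y) = f x + f y) \<and>
     (\<forall>c. \<forall>x\<in>X. f (sX c x) = sY c (f x))"

definition bilinear_map ::
    "('c \<Rightarrow> 'x \<Rightarrow> 'x) \<Rightarrow> ('c \<Rightarrow> 'y \<Rightarrow> 'y) \<Rightarrow> ('c \<Rightarrow> 'z \<Rightarrow> 'z) \<Rightarrow> 'x::plus set \<Rightarrow> 'y::plus set \<Rightarrow>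
      'z::plus set \<Rightarrow> ('x \<Rightarrow> 'y \<Rightarrow> 'z) \<Rightarrow> bool" where
  "bilinear_map sX sY sZ X Y Z f \<longleftrightarrow>
     (\<forall>x\<in>X. linear_map sY sZ Y Z (f x)) \<and> (\<forall>y\<in>Y. linear_map sX sZ X Z (\<lambda>x. f x y))"

record ('r, 'a) star_alg =
  acarrier :: "'a set"
  amult :: "'a \<Rightarrow> 'a \<Rightarrow> 'a"
  ascale :: "'r cext \<Rightarrow> 'a \<Rightarrow> 'a"
  astar :: "'a \<Rightarrow> 'a"

definition star_algebra :: "('r::linordered_idom, 'a::ab_group_add) star_alg \<Rightarrow> bool" where
  "star_algebra A \<longleftrightarrow>
     c_module (acarrier A) (ascale A) \<and>
     bilinear_map (ascale A) (ascale A) (ascale A) (acarrier A) (acarrier A) (acarrier A) (amult A) \<and>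
     (\<forall>a\<in>acarrier A. \<forall>b\<in>acarrier A. \<forall>c\<in>acarrier A.
        amult A (amult A a b) c = amult A a (amult A b c)) \<and>
     linear_map (ascale A) (\<lambda>c. ascale A (cconj c)) (acarrier A) (acarrier A) (astar A) \<and>
     (\<forall>a\<in>acarrier A. astar A (astar A a) = a) \<and>
     (\<forall>a\<in>acarrier A. \<forall>b\<in>acarrier A. astar A (amult A a b) = amult A (astar A b) (astar A a))"

definition is_one :: "('r, 'a) star_alg \<Rightarrow> 'a \<Rightarrow> bool" where
  "is_one A e \<longleftrightarrow> e \<in> acarrier A \<and> (\<forall>a\<in>acarrier A. amult A e a = a \<and> amult A a e = a)"

definition unital_star_algebra :: "('r::linordered_idom, 'a::ab_group_add) star_alg \<Rightarrow> bool" where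
  "unital_star_algebra A \<longleftrightarrow> star_algebra A \<and> (\<exists>e. is_one A e)"

definition positive_functional ::
    "('r::linordered_idom, 'a::ab_group_add) star_alg \<Rightarrow> ('a \<Rightarrow> 'r cext) \<Rightarrow> bool" where
  "positive_functional A \<omega> \<longleftrightarrow> linear_map (ascale A) (*) (acarrier A) UNIV \<omega> \<and>
     (\<forall>a\<in>acarrier A. cnonneg (\<omega> (amult A (astar A a) a)))"

definition positive_elements :: "('r::linordered_idom, 'a::ab_group_add) star_alg \<Rightarrow> 'a set" where
  "positive_elements A = {a \<in> acarrier A. astar A a = a \<and>
     (\<forall>\<omega>. positive_functional A \<omega> \<longrightarrow> cnonneg (\<omega> a))}"

section \<open>Right modules\<close>

record ('r, 'a, 'm) right_mod =
  mcarrier :: "'m set"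
  mscale :: "'r cext \<Rightarrow> 'm \<Rightarrow> 'm"
  mact :: "'m \<Rightarrow> 'a \<Rightarrow> 'm"

text \<open>The last clause makes modules over a unital algebra unital; the unit is not part of the data
  because a deformation of an algebra also deforms its unit.\<close>

definition right_module ::
    "('r::linordered_idom, 'a::ab_group_add) star_alg \<Rightarrow> ('r, 'a, 'm::ab_group_add) right_mod \<Rightarrow> bool" where
  "right_module A M \<longleftrightarrow>
     c_module (mcarrier M) (mscale M) \<and>
     bilinear_map (mscale M) (ascale A) (mscale M) (mcarrier M) (acarrier A) (mcarrier M) (mact M) \<and>
     (\<forall>x\<in>mcarrier M. \<forall>a\<in>acarrier A. \<forall>b\<in>acarrier A. mact M (mact M x a) b = mact M x (amult A a b)) \<and>
     (\<forall>e. is_one A e \<longrightarrow> (\<forall>x\<in>mcarrier M. mact M x e = x))"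

definition right_mod_hom ::
    "('r, 'a) star_alg \<Rightarrow> ('r, 'a, 'm::ab_group_add) right_mod \<Rightarrow> ('r, 'a, 'k::ab_group_add) right_mod \<Rightarrow>
      ('m \<Rightarrow> 'k) \<Rightarrow> bool" where
  "right_mod_hom A M N f \<longleftrightarrow>
     linear_map (mscale M) (mscale N) (mcarrier M) (mcarrier N) f \<and>
     (\<forall>x\<in>mcarrier M. \<forall>a\<in>acarrier A. f (mact M x a) = mact N (f x) a)"

definition finitely_generated ::
    "('r, 'a) star_alg \<Rightarrow> ('r, 'a, 'm::ab_group_add) right_mod \<Rightarrow> bool" where
  "finitely_generated A M \<longleftrightarrow> (\<exists>G. finite G \<and> G \<subseteq> mcarrier M \<and>
     (\<forall>x\<in>mcarrier M. \<exists>c. (\<forall>g\<in>G. c g \<in> acarrier A) \<and> x = (\<Sum>g\<in>G. mact M g (c g))))"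

text \<open>The lifting property against epimorphisms \<open>N \<rightarrow> L\<close> of right modules carried by the types \<open>'k\<close> and
  \<open>'l\<close>. As HOL cannot quantify over types, a module is projective if this holds with \<open>'k\<close> and \<open>'l\<close>
  arbitrary, that is, as type variables of a theorem.\<close>

definition projective_wrt ::
    "'k::ab_group_add itself \<Rightarrow> 'l::ab_group_add itself \<Rightarrow> ('r::linordered_idom, 'a::ab_group_add) star_alg \<Rightarrow>
      ('r, 'a, 'm::ab_group_add) right_mod \<Rightarrow> bool" where
  "projective_wrt _ _ A M \<longleftrightarrow>
     (\<forall>(N :: ('r, 'a, 'k) right_mod) (L :: ('r, 'a, 'l) right_mod) p f.
        right_module A N \<and> right_module A L \<and>
        right_mod_hom A N L p \<and> p ` mcarrier N = mcarrier L \<and> right_mod_hom A M L f \<longrightarrow>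
        (\<exists>g. right_mod_hom A M N g \<and> (\<forall>x\<in>mcarrier M. p (g x) = f x)))"

definition hermitian_inner_product ::
    "('r::linordered_idom, 'a::ab_group_add) star_alg \<Rightarrow> ('r, 'a, 'm::ab_group_add) right_mod \<Rightarrow>
      ('m \<Rightarrow> 'm \<Rightarrow> 'a) \<Rightarrow> bool" where
  "hermitian_inner_product A M h \<longleftrightarrow>
     (\<forall>x\<in>mcarrier M. linear_map (mscale M) (ascale A) (mcarrier M) (acarrier A) (h x)) \<and>
     (\<forall>x\<in>mcarrier M. \<forall>y\<in>mcarrier M. h x y = astar A (h y x)) \<and>
     (\<forall>x\<in>mcarrier M. \<forall>y\<in>mcarrier M. \<forall>a\<in>acarrier A. h x (mact M y a) = amult A (h x y) a) \<and>
     (\<forall>x\<in>mcarrier M. h x x \<in> positive_elements A)"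

text \<open>\<open>End\<^sub>A(M)\<close>: homomorphisms are only determined on the carrier, hence extensional functions.\<close>

definition module_End ::
    "('r, 'a) star_alg \<Rightarrow> ('r, 'a, 'm::ab_group_add) right_mod \<Rightarrow> ('m \<Rightarrow> 'm) set" where
  "module_End A M = {f \<in> extensional (mcarrier M). right_mod_hom A M M f}"

definition End_iso ::
    "('r, 'b::plus) star_alg \<Rightarrow> ('r, 'a) star_alg \<Rightarrow> ('r, 'a, 'm::ab_group_add) right_mod \<Rightarrow>
      ('b \<Rightarrow> 'm \<Rightarrow> 'm) \<Rightarrow> bool" where
  "End_iso B A M \<Phi> \<longleftrightarrow>
     bij_betw \<Phi> (acarrier B) (module_End A M) \<and>
     (\<forall>b\<in>acarrier B. \<forall>c\<in>acarrier B. \<Phi> (amult B b c) = compose (mcarrier M) (\<Phi> b) (\<Phi> c)) \<and>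
     (\<forall>b\<in>acarrier B. \<forall>c\<in>acarrier B. \<forall>x\<in>mcarrier M. \<Phi> (b + c) x = \<Phi> b x + \<Phi> c x) \<and>
     (\<forall>z. \<forall>b\<in>acarrier B. \<forall>x\<in>mcarrier M. \<Phi> (ascale B z b) x = mscale M z (\<Phi> b x))"

section \<open>Matrices over \<open>A\<close>, and the module \<open>P\<^sub>0 A\<^sup>n\<close>\<close>

definition mat_mult :: "('r, 'a::comm_monoid_add) star_alg \<Rightarrow> 'a^'n^'n \<Rightarrow> 'a^'n^'n \<Rightarrow> 'a^'n^'n" where
  "mat_mult A M N = (\<chi> i j. \<Sum>k\<in>UNIV. amult A (M $ i $ k) (N $ k $ j))"

definition mat_vec :: "('r, 'a::comm_monoid_add) star_alg \<Rightarrow> 'a^'n^'n \<Rightarrow> 'a^'n \<Rightarrow> 'a^'n" where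
  "mat_vec A M x = (\<chi> i. \<Sum>k\<in>UNIV. amult A (M $ i $ k) (x $ k))"

definition matrix_algebra :: "('r, 'a::ab_group_add) star_alg \<Rightarrow> ('r, 'a^'n^'n) star_alg" where
  "matrix_algebra A = \<lparr>acarrier = {M. \<forall>i j. M $ i $ j \<in> acarrier A}, amult = mat_mult A,
     ascale = (\<lambda>c M. \<chi> i j. ascale A c (M $ i $ j)), astar = (\<lambda>M. \<chi> i j. astar A (M $ j $ i))\<rparr>"

definition free_module :: "('r, 'a::ab_group_add) star_alg \<Rightarrow> ('r, 'a, 'a^'n) right_mod" where
  "free_module A = \<lparr>mcarrier = {x. \<forall>i. x $ i \<in> acarrier A},
     mscale = (\<lambda>c x. \<chi> i. ascale A c (x $ i)), mact = (\<lambda>x a. \<chi> i. amult A (x $ i) a)\<rparr>"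

definition projection_module ::
    "('r, 'a::ab_group_add) star_alg \<Rightarrow> 'a^'n^'n \<Rightarrow> ('r, 'a, 'a^'n) right_mod" where
  "projection_module A P = (free_module A)\<lparr>mcarrier := mat_vec A P ` mcarrier (free_module A)\<rparr>"

definition canonical_inner_product ::
    "('r, 'a::comm_monoid_add) star_alg \<Rightarrow> 'a^'n \<Rightarrow> 'a^'n \<Rightarrow> 'a" where
  "canonical_inner_product A x y = (\<Sum>i\<in>UNIV. amult A (astar A (x $ i)) (y $ i))"

definition corner_algebra ::
    "('r, 'a::ab_group_add) star_alg \<Rightarrow> 'a^'n^'n \<Rightarrow> ('r, 'a^'n^'n) star_alg" where
  "corner_algebra A P = (matrix_algebra A)\<lparr>acarrier :=
     (\<lambda>M. mat_mult A P (mat_mult A M P)) ` acarrier (matrix_algebra A)\<rparr>"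

text \<open>The identification \<open>End\<^sub>A(P A\<^sup>n) = P M\<^sub>n(A) P\<close>, where matrices act by \<^const>\<open>mat_vec\<close>.\<close>

lemma corner_algebra_End_iso:
  fixes A :: "('r::linordered_idom, 'a::ab_group_add) star_alg" and P :: "'a^'n^'n"
  assumes A: "unital_star_algebra A" and P: "P \<in> acarrier (matrix_algebra A)"
    and PP: "P = amult (matrix_algebra A) P P"
  shows "End_iso (corner_algebra A P) A (projection_module A P)
    (\<lambda>M. restrict (mat_vec A M) (mcarrier (projection_module A P)))"
proof -
  let ?S = "acarrier A" and ?m = "amult A"
  let ?V = "{x::'a^'n. \<forall>i. x $ i \<in> ?S}" and ?W = "{M::'a^'n^'n. \<forall>i j. M $ i $ j \<in> ?S}"
  define ES where "ES = mat_vec A P ` ?V"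
  define BS where "BS = (\<lambda>M. mat_mult A P (mat_mult A M P)) ` ?W"
  let ?s = "\<lambda>c (x::'a^'n). \<chi> i. ascale A c (x $ i)"
  let ?act = "\<lambda>(x::'a^'n) a. \<chi> i. ?m (x $ i) a"
  note D = unital_star_algebra_def star_algebra_def c_module_def bilinear_map_def linear_map_def
  have cl0: "0 \<in> ?S" and cla: "\<And>x y. x \<in> ?S \<Longrightarrow> y \<in> ?S \<Longrightarrow> x + y \<in> ?S"
    and clm: "\<And>x y. x \<in> ?S \<Longrightarrow> y \<in> ?S \<Longrightarrow> ?m x y \<in> ?S"
    and cls: "\<And>c x. x \<in> ?S \<Longrightarrow> ascale A c x \<in> ?S"
    and sa: "\<And>c x y. x \<in> ?S \<Longrightarrow> y \<in> ?S \<Longrightarrow> ascale A c (x + y) = ascale A c x + ascale A c y"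
    and ml: "\<And>x y z. x \<in> ?S \<Longrightarrow> y \<in> ?S \<Longrightarrow> z \<in> ?S \<Longrightarrow> ?m (x + y) z = ?m x z + ?m y z"
    and mr: "\<And>x y z. x \<in> ?S \<Longrightarrow> y \<in> ?S \<Longrightarrow> z \<in> ?S \<Longrightarrow> ?m z (x + y) = ?m z x + ?m z y"
    and sl: "\<And>c x y. x \<in> ?S \<Longrightarrow> y \<in> ?S \<Longrightarrow> ?m (ascale A c x) y = ascale A c (?m x y)"
    and sr: "\<And>c x y. x \<in> ?S \<Longrightarrow> y \<in> ?S \<Longrightarrow> ?m x (ascale A c y) = ascale A c (?m x y)"
    and as: "\<And>x y z. x \<in> ?S \<Longrightarrow> y \<in> ?S \<Longrightarrow> z \<in> ?S \<Longrightarrow> ?m (?m x y) z = ?m x (?m y z)"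
    using A unfolding D by simp_all
  obtain e where e: "e \<in> ?S" "\<And>x. x \<in> ?S \<Longrightarrow> ?m e x = x" "\<And>x. x \<in> ?S \<Longrightarrow> ?m x e = x"
    using A unfolding unital_star_algebra_def is_one_def by blast
  have ml0: "?m 0 z = 0" and mr0: "?m z 0 = 0" if "z \<in> ?S" for z
    using ml[OF cl0 cl0 that] mr[OF cl0 cl0 that] by auto
  have s0: "ascale A c 0 = 0" for c using sa[OF cl0 cl0, of c] by auto
  have cl: "sum f I \<in> ?S" if "\<And>i. i \<in> I \<Longrightarrow> f i \<in> ?S" for f :: "'n \<Rightarrow> 'a" and I
    using that by (induction I rule: infinite_finite_induct) (auto simp: cl0 cla)
  have suml: "?m (sum f I) z = (\<Sum>i\<in>I. ?m (f i) z)"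
    if "\<And>i. f i \<in> ?S" "z \<in> ?S" for f :: "'n \<Rightarrow> 'a" and I z
    by (induction I rule: infinite_finite_induct) (auto simp: that ml0 ml cl)
  have sumr: "?m z (sum f I) = (\<Sum>i\<in>I. ?m z (f i))"
    if "\<And>i. f i \<in> ?S" "z \<in> ?S" for f :: "'n \<Rightarrow> 'a" and I z
    by (induction I rule: infinite_finite_induct) (auto simp: that mr0 mr cl)
  have sums: "ascale A c (sum f I) = (\<Sum>i\<in>I. ascale A c (f i))"
    if "\<And>i. f i \<in> ?S" for f :: "'n \<Rightarrow> 'a" and I c
    by (induction I rule: infinite_finite_induct) (auto simp: that s0 sa cl)
  have PW: "P \<in> ?W" using P by (simp add: matrix_algebra_def)
  have PP': "mat_mult A P P = P" using PP by (simp add: matrix_algebra_def)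
  have mvV: "mat_vec A M x \<in> ?V" if "M \<in> ?W" "x \<in> ?V" for M x
    using that by (auto simp: mat_vec_def intro!: cl clm)
  have mmW: "mat_mult A M N \<in> ?W" if "M \<in> ?W" "N \<in> ?W" for M N
    using that by (auto simp: mat_mult_def intro!: cl clm)
  have mv_assoc: "mat_vec A (mat_mult A M N) x = mat_vec A M (mat_vec A N x)"
    if "M \<in> ?W" "N \<in> ?W" "x \<in> ?V" for M N x
  proof -
    have "(\<Sum>k\<in>UNIV. ?m (\<Sum>j\<in>UNIV. ?m (M$i$j) (N$j$k)) (x$k)) =
        (\<Sum>j\<in>UNIV. ?m (M$i$j) (\<Sum>k\<in>UNIV. ?m (N$j$k) (x$k)))" for i
    proof -
      have "(\<Sum>k\<in>UNIV. ?m (\<Sum>j\<in>UNIV. ?m (M$i$j) (N$j$k)) (x$k)) =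
          (\<Sum>k\<in>UNIV. \<Sum>j\<in>UNIV. ?m (M$i$j) (?m (N$j$k) (x$k)))"
        using that by (subst suml) (auto simp: clm as)
      also have "\<dots> = (\<Sum>j\<in>UNIV. \<Sum>k\<in>UNIV. ?m (M$i$j) (?m (N$j$k) (x$k)))" by (rule sum.swap)
      also have "\<dots> = (\<Sum>j\<in>UNIV. ?m (M$i$j) (\<Sum>k\<in>UNIV. ?m (N$j$k) (x$k)))"
        using that by (subst sumr) (auto simp: clm)
      finally show ?thesis .
    qed
    then show ?thesis by (simp add: mat_vec_def mat_mult_def)
  qed
  have col: "(\<chi> i. mat_mult A M N $ i $ j) = mat_vec A M (\<chi> i. N $ i $ j)" for M N :: "'a^'n^'n" and j
    by (simp add: mat_mult_def mat_vec_def)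
  have mm_assoc: "mat_mult A (mat_mult A M N) K = mat_mult A M (mat_mult A N K)"
    if "M \<in> ?W" "N \<in> ?W" "K \<in> ?W" for M N K
  proof -
    have "(\<chi> i. mat_mult A (mat_mult A M N) K $ i $ j) = (\<chi> i. mat_mult A M (mat_mult A N K) $ i $ j)" for j
      unfolding col using mv_assoc[OF that(1,2), of "\<chi> i. K $ i $ j"] that(3) by simp
    then show ?thesis by (simp add: vec_eq_iff)
  qed
  have E: "x \<in> ES \<longleftrightarrow> x \<in> ?V \<and> mat_vec A P x = x" for x
    using mv_assoc[OF PW PW] PP' mvV[OF PW] by (auto simp: ES_def image_iff)
  have B: "M \<in> BS \<longleftrightarrow> M \<in> ?W \<and> mat_mult A P M = M \<and> mat_mult A M P = M" for M
  proof
    assume "M \<in> BS"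
    then obtain N where N: "N \<in> ?W" "M = mat_mult A P (mat_mult A N P)" unfolding BS_def by blast
    have "mat_mult A P M = M" unfolding N(2)
      using mm_assoc[OF PW PW mmW[OF N(1) PW]] PP' by simp
    moreover have "mat_mult A M P = M" unfolding N(2)
      using mm_assoc[OF PW mmW[OF N(1) PW] PW] mm_assoc[OF N(1) PW PW] PP' by simp
    ultimately show "M \<in> ?W \<and> mat_mult A P M = M \<and> mat_mult A M P = M"
      using mmW[OF PW mmW[OF N(1) PW]] N(2) by simp
  qed (metis (no_types, lifting) BS_def image_eqI)
  have hom: "right_mod_hom A (projection_module A P) (projection_module A P) f \<longleftrightarrow>
      (\<forall>x\<in>ES. f x \<in> ES) \<and> (\<forall>x\<in>ES. \<forall>y\<in>ES. f (x + y) = f x + f y) \<and>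
      (\<forall>c. \<forall>x\<in>ES. f (?s c x) = ?s c (f x)) \<and> (\<forall>x\<in>ES. \<forall>a\<in>?S. f (?act x a) = ?act (f x) a)" for f
    unfolding right_mod_hom_def linear_map_def projection_module_def free_module_def ES_def[symmetric]
    by (simp add: ES_def[symmetric])
  have mv_add: "mat_vec A M (x + y) = mat_vec A M x + mat_vec A M y"
    if "M \<in> ?W" "x \<in> ?V" "y \<in> ?V" for M x y
    using that by (auto simp: mat_vec_def vec_eq_iff mr sum.distrib)
  have mv_add': "mat_vec A (M + N) x = mat_vec A M x + mat_vec A N x"
    if "M \<in> ?W" "N \<in> ?W" "x \<in> ?V" for M N x
    using that by (auto simp: mat_vec_def vec_eq_iff ml sum.distrib)
  have mv_s: "mat_vec A M (?s c x) = ?s c (mat_vec A M x)" if "M \<in> ?W" "x \<in> ?V" for M x c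
    using that by (auto simp: mat_vec_def vec_eq_iff sr clm sums)
  have mv_s': "mat_vec A (\<chi> i j. ascale A c (M $ i $ j)) x = ?s c (mat_vec A M x)"
    if "M \<in> ?W" "x \<in> ?V" for M x c
    using that by (auto simp: mat_vec_def vec_eq_iff sl clm sums)
  have mv_act: "mat_vec A M (?act x a) = ?act (mat_vec A M x) a"
    if "M \<in> ?W" "x \<in> ?V" "a \<in> ?S" for M x a
    using that by (auto simp: mat_vec_def vec_eq_iff as clm suml)
  have BE: "mat_vec A M x \<in> ES" if "M \<in> BS" "x \<in> ES" for M x
    using that mv_assoc[OF PW, of M x] mvV[of M x] unfolding E B by auto
  have addE: "x + y \<in> ES" if "x \<in> ES" "y \<in> ES" for x y
    using that mv_add[OF PW, of x y] unfolding E by (auto intro: cla)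
  have sE: "?s c x \<in> ES" if "x \<in> ES" for x c
    using that mv_s[OF PW, of x c] unfolding E by (auto intro: cls)
  have actE: "?act x a \<in> ES" if "x \<in> ES" "a \<in> ?S" for x a
    using that mv_act[OF PW, of x a] unfolding E by (auto intro: clm)
  have E0: "0 \<in> ES" unfolding E using cl0 by (auto simp: mat_vec_def vec_eq_iff ml0 mr0 PW[simplified])
  let ?R = "\<lambda>M. restrict (mat_vec A M) ES"
  have EV: "x \<in> ?V" if "x \<in> ES" for x using that unfolding E by blast
  have BW: "M \<in> ?W" if "M \<in> BS" for M using that unfolding B by blast
  have colP: "(\<chi> i. P $ i $ j) \<in> ES" for j
    unfolding E using col[of P P j] PW by (auto simp: PP')
  have inj: "inj_on ?R BS"
  proof (rule inj_onI)
    fix M N assume MN: "M \<in> BS" "N \<in> BS" "?R M = ?R N"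
    have "mat_vec A M (\<chi> i. P $ i $ j) = mat_vec A N (\<chi> i. P $ i $ j)" for j
      using fun_cong[OF MN(3), of "\<chi> i. P $ i $ j"] by (simp only: restrict_apply'[OF colP])
    then have "mat_mult A M P = mat_mult A N P"
      unfolding col[symmetric] by (simp add: vec_eq_iff)
    moreover have "mat_mult A M P = M" using MN(1) unfolding B by blast
    moreover have "mat_mult A N P = N" using MN(2) unfolding B by blast
    ultimately show "M = N" by simp
  qed
  have mem: "?R M \<in> module_End A (projection_module A P)" if M: "M \<in> BS" for M
    unfolding module_End_def mem_Collect_eq hom
    using mv_add[OF BW[OF M]] mv_s[OF BW[OF M]] mv_act[OF BW[OF M]] BE[OF M] addE sE actE EV
    by (simp add: projection_module_def free_module_def ES_def[symmetric])
  have surj: "f \<in> ?R ` BS" if f: "f \<in> module_End A (projection_module A P)" for f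
  proof -
    from f have ext: "f \<in> extensional ES"
      and fE: "\<And>x. x \<in> ES \<Longrightarrow> f x \<in> ES"
      and fadd: "\<And>x y. x \<in> ES \<Longrightarrow> y \<in> ES \<Longrightarrow> f (x + y) = f x + f y"
      and fact: "\<And>x a. x \<in> ES \<Longrightarrow> a \<in> ?S \<Longrightarrow> f (?act x a) = ?act (f x) a"
      unfolding module_End_def mem_Collect_eq hom
      by (auto simp: projection_module_def free_module_def ES_def[symmetric])
    have f0: "f 0 = 0" using fadd[OF E0 E0] by simp
    have fsum: "f (sum g I) = (\<Sum>i\<in>I. f (g i)) \<and> sum g I \<in> ES"
      if "\<And>i. g i \<in> ES" for g :: "'n \<Rightarrow> 'a^'n" and I
      by (induction I rule: infinite_finite_induct) (use that f0 E0 fadd addE in auto)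
    define M where "M = (\<chi> i j. f (\<chi> i. P $ i $ j) $ i)"
    have Mcol: "(\<chi> i. M $ i $ j) = f (\<chi> i. P $ i $ j)" for j by (simp add: M_def)
    have MW: "M \<in> ?W" using EV[OF fE[OF colP]] by (simp add: M_def)
    have fM: "f x = mat_vec A M x" if x: "x \<in> ES" for x
    proof -
      have decomp: "mat_vec A N x = (\<Sum>j\<in>UNIV. ?act (\<chi> i. N $ i $ j) (x $ j))" for N :: "'a^'n^'n"
        by (simp add: mat_vec_def vec_eq_iff)
      have "f x = f (\<Sum>j\<in>UNIV. ?act (\<chi> i. P $ i $ j) (x $ j))"
        using x decomp[of P] unfolding E by simp
      also have "\<dots> = (\<Sum>j\<in>UNIV. ?act (f (\<chi> i. P $ i $ j)) (x $ j))"
        using fsum[of "\<lambda>j. ?act (\<chi> i. P $ i $ j) (x $ j)" UNIV] fact[OF colP] actE[OF colP] EV[OF x]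
        by simp
      also have "\<dots> = mat_vec A M x" unfolding decomp Mcol[symmetric] ..
      finally show ?thesis .
    qed
    have "(\<chi> i. mat_mult A P M $ i $ j) = (\<chi> i. M $ i $ j)" for j
      unfolding col Mcol using fE[OF colP] E by blast
    then have "mat_mult A P M = M" by (simp add: vec_eq_iff)
    moreover have "(\<chi> i. mat_mult A M P $ i $ j) = (\<chi> i. M $ i $ j)" for j
      unfolding col Mcol fM[OF colP] ..
    then have "mat_mult A M P = M" by (simp add: vec_eq_iff)
    ultimately have "M \<in> BS" using MW B by blast
    moreover have "f = ?R M"
      using ext fM by (intro extensionalityI[of _ ES]) auto
    ultimately show ?thesis by blast
  qed
  have "bij_betw ?R BS (module_End A (projection_module A P))"
    unfolding bij_betw_def using inj mem surj by blast
  moreover have "?R (mat_mult A M N) = compose ES (?R M) (?R N)" if "M \<in> BS" "N \<in> BS" for M N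
    using mv_assoc[OF BW[OF that(1)] BW[OF that(2)] EV] BE[OF that(2)]
    by (auto simp: compose_def fun_eq_iff)
  moreover have "?R (M + N) x = ?R M x + ?R N x" if "M \<in> BS" "N \<in> BS" "x \<in> ES" for M N x
    using mv_add'[OF BW[OF that(1)] BW[OF that(2)] EV[OF that(3)]] that(3) by simp
  moreover have "?R (\<chi> i j. ascale A c (M $ i $ j)) x = ?s c (?R M x)"
    if "M \<in> BS" "x \<in> ES" for M x c
    using mv_s'[OF BW[OF that(1)] EV[OF that(2)]] that(2) by simp
  ultimately show ?thesis
    unfolding End_iso_def
    by (simp add: corner_algebra_def matrix_algebra_def projection_module_def free_module_def
        ES_def[symmetric] BS_def[symmetric])
qed

section \<open>Formal deformations\<close>

text \<open>\<open>X[[\<lambda>]]\<close> is the set of power series with coefficients in \<open>X\<close>.\<close>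

definition fps_carrier :: "'x set \<Rightarrow> 'x fps set" where
  "fps_carrier X = {f. \<forall>n. fps_nth f n \<in> X}"

text \<open>The action of \<open>C[[\<lambda>]] = R[[\<lambda>]](i)\<close>; the \<open>k\<close>-th coefficient of \<open>c\<close> is
  \<open>CExt (fps_nth (cre c) k) (fps_nth (cim c) k)\<close>.\<close>

definition fps_scale ::
    "('r cext \<Rightarrow> 'x \<Rightarrow> 'x) \<Rightarrow> 'r fps cext \<Rightarrow> 'x::comm_monoid_add fps \<Rightarrow> 'x fps" where
  "fps_scale s c f = Abs_fps (\<lambda>n. \<Sum>k\<le>n. s (CExt (fps_nth (cre c) k) (fps_nth (cim c) k)) (fps_nth f (n - k)))"

text \<open>The \<open>C[[\<lambda>]]\<close>-linear, respectively \<open>C[[\<lambda>]]\<close>-bilinear or sesquilinear, extensions of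
  \<open>\<Sum>\<^sub>r \<lambda>\<^sup>r T\<^sub>r\<close> and \<open>\<Sum>\<^sub>r \<lambda>\<^sup>r C\<^sub>r\<close> to power series.\<close>

definition fps_extend :: "(nat \<Rightarrow> 'x \<Rightarrow> 'y) \<Rightarrow> 'x fps \<Rightarrow> 'y::comm_monoid_add fps" where
  "fps_extend T f = Abs_fps (\<lambda>n. \<Sum>r\<le>n. T r (fps_nth f (n - r)))"

definition fps_extend2 :: "(nat \<Rightarrow> 'x \<Rightarrow> 'y \<Rightarrow> 'z) \<Rightarrow> 'x fps \<Rightarrow> 'y fps \<Rightarrow> 'z::comm_monoid_add fps" where
  "fps_extend2 C f g =
     Abs_fps (\<lambda>n. \<Sum>r\<le>n. \<Sum>i\<le>n - r. C r (fps_nth f i) (fps_nth g (n - r - i)))"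

definition deformed_algebra ::
    "('r, 'a::comm_monoid_add) star_alg \<Rightarrow> (nat \<Rightarrow> 'a \<Rightarrow> 'a \<Rightarrow> 'a) \<Rightarrow> ('r fps, 'a fps) star_alg" where
  "deformed_algebra A C = \<lparr>acarrier = fps_carrier (acarrier A), amult = fps_extend2 C,
     ascale = fps_scale (ascale A), astar = (\<lambda>f. Abs_fps (\<lambda>n. astar A (fps_nth f n)))\<rparr>"

definition deformed_module ::
    "('r, 'a, 'm::comm_monoid_add) right_mod \<Rightarrow> (nat \<Rightarrow> 'm \<Rightarrow> 'a \<Rightarrow> 'm) \<Rightarrow> ('r fps, 'a fps, 'm fps) right_mod" where
  "deformed_module M \<rho> = \<lparr>mcarrier = fps_carrier (mcarrier M), mscale = fps_scale (mscale M),
     mact = fps_extend2 \<rho>\<rparr>"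

definition formal_deformation ::
    "('r, 'a::ab_group_add) star_alg \<Rightarrow> (nat \<Rightarrow> 'a \<Rightarrow> 'a \<Rightarrow> 'a) \<Rightarrow> bool" where
  "formal_deformation A C \<longleftrightarrow>
     (\<forall>a\<in>acarrier A. \<forall>b\<in>acarrier A. C 0 a b = amult A a b) \<and>
     (\<forall>r. bilinear_map (ascale A) (ascale A) (ascale A) (acarrier A) (acarrier A) (acarrier A) (C r)) \<and>
     (\<forall>a\<in>fps_carrier (acarrier A). \<forall>b\<in>fps_carrier (acarrier A). \<forall>c\<in>fps_carrier (acarrier A).
        fps_extend2 C (fps_extend2 C a b) c = fps_extend2 C a (fps_extend2 C b c))"

definition hermitian_deformation ::
    "('r, 'a::ab_group_add) star_alg \<Rightarrow> (nat \<Rightarrow> 'a \<Rightarrow> 'a \<Rightarrow> 'a) \<Rightarrow> bool" where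
  "hermitian_deformation A C \<longleftrightarrow> formal_deformation A C \<and>
     (\<forall>a\<in>fps_carrier (acarrier A). \<forall>b\<in>fps_carrier (acarrier A).
        astar (deformed_algebra A C) (fps_extend2 C a b) =
        fps_extend2 C (astar (deformed_algebra A C) b) (astar (deformed_algebra A C) a))"

text \<open>\<open>T = id + \<Sum>\<^sub>r\<^sub>\<ge>\<^sub>1 \<lambda>\<^sup>r T\<^sub>r\<close>\<close>

definition formal_perturbation_of_id ::
    "'x::ab_group_add set \<Rightarrow> ('c \<Rightarrow> 'x \<Rightarrow> 'x) \<Rightarrow> (nat \<Rightarrow> 'x \<Rightarrow> 'x) \<Rightarrow> bool" where
  "formal_perturbation_of_id X s T \<longleftrightarrow> (\<forall>x\<in>X. T 0 x = x) \<and> (\<forall>r. linear_map s s X X (T r))"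

definition equivalent_deformations ::
    "('r, 'a::ab_group_add) star_alg \<Rightarrow> (nat \<Rightarrow> 'a \<Rightarrow> 'a \<Rightarrow> 'a) \<Rightarrow> (nat \<Rightarrow> 'a \<Rightarrow> 'a \<Rightarrow> 'a) \<Rightarrow> bool" where
  "equivalent_deformations A C D \<longleftrightarrow>
     (\<exists>T. formal_perturbation_of_id (acarrier A) (ascale A) T \<and>
        (\<forall>a\<in>fps_carrier (acarrier A). \<forall>b\<in>fps_carrier (acarrier A).
           fps_extend T (fps_extend2 C a b) = fps_extend2 D (fps_extend T a) (fps_extend T b)))"

text \<open>In the following \<open>C\<close> is a deformation of the product of \<open>A\<close>, \<open>\<rho>\<close> one of the action of \<open>A\<close> on
  \<open>M\<close>, and \<open>h\<close> one of an inner product \<open>h\<^sub>0\<close> on \<open>M\<close>, all given by their coefficients.\<close>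

definition module_deformation ::
    "('r::linordered_idom, 'a::ab_group_add) star_alg \<Rightarrow> (nat \<Rightarrow> 'a \<Rightarrow> 'a \<Rightarrow> 'a) \<Rightarrow>
      ('r, 'a, 'm::ab_group_add) right_mod \<Rightarrow> (nat \<Rightarrow> 'm \<Rightarrow> 'a \<Rightarrow> 'm) \<Rightarrow> bool" where
  "module_deformation A C M \<rho> \<longleftrightarrow>
     (\<forall>x\<in>mcarrier M. \<forall>a\<in>acarrier A. \<rho> 0 x a = mact M x a) \<and>
     (\<forall>r. bilinear_map (mscale M) (ascale A) (mscale M) (mcarrier M) (acarrier A) (mcarrier M) (\<rho> r)) \<and>
     right_module (deformed_algebra A C) (deformed_module M \<rho>)"

definition inner_product_deformation ::
    "('r::linordered_idom, 'a::ab_group_add) star_alg \<Rightarrow> (nat \<Rightarrow> 'a \<Rightarrow> 'a \<Rightarrow> 'a) \<Rightarrow>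
      ('r, 'a, 'm::ab_group_add) right_mod \<Rightarrow> ('m \<Rightarrow> 'm \<Rightarrow> 'a) \<Rightarrow> (nat \<Rightarrow> 'm \<Rightarrow> 'a \<Rightarrow> 'm) \<Rightarrow>
      (nat \<Rightarrow> 'm \<Rightarrow> 'm \<Rightarrow> 'a) \<Rightarrow> bool" where
  "inner_product_deformation A C M h\<^sub>0 \<rho> h \<longleftrightarrow>
     (\<forall>x\<in>mcarrier M. \<forall>y\<in>mcarrier M. h 0 x y = h\<^sub>0 x y) \<and>
     (\<forall>r. bilinear_map (\<lambda>c. mscale M (cconj c)) (mscale M) (ascale A)
        (mcarrier M) (mcarrier M) (acarrier A) (h r)) \<and>
     hermitian_inner_product (deformed_algebra A C) (deformed_module M \<rho>) (fps_extend2 h)"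

definition equivalent_module_deformations ::
    "('r, 'a::ab_group_add) star_alg \<Rightarrow> ('r, 'a, 'm::ab_group_add) right_mod \<Rightarrow>
      (nat \<Rightarrow> 'm \<Rightarrow> 'a \<Rightarrow> 'm) \<Rightarrow> (nat \<Rightarrow> 'm \<Rightarrow> 'a \<Rightarrow> 'm) \<Rightarrow> bool" where
  "equivalent_module_deformations A M \<rho> \<rho>' \<longleftrightarrow>
     (\<exists>T. formal_perturbation_of_id (mcarrier M) (mscale M) T \<and>
        (\<forall>x\<in>fps_carrier (mcarrier M). \<forall>a\<in>fps_carrier (acarrier A).
           fps_extend T (fps_extend2 \<rho> x a) = fps_extend2 \<rho>' (fps_extend T x) a))"

definition isometrically_equivalent ::
    "('r, 'a::ab_group_add) star_alg \<Rightarrow> ('r, 'a, 'm::ab_group_add) right_mod \<Rightarrow>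
      (nat \<Rightarrow> 'm \<Rightarrow> 'a \<Rightarrow> 'm) \<Rightarrow> (nat \<Rightarrow> 'm \<Rightarrow> 'm \<Rightarrow> 'a) \<Rightarrow>
      (nat \<Rightarrow> 'm \<Rightarrow> 'a \<Rightarrow> 'm) \<Rightarrow> (nat \<Rightarrow> 'm \<Rightarrow> 'm \<Rightarrow> 'a) \<Rightarrow> bool" where
  "isometrically_equivalent A M \<rho> h \<rho>' h' \<longleftrightarrow>
     (\<exists>T. formal_perturbation_of_id (mcarrier M) (mscale M) T \<and>
        (\<forall>x\<in>fps_carrier (mcarrier M). \<forall>a\<in>fps_carrier (acarrier A).
           fps_extend T (fps_extend2 \<rho> x a) = fps_extend2 \<rho>' (fps_extend T x) a) \<and>
        (\<forall>x\<in>fps_carrier (mcarrier M). \<forall>y\<in>fps_carrier (mcarrier M).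
           fps_extend2 h' (fps_extend T x) (fps_extend T y) = fps_extend2 h x y))"

text \<open>\<open>(B[[\<lambda>]], D) \<cong> End(M[[\<lambda>]], \<rho>)\<close> such that the resulting left action on \<open>M[[\<lambda>]]\<close> is, in order
  \<open>\<lambda>\<^sup>0\<close>, the given left action \<open>l\<close> of \<open>B\<close> on \<open>M\<close>.\<close>

definition deformed_bimodule ::
    "('r, 'b::ab_group_add) star_alg \<Rightarrow> (nat \<Rightarrow> 'b \<Rightarrow> 'b \<Rightarrow> 'b) \<Rightarrow> ('b \<Rightarrow> 'm \<Rightarrow> 'm) \<Rightarrow>
      ('r, 'a::ab_group_add) star_alg \<Rightarrow> (nat \<Rightarrow> 'a \<Rightarrow> 'a \<Rightarrow> 'a) \<Rightarrow>
      ('r, 'a, 'm::ab_group_add) right_mod \<Rightarrow> (nat \<Rightarrow> 'm \<Rightarrow> 'a \<Rightarrow> 'm) \<Rightarrow> bool" where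
  "deformed_bimodule B D l A C M \<rho> \<longleftrightarrow>
     (\<exists>\<Phi>. End_iso (deformed_algebra B D) (deformed_algebra A C) (deformed_module M \<rho>) \<Phi> \<and>
        (\<forall>b\<in>fps_carrier (acarrier B). \<forall>x\<in>fps_carrier (mcarrier M).
           fps_nth (\<Phi> b x) 0 = l (fps_nth b 0) (fps_nth x 0)))"

end

theory Submission
  imports Defs
begin

text \<open>Everything takes place in one concrete model. The projection \<open>P\<^sub>0\<close> lifts to a projection
  \<open>P = P\<^sub>0 + O(\<lambda>)\<close> in \<open>M\<^sub>n(A[[\<lambda>]], \<star>)\<close> (\<open>lift_matrix_projection\<close>). The right module \<open>P \<star> A[[\<lambda>]]\<^sup>n\<close> over the deformed
  algebra is finitely generated and projective, it carries the canonical inner product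
  \<open>\<Sum>\<^sub>i x\<^sub>i\<^sup>* \<star> y\<^sub>i\<close>, and its endomorphism algebra is the \<open>*\<close>-algebra \<open>P \<star> M\<^sub>n(A[[\<lambda>]]) \<star> P\<close>. As \<open>P\<close> deforms
  \<open>P\<^sub>0\<close>, the maps \<open>x \<mapsto> P \<star> x\<close> and \<open>b \<mapsto> P \<star> b \<star> P\<close> are \<open>C[[\<lambda>]]\<close>-linear bijections from \<open>E[[\<lambda>]]\<close> and \<open>B[[\<lambda>]]\<close> onto
  this module and this algebra (\<open>deformed_idempotent_bij\<close>). Pulling back the structures gives the
  required deformations, since a \<open>C[[\<lambda>]]\<close>-linear or bilinear map on power series is always
  given by coefficients (\<open>linear_map_fps_coeffs\<close>, \<open>bilinear_map_fps_coeffs\<close>).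

  Conversely every deformation \<open>\<bullet>\<close> of the module is isomorphic to the model, by a map that is the identity in
  order \<open>\<lambda>\<^sup>0\<close> (\<open>trivialization_exists\<close>): a module map from \<open>A[[\<lambda>]]\<^sup>n\<close> is obtained by choosing the images of the
  basis, and choosing the columns of \<open>P\<^sub>0\<close> makes it \<open>id + O(\<lambda>)\<close> on \<open>P \<star> A[[\<lambda>]]\<^sup>n\<close>. Maps \<open>id + O(\<lambda>)\<close> are
  invertible. Hence any two module deformations are equivalent, and all are finitely generated and
  projective and have deformations of \<open>B\<close> as their endomorphism algebras. Uniqueness of the latter
  follows from the faithfulness of the action of \<open>B\<close> on \<open>E\<close>.

  For the inner products, a deformation \<open>h\<close> of \<open>h\<^sub>0\<close> transported to the model has the form
  \<open>h(x, y) = \<langle>x, H y\<rangle>\<close>, where \<open>\<langle>_, _\<rangle>\<close> is the canonical inner product and \<open>H\<close> is Hermitian with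
  \<open>P \<star> H \<star> P = H = P + O(\<lambda>)\<close>. As 2 is invertible, \<open>H\<close> has a Hermitian square root \<open>U\<close> of the same form, and
  \<open>h(x, y) = \<langle>U x, U y\<rangle>\<close>. So every pair \<open>(\<bullet>, h)\<close> is isometric to the model (\<open>isometric_trivialization\<close>).

  All equations are solved by one method, Banach's fixed point theorem for the \<open>\<lambda>\<close>-adic metric
  (\<open>fps_contraction_fixpoint\<close>): the inverse of a map \<open>id + O(\<lambda>)\<close>, the lift of a projection and the square root
  are limits of Newton iterations whose derivative is taken at \<open>\<lambda> = 0\<close>.\<close>

section \<open>Modules and linear maps on carriers\<close>

lemma c_moduleD:
  assumes "c_module X s"
  shows "0 \<in> X" "x \<in> X \<Longrightarrow> y \<in> X \<Longrightarrow> x + y \<in> X" "x \<in> X \<Longrightarrow> - x \<in> X"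
    "x \<in> X \<Longrightarrow> y \<in> X \<Longrightarrow> x - y \<in> X" "x \<in> X \<Longrightarrow> s c x \<in> X"
    "x \<in> X \<Longrightarrow> y \<in> X \<Longrightarrow> s c (x + y) = s c x + s c y"
    "x \<in> X \<Longrightarrow> s (c + d) x = s c x + s d x" "x \<in> X \<Longrightarrow> s (c * d) x = s c (s d x)"
    "x \<in> X \<Longrightarrow> s 1 x = x"
proof -
  have neg: "\<And>x. x \<in> X \<Longrightarrow> - x \<in> X" and add: "\<And>x y. x \<in> X \<Longrightarrow> y \<in> X \<Longrightarrow> x + y \<in> X"
    using assms by (auto simp: c_module_def)
  show "x \<in> X \<Longrightarrow> y \<in> X \<Longrightarrow> x - y \<in> X" using add[OF _ neg, of x y] by simp
qed (use assms in \<open>auto simp: c_module_def\<close>)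

lemma c_module_sum_in:
  assumes "c_module X s" "\<And>i. i \<in> I \<Longrightarrow> f i \<in> X"
  shows "sum f I \<in> X"
  using assms(2) by (induction I rule: infinite_finite_induct) (auto intro: c_moduleD[OF assms(1)])

lemma linear_mapD:
  assumes "linear_map s t X Y f"
  shows "x \<in> X \<Longrightarrow> f x \<in> Y" "x \<in> X \<Longrightarrow> y \<in> X \<Longrightarrow> f (x + y) = f x + f y"
    "x \<in> X \<Longrightarrow> f (s c x) = t c (f x)"
  using assms by (auto simp: linear_map_def)

lemma linear_mapI:
  assumes "\<And>x. x \<in> X \<Longrightarrow> f x \<in> Y" "\<And>x y. x \<in> X \<Longrightarrow> y \<in> X \<Longrightarrow> f (x + y) = f x + f y"
    "\<And>c x. x \<in> X \<Longrightarrow> f (s c x) = t c (f x)"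
  shows "linear_map s t X Y f"
  using assms by (auto simp: linear_map_def)

lemma linear_map_diff:
  fixes f :: "'x::ab_group_add \<Rightarrow> 'y::ab_group_add"
  assumes "linear_map s t X Y f" "c_module X s" "x \<in> X" "y \<in> X"
  shows "f (x - y) = f x - f y"
  using linear_mapD(2)[OF assms(1), of "x - y" y] c_moduleD(4)[OF assms(2)] assms(3,4)
  by (simp add: algebra_simps)

lemma linear_map_zero:
  fixes f :: "'x::ab_group_add \<Rightarrow> 'y::ab_group_add"
  assumes "linear_map s t X Y f" "c_module X s"
  shows "f 0 = 0"
  using linear_map_diff[OF assms c_moduleD(1) c_moduleD(1), OF assms(2,2)] by simp

lemma linear_map_sum:
  fixes f :: "'x::ab_group_add \<Rightarrow> 'y::ab_group_add"
  assumes "linear_map s t X Y f" "c_module X s" "\<And>i. i \<in> I \<Longrightarrow> g i \<in> X"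
  shows "f (sum g I) = (\<Sum>i\<in>I. f (g i))"
  using assms(3)
proof (induction I rule: infinite_finite_induct)
  case (insert i I)
  then show ?case
    using linear_mapD(2)[OF assms(1), of "g i" "sum g I"] c_module_sum_in[OF assms(2), of I g] by simp
qed (simp_all add: linear_map_zero[OF assms(1,2)])

lemma linear_map_compose:
  assumes "linear_map s t X Y f" "linear_map t u Y Z g"
  shows "linear_map s u X Z (\<lambda>x. g (f x))"
  using assms by (auto simp: linear_map_def)

lemma linear_map_restrict:
  assumes "linear_map s t X Y f" "X' \<subseteq> X" "\<And>x. x \<in> X' \<Longrightarrow> f x \<in> Y'"
  shows "linear_map s t X' Y' f"
  using assms by (auto simp: linear_map_def subset_iff)

lemma linear_map_inverse:
  assumes "linear_map s t X Y f" "bij_betw f X Y" "c_module X s"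
  shows "linear_map t s Y X (inv_into X f)"
proof (rule linear_mapI)
  have f: "f (inv_into X f y) = y" "inv_into X f y \<in> X" if "y \<in> Y" for y
    using bij_betw_inv_into_right[OF assms(2) that] bij_betw_apply[OF bij_betw_inv_into[OF assms(2)] that]
    by auto
  have g: "inv_into X f (f x) = x" if "x \<in> X" for x
    using bij_betw_inv_into_left[OF assms(2) that] .
  fix x y c assume x: "x \<in> Y"
  show "inv_into X f x \<in> X" by (rule f(2)[OF x])
  show "inv_into X f (t c x) = s c (inv_into X f x)"
    using linear_mapD(3)[OF assms(1) f(2)[OF x], of c] g[OF c_moduleD(5)[OF assms(3) f(2)[OF x]], of c] f(1)[OF x]
    by simp
  assume y: "y \<in> Y"
  show "inv_into X f (x + y) = inv_into X f x + inv_into X f y"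
    using linear_mapD(2)[OF assms(1) f(2)[OF x] f(2)[OF y]]
      g[OF c_moduleD(2)[OF assms(3) f(2)[OF x] f(2)[OF y]]] f(1)[OF x] f(1)[OF y]
    by simp
qed

lemma c_module_scale_sum:
  fixes X :: "'x::ab_group_add set"
  assumes "c_module X s" "\<And>i. i \<in> I \<Longrightarrow> g i \<in> X"
  shows "s c (sum g I) = (\<Sum>i\<in>I. s c (g i))"
proof -
  have "s c 0 = 0" using c_moduleD(6)[OF assms(1) c_moduleD(1)[OF assms(1)] c_moduleD(1)[OF assms(1)], of c] by simp
  then show ?thesis using assms(2)
  proof (induction I rule: infinite_finite_induct)
    case (insert i I)
    then show ?case
      using c_moduleD(6)[OF assms(1), of "g i" "sum g I"] c_module_sum_in[OF assms(1), of I g] by simp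
  qed simp_all
qed

lemma c_module_scale_zero:
  fixes X :: "'x::ab_group_add set"
  assumes "c_module X s" shows "s c 0 = 0"
  using c_module_scale_sum[OF assms, of "{}"] by simp

lemma c_module_zero_scale:
  fixes X :: "'x::ab_group_add set"
  assumes "c_module X s" "x \<in> X" shows "s 0 x = 0"
  using c_moduleD(7)[OF assms, of 0 0] by simp

lemma c_module_sum_scale:
  fixes X :: "'x::ab_group_add set"
  assumes "c_module X s" "x \<in> X"
  shows "s (sum c I) x = (\<Sum>i\<in>I. s (c i) x)"
  by (induction I rule: infinite_finite_induct)
    (simp_all add: c_module_zero_scale[OF assms] c_moduleD(7)[OF assms])

section \<open>Power series with coefficients in a module\<close>

lemma cext_sum: "cre (sum f I) = (\<Sum>i\<in>I. cre (f i))" "cim (sum f I) = (\<Sum>i\<in>I. cim (f i))"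
  by (induction I rule: infinite_finite_induct) (simp_all add: zero_cext_def plus_cext_def)

definition cext_nth :: "'r fps cext \<Rightarrow> nat \<Rightarrow> 'r cext" where
  "cext_nth c k = CExt (fps_nth (cre c) k) (fps_nth (cim c) k)"

lemma cext_nth_simps:
  fixes c d :: "'r::comm_ring_1 fps cext"
  shows "cext_nth (c + d) k = cext_nth c k + cext_nth d k"
    "cext_nth (c * d) k = (\<Sum>i\<le>k. cext_nth c i * cext_nth d (k - i))"
    "cext_nth 1 k = (if k = 0 then 1 else 0)"
    "cext_nth (cconj c) k = cconj (cext_nth c k)"
  by (simp_all add: cext_nth_def plus_cext_def times_cext_def one_cext_def zero_cext_def cconj_def
      fps_mult_nth atMost_atLeast0 cext.expand cext_sum sum_subtractf sum.distrib)

definition cext_const :: "'r::zero cext \<Rightarrow> 'r fps cext" where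
  "cext_const c = CExt (fps_const (cre c)) (fps_const (cim c))"

definition cext_lambda :: "nat \<Rightarrow> 'r::comm_ring_1 fps cext" where
  "cext_lambda n = CExt (fps_X ^ n) 0"

lemma cext_nth_const: "cext_nth (cext_const c) k = (if k = 0 then c else 0)"
  by (simp add: cext_nth_def cext_const_def zero_cext_def)

lemma cext_nth_lambda: "cext_nth (cext_lambda n) k = (if k = n then 1 else 0)"
  by (simp add: cext_nth_def cext_lambda_def zero_cext_def one_cext_def)

lemma fps_scale_nth: "fps_nth (fps_scale s c f) n = (\<Sum>k\<le>n. s (cext_nth c k) (fps_nth f (n - k)))"
  by (simp add: fps_scale_def cext_nth_def)

lemma fps_extend_nth: "fps_nth (fps_extend T f) n = (\<Sum>r\<le>n. T r (fps_nth f (n - r)))"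
  by (simp add: fps_extend_def)

lemma fps_extend2_nth:
  "fps_nth (fps_extend2 C f g) n = (\<Sum>r\<le>n. \<Sum>i\<le>n - r. C r (fps_nth f i) (fps_nth g (n - r - i)))"
  by (simp add: fps_extend2_def)

lemma fps_carrierD: "f \<in> fps_carrier X \<Longrightarrow> fps_nth f n \<in> X"
  by (simp add: fps_carrier_def)

lemma fps_carrierI: "(\<And>n. fps_nth f n \<in> X) \<Longrightarrow> f \<in> fps_carrier X"
  by (simp add: fps_carrier_def)

lemma fps_const_in: "0 \<in> X \<Longrightarrow> x \<in> X \<Longrightarrow> fps_const x \<in> fps_carrier X"
  by (simp add: fps_carrier_def)

text \<open>Reindexings of sums over \<open>i + j + k = n\<close>.\<close>

lemma sum_triangle_assoc:
  fixes f :: "nat \<Rightarrow> nat \<Rightarrow> nat \<Rightarrow> 'x::comm_monoid_add"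
  shows "(\<Sum>q\<le>n. \<Sum>r\<le>q. f r (q - r) (n - q)) = (\<Sum>r\<le>n. \<Sum>i\<le>n - r. f r i (n - r - i))"
  using fps_mult_assoc_lemma[where k = n and n = n and f = f] by (simp add: atMost_atLeast0)

lemma sum_flip:
  fixes f :: "nat \<Rightarrow> nat \<Rightarrow> 'x::comm_monoid_add"
  shows "(\<Sum>i\<le>n. f i (n - i)) = (\<Sum>i\<le>n. f (n - i) i)"
  using fps_mult_commute_lemma[where f = f and n = n] by (simp add: atMost_atLeast0)

lemma sum_triangle_flip:
  fixes f :: "nat \<Rightarrow> nat \<Rightarrow> nat \<Rightarrow> 'x::comm_monoid_add"
  shows "(\<Sum>r\<le>n. \<Sum>i\<le>n - r. f r i (n - r - i)) = (\<Sum>r\<le>n. \<Sum>i\<le>n - r. f r (n - r - i) i)"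
  by (intro sum.cong refl sum_flip)

lemma sum_triangle_swap:
  fixes f :: "nat \<Rightarrow> nat \<Rightarrow> nat \<Rightarrow> 'x::comm_monoid_add"
  shows "(\<Sum>r\<le>n. \<Sum>i\<le>n - r. f r i (n - r - i)) = (\<Sum>i\<le>n. \<Sum>r\<le>n - i. f r i (n - i - r))"
proof -
  have "(\<Sum>r\<le>n. \<Sum>i\<le>n - r. f r i (n - r - i)) = (\<Sum>q\<le>n. \<Sum>r\<le>q. f r (q - r) (n - q))"
    by (simp only: sum_triangle_assoc)
  also have "\<dots> = (\<Sum>q\<le>n. \<Sum>r\<le>q. f (q - r) r (n - q))"
    by (intro sum.cong refl sum_flip)
  also have "\<dots> = (\<Sum>i\<le>n. \<Sum>r\<le>n - i. f r i (n - i - r))"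
    by (rule sum_triangle_assoc[of "\<lambda>i r. f r i"])
  finally show ?thesis .
qed

lemma c_module_fps:
  fixes X :: "'x::ab_group_add set" and s :: "'r::comm_ring_1 cext \<Rightarrow> 'x \<Rightarrow> 'x"
  assumes X: "c_module X s"
  shows "c_module (fps_carrier X) (fps_scale s)"
proof -
  note [simp] = c_moduleD[OF X] fps_carrierD
  have "fps_scale s (c * d) f = fps_scale s c (fps_scale s d f)" if f: "f \<in> fps_carrier X" for c d f
  proof (rule fps_ext)
    fix n
    have "fps_nth (fps_scale s (c * d) f) n =
        (\<Sum>q\<le>n. \<Sum>r\<le>q. s (cext_nth c r) (s (cext_nth d (q - r)) (fps_nth f (n - q))))"
      using f by (simp add: fps_scale_nth cext_nth_simps(2) c_module_sum_scale[OF X])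
    also have "\<dots> = (\<Sum>r\<le>n. \<Sum>i\<le>n - r. s (cext_nth c r) (s (cext_nth d i) (fps_nth f (n - r - i))))"
      by (rule sum_triangle_assoc)
    also have "\<dots> = fps_nth (fps_scale s c (fps_scale s d f)) n"
      using f by (simp add: fps_scale_nth c_module_scale_sum[OF X])
    finally show "fps_nth (fps_scale s (c * d) f) n = fps_nth (fps_scale s c (fps_scale s d f)) n" .
  qed
  moreover have "fps_scale s 1 f = f" if f: "f \<in> fps_carrier X" for f
  proof (rule fps_ext)
    fix n
    have "fps_nth (fps_scale s 1 f) n = (\<Sum>k\<le>n. if k = 0 then fps_nth f n else 0)"
      unfolding fps_scale_nth using f
      by (intro sum.cong) (auto simp: cext_nth_simps(3) c_module_zero_scale[OF X])
    then show "fps_nth (fps_scale s 1 f) n = fps_nth f n" by simp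
  qed
  moreover have "fps_scale s c f \<in> fps_carrier X" if "f \<in> fps_carrier X" for c f
    using that by (auto intro!: fps_carrierI c_module_sum_in[OF X] simp: fps_scale_nth)
  moreover have "fps_scale s c (f + g) = fps_scale s c f + fps_scale s c g"
    if "f \<in> fps_carrier X" "g \<in> fps_carrier X" for c f g
    using that by (intro fps_ext) (simp add: fps_scale_nth sum.distrib)
  moreover have "fps_scale s (c + d) f = fps_scale s c f + fps_scale s d f"
    if "f \<in> fps_carrier X" for c d f
    using that by (intro fps_ext) (simp add: fps_scale_nth cext_nth_simps(1) sum.distrib)
  ultimately show ?thesis
    unfolding c_module_def
    by (intro conjI ballI allI) (auto intro: fps_carrierI)
qed

lemma fps_scale_const:
  assumes X: "c_module X s" and x: "x \<in> X"
  shows "fps_scale s (cext_const c) (fps_const x) = fps_const (s c x)"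
  by (rule fps_ext) (auto simp: fps_scale_nth cext_nth_const c_module_scale_zero[OF X]
      c_module_zero_scale[OF X x] intro!: sum.neutral)

lemma fps_scale_lambda_nth:
  assumes X: "c_module X s" and f: "f \<in> fps_carrier X"
  shows "fps_nth (fps_scale s (cext_lambda k) f) n = (if k \<le> n then fps_nth f (n - k) else 0)"
proof -
  have "fps_nth (fps_scale s (cext_lambda k) f) n = (\<Sum>i\<le>n. if i = k then fps_nth f (n - k) else 0)"
    unfolding fps_scale_nth using f
    by (intro sum.cong) (auto simp: cext_nth_lambda c_module_zero_scale[OF X] c_moduleD(9)[OF X] fps_carrierD)
  then show ?thesis by simp
qed

lemma cconj_simps:
  fixes c d :: "'r::comm_ring_1 cext"
  shows "cconj (c + d) = cconj c + cconj d" "cconj (c * d) = cconj c * cconj d" "cconj 1 = (1 :: 'r cext)"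
    "cconj (cconj c) = c"
  by (simp_all add: cconj_def plus_cext_def times_cext_def one_cext_def)

lemma c_module_cconj: "c_module X s \<Longrightarrow> c_module X (\<lambda>c. s (cconj c))"
  unfolding c_module_def by (simp add: cconj_simps)

text \<open>A sesquilinear form is a bilinear map for the conjugate scalar multiplication \<open>\<lambda>c. s (cconj c)\<close> in its
  first argument. This description is compatible with the passage to power series, so the results on
  bilinear maps below also serve for inner products.\<close>

lemma fps_scale_cconj:
  fixes s :: "'r::comm_ring_1 cext \<Rightarrow> 'x::comm_monoid_add \<Rightarrow> 'x"
  shows "fps_scale (\<lambda>c. s (cconj c)) = (\<lambda>c. fps_scale s (cconj c))"
  by (intro ext fps_ext) (simp add: fps_scale_nth cext_nth_simps(4))

text \<open>Multiplication by a scalar series and application of \<open>\<Sum> \<lambda>\<^sup>r T\<^sub>r\<close> are both convolutions, so that they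
  commute by reindexing a sum over \<open>i + j + k = n\<close>.\<close>

lemma linear_map_fps_extend:
  fixes X :: "'x::ab_group_add set" and Y :: "'y::ab_group_add set"
    and s :: "'r::comm_ring_1 cext \<Rightarrow> 'x \<Rightarrow> 'x"
  assumes X: "c_module X s" and Y: "c_module Y t" and T: "\<And>r. linear_map s t X Y (T r)"
  shows "linear_map (fps_scale s) (fps_scale t) (fps_carrier X) (fps_carrier Y) (fps_extend T)"
proof (rule linear_mapI)
  note [simp] = fps_carrierD linear_mapD[OF T] c_moduleD[OF X] c_moduleD[OF Y]
  fix f g c assume f: "f \<in> fps_carrier X"
  show "fps_extend T f \<in> fps_carrier Y"
    using f by (auto intro!: fps_carrierI c_module_sum_in[OF Y] simp: fps_extend_nth)
  show "fps_extend T (fps_scale s c f) = fps_scale t c (fps_extend T f)"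
  proof (rule fps_ext)
    fix n
    have "fps_nth (fps_extend T (fps_scale s c f)) n =
        (\<Sum>r\<le>n. \<Sum>i\<le>n - r. t (cext_nth c i) (T r (fps_nth f (n - r - i))))"
      using f by (simp add: fps_extend_nth fps_scale_nth linear_map_sum[OF T X])
    also have "\<dots> = (\<Sum>i\<le>n. \<Sum>r\<le>n - i. t (cext_nth c i) (T r (fps_nth f (n - i - r))))"
      by (rule sum_triangle_swap)
    also have "\<dots> = fps_nth (fps_scale t c (fps_extend T f)) n"
      using f by (simp add: fps_extend_nth fps_scale_nth c_module_scale_sum[OF Y])
    finally show "fps_nth (fps_extend T (fps_scale s c f)) n = fps_nth (fps_scale t c (fps_extend T f)) n" .
  qed
  assume g: "g \<in> fps_carrier X"
  show "fps_extend T (f + g) = fps_extend T f + fps_extend T g"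
    using f g by (intro fps_ext) (simp add: fps_extend_nth sum.distrib)
qed

text \<open>Modulo \<open>\<lambda>\<^sup>n\<^sup>+\<^sup>1\<close> a power series is a finite combination of constants, and the remainder is a multiple of
  \<open>\<lambda>\<^sup>n\<^sup>+\<^sup>1\<close>. So a \<open>C[[\<lambda>]]\<close>-linear map is determined by its values on constants, and can be given by coefficients
  \<open>T\<^sub>r\<close> even if it was constructed without them.\<close>

lemma linear_map_fps_coeffs:
  fixes X :: "'x::ab_group_add set" and Y :: "'y::ab_group_add set"
    and s :: "'r::comm_ring_1 cext \<Rightarrow> 'x \<Rightarrow> 'x"
  assumes X: "c_module X s" and Y: "c_module Y t"
    and F: "linear_map (fps_scale s) (fps_scale t) (fps_carrier X) (fps_carrier Y) F"
    and f: "f \<in> fps_carrier X"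
  shows "F f = fps_extend (\<lambda>r x. fps_nth (F (fps_const x)) r) f"
proof (rule fps_ext)
  fix n
  note XX = c_module_fps[OF X] note YY = c_module_fps[OF Y]
  define R where "R = Abs_fps (\<lambda>k. fps_nth f (Suc n + k))"
  let ?m = "\<lambda>k. fps_scale s (cext_lambda k)"
  let ?c = "\<lambda>k. fps_const (fps_nth f k)"
  have c: "?c k \<in> fps_carrier X" for k
    using f c_moduleD(1)[OF X] by (simp add: fps_const_in fps_carrierD)
  have R: "R \<in> fps_carrier X" using f by (auto simp: R_def fps_carrierD intro!: fps_carrierI)
  have S: "(\<Sum>k\<le>n. ?m k (?c k)) \<in> fps_carrier X" "?m (Suc n) R \<in> fps_carrier X"
    using c R by (auto intro!: c_module_sum_in[OF XX] c_moduleD(5)[OF XX])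
  have "f = (\<Sum>k\<le>n. ?m k (?c k)) + ?m (Suc n) R"
  proof (rule fps_ext)
    fix m
    have "(\<Sum>k\<le>n. fps_nth (?m k (?c k)) m) = (\<Sum>k\<le>n. if k = m then fps_nth f m else 0)"
      using c by (intro sum.cong) (auto simp: fps_scale_lambda_nth[OF X])
    then show "fps_nth f m = fps_nth ((\<Sum>k\<le>n. ?m k (?c k)) + ?m (Suc n) R) m"
      using R by (auto simp: fps_scale_lambda_nth[OF X] fps_sum_nth) (auto simp: R_def)
  qed
  then have "F f = F (\<Sum>k\<le>n. ?m k (?c k)) + F (?m (Suc n) R)"
    using linear_mapD(2)[OF F S] by simp
  also have "F (\<Sum>k\<le>n. ?m k (?c k)) = (\<Sum>k\<le>n. fps_scale t (cext_lambda k) (F (?c k)))"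
    using c linear_mapD(3)[OF F] by (subst linear_map_sum[OF F XX]) (auto intro!: c_moduleD(5)[OF XX])
  also have "F (?m (Suc n) R) = fps_scale t (cext_lambda (Suc n)) (F R)"
    using R linear_mapD(3)[OF F] by simp
  finally have "fps_nth (F f) n = (\<Sum>k\<le>n. fps_nth (F (?c k)) (n - k))"
    using linear_mapD(1)[OF F R] linear_mapD(1)[OF F c]
    by (simp add: fps_scale_lambda_nth[OF Y] fps_sum_nth)
  also have "\<dots> = (\<Sum>k\<le>n. fps_nth (F (?c (n - k))) k)"
    by (rule sum_flip)
  finally show "fps_nth (F f) n = fps_nth (fps_extend (\<lambda>r x. fps_nth (F (fps_const x)) r) f) n"
    by (simp add: fps_extend_nth)
qed

lemma linear_map_coeff:
  fixes X :: "'x::ab_group_add set" and Y :: "'y::ab_group_add set"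
    and s :: "'r::comm_ring_1 cext \<Rightarrow> 'x \<Rightarrow> 'x"
  assumes X: "c_module X s" and Y: "c_module Y t"
    and F: "linear_map (fps_scale s) (fps_scale t) (fps_carrier X) (fps_carrier Y) F"
  shows "linear_map s t X Y (\<lambda>x. fps_nth (F (fps_const x)) r)"
proof (rule linear_mapI)
  fix x y c assume x: "x \<in> X"
  note cx = fps_const_in[OF c_moduleD(1)[OF X]]
  show "fps_nth (F (fps_const x)) r \<in> Y"
    using linear_mapD(1)[OF F cx[OF x]] by (simp add: fps_carrierD)
  have "fps_nth (fps_scale t (cext_const c) g) r = t c (fps_nth g r)" if "g \<in> fps_carrier Y" for g
  proof -
    have "fps_nth (fps_scale t (cext_const c) g) r = (\<Sum>k\<le>r. if k = 0 then t c (fps_nth g r) else 0)"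
      unfolding fps_scale_nth using that
      by (intro sum.cong) (auto simp: cext_nth_const c_module_zero_scale[OF Y] fps_carrierD)
    then show ?thesis by simp
  qed
  then show "fps_nth (F (fps_const (s c x))) r = t c (fps_nth (F (fps_const x)) r)"
    using linear_mapD(3)[OF F cx[OF x], of "cext_const c"] linear_mapD(1)[OF F cx[OF x]]
    by (simp add: fps_scale_const[OF X x])
  assume y: "y \<in> X"
  show "fps_nth (F (fps_const (x + y))) r = fps_nth (F (fps_const x)) r + fps_nth (F (fps_const y)) r"
    using linear_mapD(2)[OF F cx[OF x] cx[OF y]] by simp
qed

text \<open>With one argument fixed, \<open>fps_extend2 C\<close> is again a formal series of maps, so bilinearity
  reduces to linearity.\<close>

lemma fps_extend2_right:
  fixes C :: "nat \<Rightarrow> 'x \<Rightarrow> 'y \<Rightarrow> 'z::comm_monoid_add"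
  shows "fps_extend2 C f = fps_extend (\<lambda>q y. \<Sum>r\<le>q. C r (fps_nth f (q - r)) y)"
  by (rule ext, rule fps_ext)
    (simp add: fps_extend2_nth fps_extend_nth sum_triangle_assoc[of "\<lambda>r i k. C r (fps_nth f i) (fps_nth _ k)"])

lemma fps_extend2_left:
  fixes C :: "nat \<Rightarrow> 'x \<Rightarrow> 'y \<Rightarrow> 'z::comm_monoid_add"
  shows "fps_extend2 C f g = fps_extend (\<lambda>q x. \<Sum>r\<le>q. C r x (fps_nth g (q - r))) f"
proof (rule fps_ext)
  fix n
  have "fps_nth (fps_extend (\<lambda>q x. \<Sum>r\<le>q. C r x (fps_nth g (q - r))) f) n =
     (\<Sum>r\<le>n. \<Sum>i\<le>n - r. C r (fps_nth f (n - r - i)) (fps_nth g i))"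
    by (simp add: fps_extend_nth sum_triangle_assoc[of "\<lambda>r i k. C r (fps_nth f k) (fps_nth g i)"])
  also have "\<dots> = fps_nth (fps_extend2 C f g) n"
    unfolding fps_extend2_nth by (rule sum_triangle_flip[symmetric])
  finally show "fps_nth (fps_extend2 C f g) n =
    fps_nth (fps_extend (\<lambda>q x. \<Sum>r\<le>q. C r x (fps_nth g (q - r))) f) n" by simp
qed

lemma linear_map_sum_maps:
  fixes X :: "'x::ab_group_add set" and Y :: "'y::ab_group_add set"
  assumes Y: "c_module Y t" and T: "\<And>i. i \<in> I \<Longrightarrow> linear_map s t X Y (T i)"
  shows "linear_map s t X Y (\<lambda>x. \<Sum>i\<in>I. T i x)"
  using T unfolding linear_map_def
  by (auto intro!: c_module_sum_in[OF Y] simp: sum.distrib c_module_scale_sum[OF Y])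

lemma bilinear_map_fps_extend2:
  fixes X :: "'x::ab_group_add set" and Y :: "'y::ab_group_add set" and Z :: "'z::ab_group_add set"
    and s :: "'r::comm_ring_1 cext \<Rightarrow> 'x \<Rightarrow> 'x"
  assumes X: "c_module X s" and Y: "c_module Y t" and Z: "c_module Z u"
    and C: "\<And>r. bilinear_map s t u X Y Z (C r)"
  shows "bilinear_map (fps_scale s) (fps_scale t) (fps_scale u)
    (fps_carrier X) (fps_carrier Y) (fps_carrier Z) (fps_extend2 C)"
proof -
  have "linear_map (fps_scale t) (fps_scale u) (fps_carrier Y) (fps_carrier Z) (fps_extend2 C f)"
    if "f \<in> fps_carrier X" for f
    unfolding fps_extend2_right using C that
    by (intro linear_map_fps_extend[OF Y Z] linear_map_sum_maps[OF Z])
      (auto simp: bilinear_map_def fps_carrierD)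
  moreover have "linear_map (fps_scale s) (fps_scale u) (fps_carrier X) (fps_carrier Z)
      (\<lambda>f. fps_extend2 C f g)" if "g \<in> fps_carrier Y" for g
    unfolding fps_extend2_left using C that
    by (intro linear_map_fps_extend[OF X Z] linear_map_sum_maps[OF Z])
      (auto simp: bilinear_map_def fps_carrierD)
  ultimately show ?thesis by (auto simp: bilinear_map_def)
qed

lemma bilinear_map_fps_coeffs:
  fixes X :: "'x::ab_group_add set" and Y :: "'y::ab_group_add set" and Z :: "'z::ab_group_add set"
    and s :: "'r::comm_ring_1 cext \<Rightarrow> 'x \<Rightarrow> 'x"
  assumes X: "c_module X s" and Y: "c_module Y t" and Z: "c_module Z u"
    and F: "bilinear_map (fps_scale s) (fps_scale t) (fps_scale u)
      (fps_carrier X) (fps_carrier Y) (fps_carrier Z) F"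
  shows "f \<in> fps_carrier X \<Longrightarrow> g \<in> fps_carrier Y \<Longrightarrow>
      F f g = fps_extend2 (\<lambda>r x y. fps_nth (F (fps_const x) (fps_const y)) r) f g"
    and "bilinear_map s t u X Y Z (\<lambda>x y. fps_nth (F (fps_const x) (fps_const y)) r)"
proof -
  note cx = fps_const_in[OF c_moduleD(1)[OF X]] note cy = fps_const_in[OF c_moduleD(1)[OF Y]]
  have L: "linear_map (fps_scale t) (fps_scale u) (fps_carrier Y) (fps_carrier Z) (F f)"
    if "f \<in> fps_carrier X" for f
    using F that by (simp add: bilinear_map_def)
  have R: "linear_map (fps_scale s) (fps_scale u) (fps_carrier X) (fps_carrier Z) (\<lambda>f. F f g)"
    if "g \<in> fps_carrier Y" for g
    using F that by (simp add: bilinear_map_def)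
  show "bilinear_map s t u X Y Z (\<lambda>x y. fps_nth (F (fps_const x) (fps_const y)) r)"
    unfolding bilinear_map_def
    using linear_map_coeff[OF Y Z L[OF cx], of _ r] linear_map_coeff[OF X Z R[OF cy], of _ r] by blast
  assume f: "f \<in> fps_carrier X" and g: "g \<in> fps_carrier Y"
  show "F f g = fps_extend2 (\<lambda>r x y. fps_nth (F (fps_const x) (fps_const y)) r) f g"
  proof (rule fps_ext)
    fix n
    have "fps_nth (F f g) n = (\<Sum>q\<le>n. fps_nth (F f (fps_const (fps_nth g (n - q)))) q)"
      by (subst linear_map_fps_coeffs[OF Y Z L[OF f] g]) (simp add: fps_extend_nth)
    also have "\<dots> = (\<Sum>q\<le>n. \<Sum>r\<le>q.
        fps_nth (F (fps_const (fps_nth f (q - r))) (fps_const (fps_nth g (n - q)))) r)"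
    proof (intro sum.cong refl)
      fix q
      show "fps_nth (F f (fps_const (fps_nth g (n - q)))) q = (\<Sum>r\<le>q.
        fps_nth (F (fps_const (fps_nth f (q - r))) (fps_const (fps_nth g (n - q)))) r)"
        by (subst linear_map_fps_coeffs[OF X Z R[OF cy[OF fps_carrierD[OF g]]] f]) (simp add: fps_extend_nth)
    qed
    finally show "fps_nth (F f g) n =
        fps_nth (fps_extend2 (\<lambda>r x y. fps_nth (F (fps_const x) (fps_const y)) r) f g) n"
      by (simp add: fps_extend2_right fps_extend_nth)
  qed
qed

lemma fps_extend2_0: "fps_nth (fps_extend2 C f g) 0 = C 0 (fps_nth f 0) (fps_nth g 0)"
  by (simp add: fps_extend2_nth)

section \<open>Solving equations order by order\<close>

text \<open>Congruence modulo \<open>\<lambda>\<^sup>n\<close>.\<close>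

definition agree :: "nat \<Rightarrow> 'x fps \<Rightarrow> 'x fps \<Rightarrow> bool" where
  "agree n f g \<longleftrightarrow> (\<forall>k<n. fps_nth f k = fps_nth g k)"

lemma agree_Suc: "agree (Suc n) f g \<longleftrightarrow> agree n f g \<and> fps_nth f n = fps_nth g n"
  by (auto simp: agree_def less_Suc_eq)

lemma agree_sym: "agree n f g \<Longrightarrow> agree n g f"
  by (simp add: agree_def)

lemma agree_trans: "agree n f g \<Longrightarrow> agree n g h \<Longrightarrow> agree n f h"
  by (simp add: agree_def)

lemma agree_mono: "agree n f g \<Longrightarrow> m \<le> n \<Longrightarrow> agree m f g"
  by (simp add: agree_def)

lemma agree_all: "(\<And>n. agree n f g) \<Longrightarrow> f = g"
  by (rule fps_ext) (meson agree_Suc)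

text \<open>Banach's fixed point theorem for the \<open>\<lambda>\<close>-adic metric.\<close>

lemma fps_contraction_fixpoint:
  fixes Z :: "'x fps set"
  assumes ne: "z \<in> Z" and F: "\<And>f. f \<in> Z \<Longrightarrow> F f \<in> Z"
    and contr: "\<And>n f g. f \<in> Z \<Longrightarrow> g \<in> Z \<Longrightarrow> agree n f g \<Longrightarrow> agree (Suc n) (F f) (F g)"
    and closed: "\<And>f. (\<And>n. \<exists>g\<in>Z. agree n g f) \<Longrightarrow> f \<in> Z"
  obtains f where "f \<in> Z" "F f = f"
proof -
  define S where "S k = (F ^^ k) z" for k
  have S: "S k \<in> Z" "S (Suc k) = F (S k)" for k
    by (induction k) (auto simp: S_def ne F)
  have step: "agree k (S k) (S (Suc k))" for k
  proof (induction k)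
    case (Suc k)
    then show ?case using contr[OF S(1) S(1)] S(2) by metis
  qed (simp add: agree_def)
  have later: "agree k (S k) (S (k + m))" for k m
  proof (induction m)
    case (Suc m)
    then show ?case using agree_trans[OF Suc agree_mono[OF step]] by simp
  qed (simp add: agree_def)
  define f where "f = Abs_fps (\<lambda>n. fps_nth (S (Suc n)) n)"
  have lim: "agree n (S n) f" for n
    unfolding agree_def
  proof (intro allI impI)
    fix k assume "k < n"
    then show "fps_nth (S n) k = fps_nth f k"
      using later[of "Suc k" "n - Suc k"] by (simp add: f_def agree_Suc)
  qed
  have fZ: "f \<in> Z" using closed S(1) lim by blast
  have "agree n (F f) f" for n
  proof (cases n)
    case (Suc m)
    have "agree n (F f) (S n)"
      unfolding Suc S(2) by (rule contr[OF fZ S(1) agree_sym[OF lim]])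
    then show ?thesis using agree_trans lim by blast
  qed (simp add: agree_def)
  then have "F f = f" by (rule agree_all)
  with fZ that show thesis by blast
qed

lemma fps_carrier_closed:
  assumes "\<And>n. \<exists>g\<in>fps_carrier X. agree n g f"
  shows "f \<in> fps_carrier X"
proof (rule fps_carrierI)
  fix n
  show "fps_nth f n \<in> X" using assms[of "Suc n"] by (auto simp: agree_Suc dest: fps_carrierD[of _ _ n])
qed

text \<open>These two facts serve to show that an iteration gains an order in each step, and that an element vanishes:
  one inspects the lowest order in which a difference might not be zero.\<close>

lemma linear_map_agree:
  fixes X :: "'x::ab_group_add set" and Y :: "'y::ab_group_add set"
    and s :: "'r::comm_ring_1 cext \<Rightarrow> 'x \<Rightarrow> 'x"
  assumes X: "c_module X s" and Y: "c_module Y t"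
    and F: "linear_map (fps_scale s) (fps_scale t) (fps_carrier X) (fps_carrier Y) F"
    and fg: "f \<in> fps_carrier X" "g \<in> fps_carrier X" "agree n f g"
  shows "agree n (F f) (F g)"
  unfolding linear_map_fps_coeffs[OF X Y F fg(1)] linear_map_fps_coeffs[OF X Y F fg(2)]
  using fg(3) unfolding agree_def fps_extend_nth by (auto intro!: sum.cong)

lemma linear_map_lowest_order:
  fixes X :: "'x::ab_group_add set" and Y :: "'y::ab_group_add set"
    and s :: "'r::comm_ring_1 cext \<Rightarrow> 'x \<Rightarrow> 'x"
  assumes X: "c_module X s" and Y: "c_module Y t"
    and F: "linear_map (fps_scale s) (fps_scale t) (fps_carrier X) (fps_carrier Y) F"
    and F0: "\<And>f. f \<in> fps_carrier X \<Longrightarrow> fps_nth (F f) 0 = F\<^sub>0 (fps_nth f 0)"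
    and f: "f \<in> fps_carrier X" "\<And>k. k < n \<Longrightarrow> fps_nth f k = 0"
  shows "fps_nth (F f) n = F\<^sub>0 (fps_nth f n)"
proof -
  have T0: "fps_nth (F (fps_const 0)) r = 0" for r
    using linear_map_zero[OF F c_module_fps[OF X]] by simp
  have "fps_nth (F f) n = (\<Sum>r\<le>n. if r = 0 then fps_nth (F (fps_const (fps_nth f n))) 0 else 0)"
    unfolding linear_map_fps_coeffs[OF X Y F f(1)] fps_extend_nth
    using f(2) T0 by (intro sum.cong) auto
  also have "\<dots> = F\<^sub>0 (fps_nth f n)"
    using F0[OF fps_const_in[OF c_moduleD(1)[OF X] fps_carrierD[OF f(1)]]] by simp
  finally show ?thesis .
qed

lemma fps_zero_by_order:
  fixes f :: "'x::zero fps"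
  assumes "\<And>n. (\<And>k. k < n \<Longrightarrow> fps_nth f k = 0) \<Longrightarrow> fps_nth f n = 0"
  shows "f = 0"
proof (rule fps_ext)
  fix n show "fps_nth f n = fps_nth 0 n"
    using assms by (induction n rule: less_induct) simp
qed

section \<open>Perturbations of the identity and of idempotents\<close>

text \<open>The maps \<open>id + O(\<lambda>)\<close>. Without reference to coefficients, composites and inverses need no computation.\<close>

definition perturbs_id ::
    "'x::ab_group_add set \<Rightarrow> ('r::comm_ring_1 cext \<Rightarrow> 'x \<Rightarrow> 'x) \<Rightarrow> ('x fps \<Rightarrow> 'x fps) \<Rightarrow> bool" where
  "perturbs_id X s F \<longleftrightarrow>
     linear_map (fps_scale s) (fps_scale s) (fps_carrier X) (fps_carrier X) F \<and>
     (\<forall>f\<in>fps_carrier X. fps_nth (F f) 0 = fps_nth f 0)"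

lemma perturbs_id_coeffs:
  assumes X: "c_module X s" and F: "perturbs_id X s F"
  obtains T where "formal_perturbation_of_id X s T" "\<And>f. f \<in> fps_carrier X \<Longrightarrow> fps_extend T f = F f"
proof
  let ?T = "\<lambda>r x. fps_nth (F (fps_const x)) r"
  have L: "linear_map (fps_scale s) (fps_scale s) (fps_carrier X) (fps_carrier X) F"
    using F by (simp add: perturbs_id_def)
  show "formal_perturbation_of_id X s ?T"
    using linear_map_coeff[OF X X L] F fps_const_in[OF c_moduleD(1)[OF X]]
    by (auto simp: formal_perturbation_of_id_def perturbs_id_def)
  show "fps_extend ?T f = F f" if "f \<in> fps_carrier X" for f
    using linear_map_fps_coeffs[OF X X L that] by simp
qed

text \<open>Let \<open>F\<close> deform a map \<open>i\<close> with left inverse \<open>p\<close>. Then \<open>F\<close> is injective, by looking at the lowest order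
  of an element of its kernel, and \<open>p (y - F f) = 0\<close> is solved for \<open>f\<close> order by order: replacing
  \<open>f\<close> by \<open>f + p (y - F f)\<close> improves the solution by one order.\<close>

lemma deformed_section:
  fixes X :: "'x::ab_group_add set" and E :: "'e::ab_group_add set"
    and s :: "'r::comm_ring_1 cext \<Rightarrow> 'x \<Rightarrow> 'x"
  assumes E: "c_module E t" and X: "c_module X s"
    and F: "linear_map (fps_scale t) (fps_scale s) (fps_carrier E) (fps_carrier X) F"
    and F0: "\<And>f. f \<in> fps_carrier E \<Longrightarrow> fps_nth (F f) 0 = i (fps_nth f 0)"
    and p: "linear_map s t X E p" and pi: "\<And>x. x \<in> E \<Longrightarrow> p (i x) = x"
  shows "inj_on F (fps_carrier E)"
    and "y \<in> fps_carrier X \<Longrightarrow> \<exists>f\<in>fps_carrier E. \<forall>n. p (fps_nth (y - F f) n) = 0"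
proof -
  let ?X = "fps_carrier X" and ?E = "fps_carrier E"
  note XX = c_module_fps[OF X] note EE = c_module_fps[OF E]
  have low: "p (fps_nth (F f) n) = fps_nth f n"
    if "f \<in> ?E" "\<And>k. k < n \<Longrightarrow> fps_nth f k = 0" for f n
    using linear_map_lowest_order[OF E X F F0 that] pi[OF fps_carrierD[OF that(1)]] by simp
  show "inj_on F ?E"
  proof (rule inj_onI)
    fix f g assume f: "f \<in> ?E" and g: "g \<in> ?E" and eq: "F f = F g"
    have "F (f - g) = 0" using linear_map_diff[OF F EE f g] eq by simp
    then have "f - g = 0"
      using low[OF c_moduleD(4)[OF EE f g]] linear_map_zero[OF p X]
      by (intro fps_zero_by_order) (metis fps_zero_nth)
    then show "f = g" by simp
  qed
  assume y: "y \<in> ?X"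
  define P where "P f = Abs_fps (\<lambda>n. p (fps_nth f n))" for f :: "'x fps"
  have Pn: "fps_nth (P f) n = p (fps_nth f n)" for f n by (simp add: P_def)
  let ?G = "\<lambda>f. f + P (y - F f)"
  have G: "?G f \<in> ?E" if "f \<in> ?E" for f
    using c_moduleD(4)[OF XX y linear_mapD(1)[OF F that]]
    by (intro c_moduleD(2)[OF EE that] fps_carrierI) (auto simp only: Pn dest: fps_carrierD intro: linear_mapD(1)[OF p])
  have contr: "agree (Suc n) (?G f) (?G g)" if f: "f \<in> ?E" and g: "g \<in> ?E" and ag: "agree n f g" for n f g
  proof -
    have zero: "fps_nth (f - g) k = 0" if "k < n" for k using ag that by (auto simp: agree_def)
    have "agree n (F f) (F g)" by (rule linear_map_agree[OF E X F f g ag])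
    with ag have "agree n (?G f) (?G g)" by (simp add: agree_def Pn)
    have "p (fps_nth (F f) n) - p (fps_nth (F g) n) = fps_nth (f - g) n"
      using low[OF c_moduleD(4)[OF EE f g] zero] linear_map_diff[OF F EE f g]
        linear_map_diff[OF p X fps_carrierD[OF linear_mapD(1)[OF F f]] fps_carrierD[OF linear_mapD(1)[OF F g]]]
      by simp
    moreover have "p (fps_nth (y - F h) n) = p (fps_nth y n) - p (fps_nth (F h) n)" if "h \<in> ?E" for h
      using linear_map_diff[OF p X fps_carrierD[OF y] fps_carrierD[OF linear_mapD(1)[OF F that]]] by simp
    from this[OF f] this[OF g]
    have "fps_nth (P (y - F f)) n = p (fps_nth y n) - p (fps_nth (F f) n)"
      "fps_nth (P (y - F g)) n = p (fps_nth y n) - p (fps_nth (F g) n)" unfolding Pn .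
    then have "fps_nth (?G f) n - fps_nth (?G g) n =
        fps_nth (f - g) n - (p (fps_nth (F f) n) - p (fps_nth (F g) n))"
      by simp
    ultimately have "fps_nth (?G f) n = fps_nth (?G g) n" by simp
    with \<open>agree n (?G f) (?G g)\<close> show ?thesis by (simp add: agree_Suc)
  qed
  obtain f where f: "f \<in> ?E" "?G f = f"
    by (rule fps_contraction_fixpoint[of 0 ?E ?G, OF c_moduleD(1)[OF EE] G contr fps_carrier_closed]) auto
  have "fps_nth (P (y - F f)) n = 0" for n using f(2) by simp
  then show "\<exists>f\<in>?E. \<forall>n. p (fps_nth (y - F f) n) = 0"
    using f(1) unfolding Pn by blast
qed

lemma perturbs_id_bij:
  fixes X :: "'x::ab_group_add set" and s :: "'r::comm_ring_1 cext \<Rightarrow> 'x \<Rightarrow> 'x"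
  assumes X: "c_module X s" and F: "perturbs_id X s F"
  shows "bij_betw F (fps_carrier X) (fps_carrier X)"
proof -
  have L: "linear_map (fps_scale s) (fps_scale s) (fps_carrier X) (fps_carrier X) F"
    and F0: "\<And>f. f \<in> fps_carrier X \<Longrightarrow> fps_nth (F f) 0 = (\<lambda>x. x) (fps_nth f 0)"
    and I: "linear_map s s X X (\<lambda>x. x)"
    using F by (simp_all add: perturbs_id_def linear_map_def)
  have "y \<in> F ` fps_carrier X" if y: "y \<in> fps_carrier X" for y
  proof -
    obtain f where f: "f \<in> fps_carrier X" "\<forall>n. fps_nth (y - F f) n = 0"
      using deformed_section(2)[OF X X L F0 I refl y] by blast
    then have "y = F f" by (intro fps_ext) simp
    with f(1) show ?thesis by blast
  qed
  then show ?thesis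
    using deformed_section(1)[OF X X L F0 I refl] linear_mapD(1)[OF L] unfolding bij_betw_def by blast
qed

text \<open>Used to compare two identifications of \<open>X[[\<lambda>]]\<close> with the same module \<open>Y\<close>; \<open>head\<close> is the part of order
  \<open>\<lambda>\<^sup>0\<close> of an element of \<open>Y\<close>.\<close>

lemma perturbs_id_compose_inverse:
  fixes X :: "'x::ab_group_add set" and s :: "'r::comm_ring_1 cext \<Rightarrow> 'x \<Rightarrow> 'x"
  assumes X: "c_module X s"
    and F: "linear_map (fps_scale s) u (fps_carrier X) Y F" "bij_betw F (fps_carrier X) Y"
    and G: "linear_map (fps_scale s) u (fps_carrier X) Y G"
    and 0: "\<And>f. f \<in> fps_carrier X \<Longrightarrow> head (F f) = fps_nth f 0"
      "\<And>f. f \<in> fps_carrier X \<Longrightarrow> head (G f) = fps_nth f 0"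
  shows "perturbs_id X s (\<lambda>f. inv_into (fps_carrier X) F (G f))"
  unfolding perturbs_id_def
proof
  show "linear_map (fps_scale s) (fps_scale s) (fps_carrier X) (fps_carrier X)
      (\<lambda>f. inv_into (fps_carrier X) F (G f))"
    by (rule linear_map_compose[OF G linear_map_inverse[OF F c_module_fps[OF X]]])
  show "\<forall>f\<in>fps_carrier X. fps_nth (inv_into (fps_carrier X) F (G f)) 0 = fps_nth f 0"
  proof
    fix f assume f: "f \<in> fps_carrier X"
    let ?g = "inv_into (fps_carrier X) F (G f)"
    have "?g \<in> fps_carrier X" "F ?g = G f"
      using bij_betw_apply[OF bij_betw_inv_into[OF F(2)] linear_mapD(1)[OF G f]]
        bij_betw_inv_into_right[OF F(2) linear_mapD(1)[OF G f]] by auto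
    then show "fps_nth ?g 0 = fps_nth f 0" using 0(1)[of ?g] 0(2)[OF f] by simp
  qed
qed

text \<open>With \<open>E = p X\<close>, it remains to see that the residue \<open>z = y - F f\<close> of an element \<open>y\<close> in the range of \<open>F\<close> is
  zero. It satisfies \<open>F z = z\<close> and \<open>p z = 0\<close>, and in lowest order \<open>F z\<close> is \<open>p z\<close>.\<close>

lemma deformed_idempotent_bij:
  fixes X :: "'x::ab_group_add set" and s :: "'r::comm_ring_1 cext \<Rightarrow> 'x \<Rightarrow> 'x"
  assumes X: "c_module X s" and p: "linear_map s s X X p" and pp: "\<And>x. x \<in> X \<Longrightarrow> p (p x) = p x"
    and pX: "c_module (p ` X) s"
    and F: "linear_map (fps_scale s) (fps_scale s) (fps_carrier X) (fps_carrier X) F"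
    and FF: "\<And>f. f \<in> fps_carrier X \<Longrightarrow> F (F f) = F f"
    and F0: "\<And>f. f \<in> fps_carrier X \<Longrightarrow> fps_nth (F f) 0 = p (fps_nth f 0)"
  shows "bij_betw F (fps_carrier (p ` X)) (F ` fps_carrier X)"
proof -
  let ?X = "fps_carrier X" and ?E = "fps_carrier (p ` X)"
  note XX = c_module_fps[OF X]
  have EX: "f \<in> ?X" if "f \<in> ?E" for f
  proof (rule fps_carrierI)
    show "fps_nth f n \<in> X" for n using fps_carrierD[OF that, of n] linear_mapD(1)[OF p] by auto
  qed
  have FE: "linear_map (fps_scale s) (fps_scale s) ?E ?X F"
    by (rule linear_mapI) (use EX linear_mapD[OF F] in blast)+
  have p': "linear_map s s X (p ` X) p"
    by (rule linear_mapI) (use linear_mapD[OF p] in blast)+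
  have ppp: "p (p x) = x" if "x \<in> p ` X" for x using that pp by (metis imageE)
  have "y \<in> F ` ?E" if yF: "y \<in> F ` ?X" for y
  proof -
    obtain x where "x \<in> ?X" "y = F x" using yF by blast
    then have y: "y \<in> ?X" "F y = y" using FF linear_mapD(1)[OF F] by metis+
    obtain f where f: "f \<in> ?E" "\<forall>n. p (fps_nth (y - F f) n) = 0"
      using deformed_section(2)[OF pX X FE F0[OF EX] p' ppp y(1)] by blast
    define z where "z = y - F f"
    have Ff: "F f \<in> ?X" by (rule linear_mapD(1)[OF F EX[OF f(1)]])
    have z: "z \<in> ?X" "F z = z"
      using c_moduleD(4)[OF XX y(1) Ff] linear_map_diff[OF F XX y(1) Ff] y(2) FF[OF EX[OF f(1)]]
      by (auto simp: z_def)
    have "z = 0"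
      using linear_map_lowest_order[OF X X F F0 z(1)] z(2) f(2)
      by (intro fps_zero_by_order) (simp add: z_def)
    then show ?thesis using f(1) by (simp add: z_def)
  qed
  moreover have "F ` ?E \<subseteq> F ` ?X" using EX by auto
  ultimately show ?thesis using deformed_section(1)[OF pX X FE F0[OF EX] p' ppp] unfolding bij_betw_def by blast
qed

text \<open>The same with \<open>X[[\<lambda>]]\<close> replaced by a copy \<open>Y\<close> of it. In the applications \<open>X\<close> consists of vectors or matrices
  over \<open>A\<close>, and \<open>Y\<close> of vectors or matrices over \<open>A[[\<lambda>]]\<close>.\<close>

lemma swapped_idempotent_bij:
  fixes X :: "'x::ab_group_add set" and Y :: "'y::ab_group_add set"
    and s :: "'r::comm_ring_1 cext \<Rightarrow> 'x \<Rightarrow> 'x"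
  assumes X: "c_module X s" and p: "linear_map s s X X p" and pp: "\<And>x. x \<in> X \<Longrightarrow> p (p x) = p x"
    and pX: "c_module (p ` X) s"
    and \<sigma>: "linear_map (fps_scale s) u (fps_carrier X) Y \<sigma>" "bij_betw \<sigma> (fps_carrier X) Y"
    and F: "linear_map u u Y Y F" "\<And>y. y \<in> Y \<Longrightarrow> F (F y) = F y"
    and head: "\<And>f. f \<in> fps_carrier X \<Longrightarrow> head (\<sigma> f) = fps_nth f 0"
      "\<And>y. y \<in> Y \<Longrightarrow> head (F y) = p (head y)"
  shows "bij_betw (\<lambda>f. F (\<sigma> f)) (fps_carrier (p ` X)) (F ` Y)"
proof -
  let ?X = "fps_carrier X"
  define \<tau> where "\<tau> = inv_into ?X \<sigma>"
  have \<sigma>Y: "\<sigma> f \<in> Y" "\<tau> (\<sigma> f) = f" if "f \<in> ?X" for f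
    using bij_betw_apply[OF \<sigma>(2) that] bij_betw_inv_into_left[OF \<sigma>(2) that] by (auto simp: \<tau>_def)
  have \<tau>X: "\<tau> y \<in> ?X" "\<sigma> (\<tau> y) = y" if "y \<in> Y" for y
    using bij_betw_apply[OF bij_betw_inv_into[OF \<sigma>(2)] that] bij_betw_inv_into_right[OF \<sigma>(2) that]
    by (auto simp: \<tau>_def)
  have FY: "F y \<in> Y" if "y \<in> Y" for y using linear_mapD(1)[OF F(1) that] .
  let ?G = "\<lambda>f. \<tau> (F (\<sigma> f))"
  have G1: "linear_map (fps_scale s) (fps_scale s) ?X ?X ?G"
    unfolding \<tau>_def
    by (rule linear_map_compose[OF linear_map_compose[OF \<sigma>(1) F(1)] linear_map_inverse[OF \<sigma> c_module_fps[OF X]]])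
  have G2: "?G (?G f) = ?G f" if "f \<in> ?X" for f using \<tau>X(2)[OF FY] \<sigma>Y(1)[OF that] F(2) by simp
  have G3: "fps_nth (?G f) 0 = p (fps_nth f 0)" if "f \<in> ?X" for f
    using head(1)[OF \<tau>X(1)[OF FY[OF \<sigma>Y(1)[OF that]]]] \<tau>X(2)[OF FY[OF \<sigma>Y(1)[OF that]]]
      head(2)[OF \<sigma>Y(1)[OF that]] head(1)[OF that] by simp
  have G: "bij_betw ?G (fps_carrier (p ` X)) (?G ` ?X)"
    by (rule deformed_idempotent_bij[where F = ?G, OF X p pp pX G1 G2 G3])
  have GX: "?G ` ?X \<subseteq> ?X" using \<tau>X(1)[OF FY[OF \<sigma>Y(1)]] by auto
  have "bij_betw (\<sigma> \<circ> ?G) (fps_carrier (p ` X)) (\<sigma> ` ?G ` ?X)"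
    by (rule bij_betw_trans[OF G]) (rule bij_betw_subset[OF \<sigma>(2) GX refl])
  moreover have "(\<sigma> \<circ> ?G) f = F (\<sigma> f)" if "f \<in> ?X" for f using \<tau>X(2)[OF FY[OF \<sigma>Y(1)[OF that]]] by simp
  moreover have "fps_carrier (p ` X) \<subseteq> ?X"
  proof
    fix f assume f: "f \<in> fps_carrier (p ` X)"
    show "f \<in> ?X"
    proof (rule fps_carrierI)
      show "fps_nth f n \<in> X" for n using fps_carrierD[OF f, of n] linear_mapD(1)[OF p] by auto
    qed
  qed
  moreover have "\<sigma> ` ?G ` ?X = F ` Y"
  proof -
    have "\<sigma> ` ?G ` ?X = (\<lambda>f. F (\<sigma> f)) ` ?X"
      unfolding image_image by (rule image_cong) (use \<tau>X(2)[OF FY[OF \<sigma>Y(1)]] in auto)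
    also have "\<dots> = F ` Y" using \<sigma>(2) by (auto simp: bij_betw_def)
    finally show ?thesis .
  qed
  ultimately show ?thesis by (subst bij_betw_cong[of _ _ "\<sigma> \<circ> ?G"]) auto
qed

section \<open>Star algebras and their Hermitian deformations\<close>

locale star_alg_on =
  fixes A :: "('r::linordered_idom, 'a::ab_group_add) star_alg"
  assumes star_algebra: "star_algebra A"
begin

lemma c_module: "c_module (acarrier A) (ascale A)"
  using star_algebra by (simp add: star_algebra_def)

lemmas zero_in = c_moduleD(1)[OF c_module] and add_in = c_moduleD(2)[OF c_module]
  and diff_in = c_moduleD(4)[OF c_module]
  and scale_in = c_moduleD(5)[OF c_module] and sum_in = c_module_sum_in[OF c_module]

lemma bilinear: "bilinear_map (ascale A) (ascale A) (ascale A) (acarrier A) (acarrier A) (acarrier A) (amult A)"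
  using star_algebra by (simp add: star_algebra_def)

lemma linear_left: "x \<in> acarrier A \<Longrightarrow> linear_map (ascale A) (ascale A) (acarrier A) (acarrier A) (amult A x)"
  and linear_right: "y \<in> acarrier A \<Longrightarrow> linear_map (ascale A) (ascale A) (acarrier A) (acarrier A) (\<lambda>x. amult A x y)"
  using bilinear by (simp_all add: bilinear_map_def)

lemma mult_in: "x \<in> acarrier A \<Longrightarrow> y \<in> acarrier A \<Longrightarrow> amult A x y \<in> acarrier A"
  using linear_mapD(1)[OF linear_left] .

lemma mult_add:
  assumes "x \<in> acarrier A" "y \<in> acarrier A" "z \<in> acarrier A"
  shows "amult A x (y + z) = amult A x y + amult A x z" "amult A (x + y) z = amult A x z + amult A y z"
  using linear_mapD(2)[OF linear_left] linear_mapD(2)[OF linear_right] assms by auto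

lemma mult_diff:
  assumes "x \<in> acarrier A" "y \<in> acarrier A" "z \<in> acarrier A"
  shows "amult A x (y - z) = amult A x y - amult A x z" "amult A (x - y) z = amult A x z - amult A y z"
  using linear_map_diff[OF linear_left c_module] linear_map_diff[OF linear_right c_module] assms by auto

lemma mult_scale:
  assumes "x \<in> acarrier A" "y \<in> acarrier A"
  shows "amult A x (ascale A c y) = ascale A c (amult A x y)" "amult A (ascale A c x) y = ascale A c (amult A x y)"
  using linear_mapD(3)[OF linear_left] linear_mapD(3)[OF linear_right] assms by auto

lemma mult_zero: "x \<in> acarrier A \<Longrightarrow> amult A x 0 = 0" "x \<in> acarrier A \<Longrightarrow> amult A 0 x = 0"
  using linear_map_zero[OF linear_left c_module] linear_map_zero[OF linear_right c_module] by auto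

lemma mult_sum:
  assumes "x \<in> acarrier A" "\<And>i. i \<in> I \<Longrightarrow> f i \<in> acarrier A"
  shows "amult A x (sum f I) = (\<Sum>i\<in>I. amult A x (f i))" "amult A (sum f I) x = (\<Sum>i\<in>I. amult A (f i) x)"
proof -
  show "amult A x (sum f I) = (\<Sum>i\<in>I. amult A x (f i))"
    by (rule linear_map_sum[OF linear_left[OF assms(1)] c_module assms(2)])
  show "amult A (sum f I) x = (\<Sum>i\<in>I. amult A (f i) x)"
    by (rule linear_map_sum[OF linear_right[OF assms(1)] c_module assms(2)])
qed

lemma mult_assoc:
  "x \<in> acarrier A \<Longrightarrow> y \<in> acarrier A \<Longrightarrow> z \<in> acarrier A \<Longrightarrow>
    amult A (amult A x y) z = amult A x (amult A y z)"
  using star_algebra by (simp add: star_algebra_def)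

lemma star_linear:
  "linear_map (ascale A) (\<lambda>c. ascale A (cconj c)) (acarrier A) (acarrier A) (astar A)"
  using star_algebra by (simp add: star_algebra_def)

lemmas star_in = linear_mapD(1)[OF star_linear] and star_add = linear_mapD(2)[OF star_linear]
  and star_scale = linear_mapD(3)[OF star_linear] and star_diff = linear_map_diff[OF star_linear c_module]
  and star_zero = linear_map_zero[OF star_linear c_module] and star_sum = linear_map_sum[OF star_linear c_module]

lemma star_star: "x \<in> acarrier A \<Longrightarrow> astar A (astar A x) = x"
  using star_algebra by (simp add: star_algebra_def)

lemma star_mult:
  "x \<in> acarrier A \<Longrightarrow> y \<in> acarrier A \<Longrightarrow> astar A (amult A x y) = amult A (astar A y) (astar A x)"
  using star_algebra by (simp add: star_algebra_def)

lemma star_mult_self_positive: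
  assumes "\<And>i. i \<in> I \<Longrightarrow> f i \<in> acarrier A"
  shows "(\<Sum>i\<in>I. amult A (astar A (f i)) (f i)) \<in> positive_elements A"
proof -
  have t: "amult A (astar A (f i)) (f i) \<in> acarrier A" if "i \<in> I" for i
    using assms that by (auto intro: mult_in star_in)
  have "cnonneg (\<omega> (\<Sum>i\<in>I. amult A (astar A (f i)) (f i)))" if \<omega>: "positive_functional A \<omega>" for \<omega>
  proof -
    have L: "linear_map (ascale A) (*) (acarrier A) UNIV \<omega>"
      and "\<And>a. a \<in> acarrier A \<Longrightarrow> cnonneg (\<omega> (amult A (astar A a) a))"
      using \<omega> by (auto simp: positive_functional_def)
    then have "cnonneg (\<Sum>i\<in>I. \<omega> (amult A (astar A (f i)) (f i)))"
      using assms by (auto simp: cnonneg_def cext_sum intro!: sum_nonneg)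
    then show ?thesis by (subst linear_map_sum[OF L c_module]) (auto intro: t)
  qed
  moreover have "astar A (\<Sum>i\<in>I. amult A (astar A (f i)) (f i)) = (\<Sum>i\<in>I. amult A (astar A (f i)) (f i))"
    using assms t by (simp add: star_sum star_mult star_in star_star)
  ultimately show ?thesis using sum_in[of I] t by (auto simp: positive_elements_def)
qed

end

lemma fps_extend2_agree:
  "agree n f f' \<Longrightarrow> agree n g g' \<Longrightarrow> agree n (fps_extend2 C f g) (fps_extend2 C f' g')"
  unfolding agree_def fps_extend2_nth by (auto intro!: sum.cong arg_cong2[where f = "C _"])

lemma agree_limit_eq:
  assumes "\<And>n. \<exists>g. agree n g f \<and> U g = V g"
    and "\<And>n g. agree n g f \<Longrightarrow> agree n (U g) (U f)" "\<And>n g. agree n g f \<Longrightarrow> agree n (V g) (V f)"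
  shows "U f = V f"
  by (rule agree_all) (metis assms agree_sym agree_trans)

locale hermitian_deform = star_alg_on A
  for A :: "('r::linordered_idom, 'a::ab_group_add) star_alg" +
  fixes C :: "nat \<Rightarrow> 'a \<Rightarrow> 'a \<Rightarrow> 'a"
  assumes hermitian: "hermitian_deformation A C"
begin

abbreviation "DA \<equiv> deformed_algebra A C"

lemma DA_simps:
  "acarrier DA = fps_carrier (acarrier A)" "amult DA = fps_extend2 C"
  "ascale DA = fps_scale (ascale A)" "fps_nth (astar DA f) n = astar A (fps_nth f n)"
  by (simp_all add: deformed_algebra_def)

lemma C_0: "a \<in> acarrier A \<Longrightarrow> b \<in> acarrier A \<Longrightarrow> C 0 a b = amult A a b"
  using hermitian by (simp add: hermitian_deformation_def formal_deformation_def)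

lemma DA_bilinear:
  "bilinear_map (ascale DA) (ascale DA) (ascale DA) (acarrier DA) (acarrier DA) (acarrier DA) (amult DA)"
  unfolding DA_simps using hermitian
  by (intro bilinear_map_fps_extend2[OF c_module c_module c_module])
    (simp add: hermitian_deformation_def formal_deformation_def)

lemma star_algebra_DA: "star_algebra DA"
proof -
  have "linear_map (ascale DA) (\<lambda>c. ascale DA (cconj c)) (acarrier DA) (acarrier DA) (astar DA)"
    unfolding linear_map_def DA_simps
    by (auto intro!: fps_ext fps_carrierI simp: DA_simps fps_carrierD star_in star_add fps_scale_nth
        cext_nth_simps star_sum star_scale scale_in)
  moreover have "\<forall>a\<in>acarrier DA. astar DA (astar DA a) = a"
    unfolding DA_simps by (auto intro!: fps_ext simp: DA_simps star_star fps_carrierD)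
  ultimately show ?thesis
    using DA_bilinear hermitian c_module_fps[OF c_module]
    by (simp add: star_algebra_def hermitian_deformation_def formal_deformation_def DA_simps)
qed

sublocale DA: star_alg_on DA by unfold_locales (rule star_algebra_DA)

lemma const_in: "a \<in> acarrier A \<Longrightarrow> fps_const a \<in> acarrier DA"
  by (simp add: DA_simps fps_const_in zero_in)

lemma nth_in: "f \<in> acarrier DA \<Longrightarrow> fps_nth f n \<in> acarrier A"
  by (simp add: DA_simps fps_carrierD)

lemma mult_nth_0: "f \<in> acarrier DA \<Longrightarrow> g \<in> acarrier DA \<Longrightarrow>
    fps_nth (amult DA f g) 0 = amult A (fps_nth f 0) (fps_nth g 0)"
  using C_0 nth_in by (simp add: DA_simps(2) fps_extend2_0)

lemma mult_lowest_order:
  assumes "f \<in> acarrier DA" "g \<in> acarrier DA" "\<And>k. k < n \<Longrightarrow> fps_nth g k = 0"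
  shows "fps_nth (amult DA f g) n = amult A (fps_nth f 0) (fps_nth g n)"
    and "fps_nth (amult DA g f) n = amult A (fps_nth g n) (fps_nth f 0)"
proof -
  note L = DA.linear_left[OF assms(1), unfolded DA_simps(1,3)]
    and R = DA.linear_right[OF assms(1), unfolded DA_simps(1,3)]
  have 0: "fps_nth (amult DA f h) 0 = amult A (fps_nth f 0) (fps_nth h 0)"
    "fps_nth (amult DA h f) 0 = amult A (fps_nth h 0) (fps_nth f 0)"
    if "h \<in> fps_carrier (acarrier A)" for h
    using mult_nth_0 assms(1) that by (auto simp: DA_simps(1))
  show "fps_nth (amult DA f g) n = amult A (fps_nth f 0) (fps_nth g n)"
    using linear_map_lowest_order[OF c_module c_module L 0(1)] assms by (simp add: DA_simps(1))
  show "fps_nth (amult DA g f) n = amult A (fps_nth g n) (fps_nth f 0)"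
    using linear_map_lowest_order[OF c_module c_module R 0(2)] assms by (simp add: DA_simps(1))
qed

lemma mult_agree: "agree n f f' \<Longrightarrow> agree n g g' \<Longrightarrow> agree n (amult DA f g) (amult DA f' g')"
  unfolding DA_simps(2) by (rule fps_extend2_agree)

lemma star_agree: "agree n f g \<Longrightarrow> agree n (astar DA f) (astar DA g)"
  by (simp add: agree_def DA_simps(4))

text \<open>The unit of \<open>A\<close> acts from both sides by maps \<open>id + O(\<lambda>)\<close>. These are invertible. The preimage of the old unit
  under left multiplication is a left unit for the deformed product, the one under right multiplication
  is a right unit.\<close>

lemma deformed_unit:
  assumes e: "is_one A e" shows "\<exists>u. is_one DA u"
proof -
  let ?e = "fps_const e"
  have e': "e \<in> acarrier A" "\<And>a. a \<in> acarrier A \<Longrightarrow> amult A e a = a" "\<And>a. a \<in> acarrier A \<Longrightarrow> amult A a e = a"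
    using e by (auto simp: is_one_def)
  note E = const_in[OF e'(1)]
  have "perturbs_id (acarrier A) (ascale A) (amult DA ?e)"
    "perturbs_id (acarrier A) (ascale A) (\<lambda>f. amult DA f ?e)"
    unfolding perturbs_id_def
    using DA.linear_left[OF E] DA.linear_right[OF E] mult_nth_0 E e' nth_in
    by (auto simp: DA_simps(1,3))
  then have bij: "bij_betw (amult DA ?e) (acarrier DA) (acarrier DA)"
    "bij_betw (\<lambda>f. amult DA f ?e) (acarrier DA) (acarrier DA)"
    unfolding DA_simps(1) by (auto intro: perturbs_id_bij[OF c_module])
  obtain u v where u: "u \<in> acarrier DA" "amult DA ?e u = ?e" and v: "v \<in> acarrier DA" "amult DA v ?e = ?e"
    using E bij unfolding bij_betw_def by (metis (no_types, lifting) image_iff)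
  have l: "amult DA u a = a" if a: "a \<in> acarrier DA" for a
  proof (rule inj_onD[OF bij_betw_imp_inj_on[OF bij(1)] _ DA.mult_in[OF u(1) a] a])
    show "amult DA ?e (amult DA u a) = amult DA ?e a" using DA.mult_assoc[OF E u(1) a] u(2) by simp
  qed
  have r: "amult DA a v = a" if a: "a \<in> acarrier DA" for a
  proof (rule inj_onD[OF bij_betw_imp_inj_on[OF bij(2)] _ DA.mult_in[OF a v(1)] a])
    show "amult DA (amult DA a v) ?e = amult DA a ?e" using DA.mult_assoc[OF a v(1) E] v(2) by simp
  qed
  have "u = v" using l[OF v(1)] r[OF u(1)] by simp
  then show ?thesis using u(1) l r by (auto simp: is_one_def)
qed

text \<open>On elements \<open>q = p + O(\<lambda>)\<close> commuting with \<open>p\<close>, the map \<open>q \<mapsto> q - (1 - 2p) (q - q\<^sup>2)\<close> is Newton's iteration for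
  \<open>q - q\<^sup>2 = 0\<close>, with the derivative \<open>1 - 2p\<close> taken at \<open>\<lambda> = 0\<close>, where it is its own inverse. Restricting to the
  Hermitian elements that commute with \<open>p\<close> makes the derivative a multiplication operator, and the limit
  Hermitian.\<close>

lemma lift_projection:
  assumes p: "p \<in> acarrier A" "amult A p p = p" "astar A p = p"
  obtains P where "P \<in> acarrier DA" "amult DA P P = P" "astar DA P = P" "fps_nth P 0 = p"
proof -
  define c where "c = fps_const p"
  have c: "c \<in> acarrier DA" "fps_nth c 0 = p" "astar DA c = c"
    using const_in[OF p(1)] p(3) by (auto simp: c_def DA_simps star_zero intro!: fps_ext)
  define Z where "Z = {q \<in> acarrier DA. fps_nth q 0 = p \<and> astar DA q = q \<and> amult DA c q = amult DA q c}"
  (* F is the iteration above, written without the unit of the deformed algebra *)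
  define G where "G q = amult DA c (q - amult DA q q)" for q
  define F where "F q = G q + G q + amult DA q q" for q
  note cl = DA.mult_in DA.add_in DA.diff_in
  have ZD: "q \<in> acarrier DA" "fps_nth q 0 = p" "astar DA q = q" "amult DA c q = amult DA q c"
    if "q \<in> Z" for q using that by (auto simp: Z_def)
  have sq: "amult DA c (amult DA q q) = amult DA (amult DA q q) c" if q: "q \<in> Z" for q
    using DA.mult_assoc[of c q q] DA.mult_assoc[of q c q] DA.mult_assoc[of q q c] ZD[OF q] c(1) by metis
  have GZ: "G q \<in> acarrier DA" "fps_nth (G q) 0 = 0" "astar DA (G q) = G q" "amult DA c (G q) = amult DA (G q) c"
    if q: "q \<in> Z" for q
  proof -
    define z where "z = q - amult DA q q"
    have z: "z \<in> acarrier DA" and G: "G q = amult DA c z"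
      using ZD[OF q] by (auto intro: cl simp: z_def G_def)
    have zc: "amult DA c z = amult DA z c" "astar DA z = z"
      using sq[OF q] ZD[OF q] c(1) by (simp_all add: z_def DA.mult_diff cl DA.star_diff DA.star_mult)
    have z0: "fps_nth z 0 = 0" using ZD[OF q] p by (simp add: z_def mult_nth_0)
    show "G q \<in> acarrier DA" "astar DA (G q) = G q"
      using z c zc by (auto simp: G DA.star_mult intro: cl)
    show "fps_nth (G q) 0 = 0" using z0 mult_nth_0[OF c(1) z] mult_zero(1)[OF p(1)] c(2) by (simp add: G)
    show "amult DA c (G q) = amult DA (G q) c"
      unfolding G using DA.mult_assoc[OF c(1) z c(1)] zc(1) by simp
  qed
  have qq: "amult DA q q \<in> acarrier DA" if "q \<in> Z" for q using ZD[OF that] by (auto intro: cl)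
  have FZ: "F q \<in> Z" if q: "q \<in> Z" for q
    using GZ[OF q] ZD[OF q] sq[OF q] qq[OF q] c(1) p mult_nth_0[of q q]
    by (auto simp: Z_def F_def DA.mult_add DA.star_add DA.star_mult cl)
  have contr: "agree (Suc n) (F f) (F g)" if f: "f \<in> Z" and g: "g \<in> Z" and ag: "agree n f g" for n f g
  proof -
    define d where "d = f - g"
    have d: "d \<in> acarrier DA" using ZD(1)[OF f] ZD(1)[OF g] by (auto simp: d_def intro: cl)
    have low: "fps_nth d k = 0" if "k < n" for k using ag that by (auto simp: d_def agree_def)
    note dn = nth_in[OF d, of n] note pdn = mult_in[OF p(1) dn]
    (* the lowest order term of d commutes with p, which makes the first variation of F vanish *)
    have "amult DA c d = amult DA d c"
      using ZD[OF f] ZD[OF g] c(1) by (simp add: d_def DA.mult_diff)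
    then have comm: "amult A (fps_nth d n) p = amult A p (fps_nth d n)"
      using mult_lowest_order[OF c(1) d low] c(2) by simp
    have "amult DA f f - amult DA g g = amult DA f d + amult DA d g"
      using ZD(1)[OF f] ZD(1)[OF g] by (simp add: d_def DA.mult_diff)
    from arg_cong[OF this, of "\<lambda>h. fps_nth h n"]
    have sqn: "fps_nth (amult DA f f) n - fps_nth (amult DA g g) n =
        amult A p (fps_nth d n) + amult A p (fps_nth d n)"
      using mult_lowest_order(1)[OF ZD(1)[OF f] d low] mult_lowest_order(2)[OF ZD(1)[OF g] d low]
      by (simp add: ZD(2)[OF f] ZD(2)[OF g] comm)
    define w where "w = (f - amult DA f f) - (g - amult DA g g)"
    have w: "w \<in> acarrier DA" using ZD(1)[OF f] ZD(1)[OF g] by (auto simp: w_def intro: cl)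
    have "agree n (f - amult DA f f) (g - amult DA g g)"
      using ag mult_agree[OF ag ag] by (simp add: agree_def)
    then have wlow: "fps_nth w k = 0" if "k < n" for k using that by (auto simp: w_def agree_def)
    have wn: "fps_nth w n = fps_nth d n - (amult A p (fps_nth d n) + amult A p (fps_nth d n))"
      unfolding w_def d_def sqn[unfolded d_def, symmetric] by simp
    have "G f - G g = amult DA c w"
      using ZD(1)[OF f] ZD(1)[OF g] c(1) by (simp add: G_def w_def DA.mult_diff cl)
    from arg_cong[OF this, of "\<lambda>h. fps_nth h n"]
    have "fps_nth (G f) n - fps_nth (G g) n = amult A p (fps_nth w n)"
      using mult_lowest_order(1)[OF c(1) w wlow] c(2) by simp
    also have "\<dots> = - amult A p (fps_nth d n)"
      unfolding wn using p dn pdn mult_assoc[OF p(1) p(1) dn]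
      by (simp add: mult_diff mult_add add_in)
    finally have "fps_nth (G g) n = fps_nth (G f) n + amult A p (fps_nth d n)"
      by (simp add: algebra_simps)
    moreover have "fps_nth (amult DA f f) n =
        fps_nth (amult DA g g) n + (amult A p (fps_nth d n) + amult A p (fps_nth d n))"
      using sqn by (simp add: algebra_simps)
    ultimately have "fps_nth (F f) n = fps_nth (F g) n" by (simp add: F_def ac_simps)
    moreover have "agree n (F f) (F g)"
    proof -
      have s: "agree n (amult DA f f) (amult DA g g)" by (rule mult_agree[OF ag ag])
      have "agree n (G f) (G g)" unfolding G_def
        by (rule mult_agree) (use s ag in \<open>auto simp: agree_def\<close>)
      with s show ?thesis by (simp add: agree_def F_def)
    qed
    ultimately show ?thesis by (simp add: agree_Suc)
  qed
  have closed: "f \<in> Z" if lim: "\<And>n. \<exists>g\<in>Z. agree n g f" for f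
  proof -
    have "f \<in> acarrier DA"
      unfolding DA_simps(1) by (rule fps_carrier_closed) (use lim ZD(1) in \<open>auto simp: DA_simps(1)\<close>)
    moreover have "fps_nth f 0 = p" using lim[of 1] ZD(2) by (auto simp: agree_def)
    moreover have "astar DA f = f"
      by (rule agree_limit_eq) (use lim ZD(3) star_agree in blast)+
    moreover have "amult DA c f = amult DA f c"
    proof (rule agree_limit_eq[where U = "amult DA c" and V = "\<lambda>g. amult DA g c"])
      show "\<exists>g. agree n g f \<and> amult DA c g = amult DA g c" for n using lim ZD(4) by blast
      fix n g assume ag: "agree n g f"
      have "agree n c c" by (simp add: agree_def)
      then show "agree n (amult DA c g) (amult DA c f)" "agree n (amult DA g c) (amult DA f c)"
        using ag by (auto intro: mult_agree)
    qed
    ultimately show ?thesis by (simp add: Z_def)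
  qed
  have "c \<in> Z" using c by (simp add: Z_def)
  then obtain P where P: "P \<in> Z" "F P = P"
    by (rule fps_contraction_fixpoint[of c Z F, OF _ FZ contr closed])
  define z where "z = P - amult DA P P"
  have z: "z \<in> acarrier DA" using ZD(1)[OF P(1)] by (auto simp: z_def intro: cl)
  (* a fixed point only satisfies (1 - 2p) z = 0; in lowest order this can be multiplied by p *)
  have eq: "z = amult DA c z + amult DA c z"
    using P(2) by (simp add: F_def G_def z_def algebra_simps)
  have "z = 0"
  proof (rule fps_zero_by_order)
    fix n assume "\<And>k. k < n \<Longrightarrow> fps_nth z k = 0"
    then have "fps_nth z n = amult A p (fps_nth z n) + amult A p (fps_nth z n)" (is "?z = ?y + ?y")
      using mult_lowest_order(1)[OF c(1) z] c(2) arg_cong[OF eq, of "\<lambda>h. fps_nth h n"] by simp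
    moreover from this have "?y = amult A p ?y + amult A p ?y"
      using mult_add(1)[OF p(1) mult_in[OF p(1) nth_in[OF z]] mult_in[OF p(1) nth_in[OF z]]] by metis
    then have "?y = 0"
      using mult_assoc[OF p(1) p(1) nth_in[OF z]] p(2) by simp
    ultimately show "fps_nth z n = 0" by simp
  qed
  then show thesis using that[of P] ZD[OF P(1)] by (simp add: z_def)
qed

text \<open>Newton's iteration for \<open>v\<^sup>2 = H\<close>, with the derivative taken at \<open>v = e\<close>, is \<open>v \<mapsto> v + (H - v\<^sup>2) / 2\<close>. It stays among
  the Hermitian elements \<open>e + O(\<lambda>)\<close>, and there gains an order in each step.\<close>

lemma hermitian_square_root:
  fixes c :: "'r fps cext"
  assumes e: "is_one A e" and H: "H \<in> acarrier DA" "astar DA H = H" "fps_nth H 0 = e"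
    and half: "c + c = 1" "cconj c = c"
  obtains U where "U \<in> acarrier DA" "astar DA U = U" "fps_nth U 0 = e" "amult DA U U = H"
proof -
  have e': "e \<in> acarrier A" "\<And>a. a \<in> acarrier A \<Longrightarrow> amult A e a = a" "\<And>a. a \<in> acarrier A \<Longrightarrow> amult A a e = a"
    using e by (auto simp: is_one_def)
  have half_add: "ascale DA c f + ascale DA c f = f" if "f \<in> acarrier DA" for f
    using c_moduleD(7)[OF DA.c_module that, of c c] c_moduleD(9)[OF DA.c_module that] half(1) by simp
  define Z where "Z = {v \<in> acarrier DA. fps_nth v 0 = e \<and> astar DA v = v}"
  define F where "F v = v + ascale DA c (H - amult DA v v)" for v
  note cl = DA.mult_in DA.add_in DA.diff_in DA.scale_in
  have ZD: "v \<in> acarrier DA" "fps_nth v 0 = e" "astar DA v = v" if "v \<in> Z" for v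
    using that by (auto simp: Z_def)
  have scale_agree: "agree n f g \<Longrightarrow> agree n (ascale DA c f) (ascale DA c g)" for n f g
    by (simp add: agree_def DA_simps(3) fps_scale_nth)
  have scale_low: "fps_nth (ascale DA c f) n = ascale A (cext_nth c 0) (fps_nth f n)"
    if "f \<in> acarrier DA" "\<And>k. k < n \<Longrightarrow> fps_nth f k = 0" for f n
  proof -
    have "fps_nth (ascale DA c f) n = (\<Sum>k\<le>n. if k = 0 then ascale A (cext_nth c 0) (fps_nth f n) else 0)"
      unfolding DA_simps(3) fps_scale_nth using that
      by (intro sum.cong) (auto simp: c_module_scale_zero[OF c_module])
    then show ?thesis by simp
  qed
  have FZ: "F v \<in> Z" if v: "v \<in> Z" for v
  proof -
    have d: "H - amult DA v v \<in> acarrier DA" using H(1) ZD[OF v] by (auto intro: cl)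
    have "fps_nth (H - amult DA v v) 0 = 0"
      using H(3) ZD[OF v] e' by (simp add: mult_nth_0)
    then have "fps_nth (F v) 0 = e"
      using scale_low[OF d, of 0] ZD(2)[OF v] by (simp add: F_def c_module_scale_zero[OF c_module])
    moreover have "astar DA (F v) = F v"
      using d ZD[OF v] H half(2)
      by (simp add: F_def DA.star_add DA.star_scale DA.star_diff DA.star_mult cl)
    ultimately show ?thesis using d ZD(1)[OF v] by (auto simp: Z_def F_def intro: cl)
  qed
  have contr: "agree (Suc n) (F f) (F g)" if f: "f \<in> Z" and g: "g \<in> Z" and ag: "agree n f g" for n f g
  proof -
    define d where "d = f - g"
    have d: "d \<in> acarrier DA" using ZD(1)[OF f] ZD(1)[OF g] by (auto simp: d_def intro: cl)
    have low: "fps_nth d k = 0" if "k < n" for k using ag that by (auto simp: d_def agree_def)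
    define w where "w = amult DA f f - amult DA g g"
    have w: "w \<in> acarrier DA" using ZD(1)[OF f] ZD(1)[OF g] by (auto simp: w_def intro: cl)
    have "w = amult DA f d + amult DA d g"
      using ZD(1)[OF f] ZD(1)[OF g] by (simp add: d_def w_def DA.mult_diff)
    then have wn: "fps_nth w n = fps_nth d n + fps_nth d n"
      using mult_lowest_order(1)[OF ZD(1)[OF f] d low] mult_lowest_order(2)[OF ZD(1)[OF g] d low]
        ZD(2)[OF f] ZD(2)[OF g] e' nth_in[OF d] by simp
    have "agree n (amult DA f f) (amult DA g g)" by (rule mult_agree[OF ag ag])
    then have wlow: "fps_nth w k = 0" if "k < n" for k using that by (auto simp: w_def agree_def)
    have c0: "cext_nth c 0 + cext_nth c 0 = 1"
      using cext_nth_simps(1)[of c c 0] half(1) by (simp add: cext_nth_simps(3))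
    have "fps_nth (ascale DA c w) n = ascale A (cext_nth c 0) (fps_nth d n + fps_nth d n)"
      using scale_low[OF w wlow] wn by simp
    also have "\<dots> = fps_nth d n"
      using c_moduleD(6)[OF c_module nth_in[OF d] nth_in[OF d], of "cext_nth c 0"]
        c_moduleD(7)[OF c_module nth_in[OF d, of n], where c = "cext_nth c 0" and d = "cext_nth c 0"]
        c_moduleD(9)[OF c_module nth_in[OF d]] c0 by simp
    finally have sc: "fps_nth (ascale DA c w) n = fps_nth d n" .
    have "F f - F g = d - ascale DA c w"
    proof -
      have "ascale DA c (H - amult DA g g) = ascale DA c ((H - amult DA f f) + w)" by (simp add: w_def)
      also have "\<dots> = ascale DA c (H - amult DA f f) + ascale DA c w"
        using w H(1) ZD(1)[OF f] by (intro c_moduleD(6)[OF DA.c_module]) (auto intro: cl)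
      finally show ?thesis by (simp add: F_def d_def)
    qed
    from arg_cong[OF this, of "\<lambda>h. fps_nth h n"]
    have "fps_nth (F f) n - fps_nth (F g) n = 0" using sc by simp
    moreover have "agree n (F f) (F g)"
    proof -
      have "agree n (ascale DA c (H - amult DA f f)) (ascale DA c (H - amult DA g g))"
        by (rule scale_agree) (use mult_agree[OF ag ag] in \<open>auto simp: agree_def\<close>)
      with ag show ?thesis by (simp add: agree_def F_def)
    qed
    ultimately show ?thesis by (simp add: agree_Suc)
  qed
  have closed: "f \<in> Z" if lim: "\<And>n. \<exists>g\<in>Z. agree n g f" for f
  proof -
    have "f \<in> acarrier DA"
      unfolding DA_simps(1) by (rule fps_carrier_closed) (use lim ZD(1) in \<open>auto simp: DA_simps(1)\<close>)
    moreover have "fps_nth f 0 = e" using lim[of 1] ZD(2) by (auto simp: agree_def)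
    moreover have "astar DA f = f"
      by (rule agree_limit_eq) (use lim ZD(3) star_agree in blast)+
    ultimately show ?thesis by (simp add: Z_def)
  qed
  have "H \<in> Z" using H by (simp add: Z_def)
  then obtain U where U: "U \<in> Z" "F U = U"
    by (rule fps_contraction_fixpoint[of H Z F, OF _ FZ contr closed])
  have "H - amult DA U U \<in> acarrier DA" using H(1) ZD(1)[OF U(1)] by (auto intro: cl)
  from half_add[OF this] have "H - amult DA U U = 0" using U(2) by (simp add: F_def)
  then show thesis using that[of U] ZD[OF U(1)] by simp
qed

end

text \<open>The product of \<open>Y\<close>, pulled back to \<open>M[[\<lambda>]]\<close>, is \<open>C[[\<lambda>]]\<close>-bilinear and hence determined by the products of
  constants, which supply the coefficients of the deformation. The last hypothesis says that the
  product is that of \<open>M\<close> in order \<open>\<lambda>\<^sup>0\<close>.\<close>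

lemma transport_hermitian_deformation:
  fixes M :: "('r::linordered_idom, 'm::ab_group_add) star_alg"
    and Y :: "('r fps, 'y::ab_group_add) star_alg"
  assumes M: "star_algebra M" and Y: "star_algebra Y"
    and bij: "bij_betw \<theta> (fps_carrier (acarrier M)) (acarrier Y)"
    and lin: "linear_map (fps_scale (ascale M)) (ascale Y) (fps_carrier (acarrier M)) (acarrier Y) \<theta>"
    and star: "\<And>f. f \<in> fps_carrier (acarrier M) \<Longrightarrow>
      \<theta> (Abs_fps (\<lambda>n. astar M (fps_nth f n))) = astar Y (\<theta> f)"
    and 0: "\<And>f g k. f \<in> fps_carrier (acarrier M) \<Longrightarrow> g \<in> fps_carrier (acarrier M) \<Longrightarrow>
      k \<in> fps_carrier (acarrier M) \<Longrightarrow> \<theta> k = amult Y (\<theta> f) (\<theta> g) \<Longrightarrow>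
      fps_nth k 0 = amult M (fps_nth f 0) (fps_nth g 0)"
  obtains D where "hermitian_deformation M D"
    "\<And>f g. f \<in> fps_carrier (acarrier M) \<Longrightarrow> g \<in> fps_carrier (acarrier M) \<Longrightarrow>
      \<theta> (fps_extend2 D f g) = amult Y (\<theta> f) (\<theta> g)"
proof -
  interpret M: star_alg_on M by unfold_locales (rule M)
  interpret Y: star_alg_on Y by unfold_locales (rule Y)
  let ?X = "fps_carrier (acarrier M)"
  note XX = c_module_fps[OF M.c_module]
  define \<phi> where "\<phi> = inv_into ?X \<theta>"
  define F where "F f g = \<phi> (amult Y (\<theta> f) (\<theta> g))" for f g
  define D where "D r x y = fps_nth (F (fps_const x) (fps_const y)) r" for r x y
  have th: "\<theta> f \<in> acarrier Y" if "f \<in> ?X" for f using bij_betw_apply[OF bij that] .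
  have phi: "\<phi> y \<in> ?X" "\<theta> (\<phi> y) = y" if "y \<in> acarrier Y" for y
    using bij_betw_apply[OF bij_betw_inv_into[OF bij] that] bij_betw_inv_into_right[OF bij that]
    by (auto simp: \<phi>_def)
  have inj: "f = g" if "f \<in> ?X" "g \<in> ?X" "\<theta> f = \<theta> g" for f g
    using bij_betw_imp_inj_on[OF bij] that by (auto dest: inj_onD)
  have FX: "F f g \<in> ?X" "\<theta> (F f g) = amult Y (\<theta> f) (\<theta> g)" if "f \<in> ?X" "g \<in> ?X" for f g
    using phi[OF Y.mult_in[OF th th], OF that] by (auto simp: F_def)
  note lin_phi = linear_map_inverse[OF lin bij XX, folded \<phi>_def]
  have bil: "bilinear_map (fps_scale (ascale M)) (fps_scale (ascale M)) (fps_scale (ascale M)) ?X ?X ?X F"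
    unfolding bilinear_map_def F_def
    using linear_map_compose[OF linear_map_compose[OF lin Y.linear_left] lin_phi]
      linear_map_compose[OF linear_map_compose[OF lin Y.linear_right] lin_phi] th by blast
  note co = bilinear_map_fps_coeffs[OF M.c_module M.c_module M.c_module bil, folded D_def]
  have D: "fps_extend2 D f g = F f g" if "f \<in> ?X" "g \<in> ?X" for f g
    using co(1)[OF that] by simp
  have cX: "fps_const a \<in> ?X" if "a \<in> acarrier M" for a using fps_const_in[OF M.zero_in that] .
  have "hermitian_deformation M D"
    unfolding hermitian_deformation_def formal_deformation_def
  proof (intro conjI ballI allI)
    fix a b assume ab: "a \<in> acarrier M" "b \<in> acarrier M"
    show "D 0 a b = amult M a b"
      unfolding D_def using 0[OF cX cX FX(1)[OF cX cX] FX(2)[OF cX cX], OF ab ab ab] by simp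
  next
    fix r show "bilinear_map (ascale M) (ascale M) (ascale M) (acarrier M) (acarrier M) (acarrier M) (D r)"
      unfolding D_def[abs_def] using co(2)[of r] unfolding D_def[abs_def] .
  next
    fix a b c assume a: "a \<in> ?X" and b: "b \<in> ?X" and c: "c \<in> ?X"
    have "F (F a b) c = F a (F b c)"
      using FX a b c Y.mult_assoc[OF th[OF a] th[OF b] th[OF c]] by (intro inj) auto
    then show "fps_extend2 D (fps_extend2 D a b) c = fps_extend2 D a (fps_extend2 D b c)"
      using D FX(1) a b c by simp
  next
    fix a b assume a: "a \<in> ?X" and b: "b \<in> ?X"
    have sX: "Abs_fps (\<lambda>n. astar M (fps_nth f n)) \<in> ?X" if "f \<in> ?X" for f
      using that by (auto intro!: fps_carrierI simp: M.star_in fps_carrierD)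
    have "Abs_fps (\<lambda>n. astar M (fps_nth (F a b) n)) =
      F (Abs_fps (\<lambda>n. astar M (fps_nth b n))) (Abs_fps (\<lambda>n. astar M (fps_nth a n)))"
      using FX a b sX star Y.star_mult[OF th[OF a] th[OF b]] by (intro inj) auto
    then show "astar (deformed_algebra M D) (fps_extend2 D a b) =
      fps_extend2 D (astar (deformed_algebra M D) b) (astar (deformed_algebra M D) a)"
      using D a b sX by (simp add: deformed_algebra_def)
  qed
  then show thesis using that[of D] D FX(2) by simp
qed

section \<open>Right modules and dual bases\<close>

lemma right_moduleD:
  assumes "right_module A M"
  shows "c_module (mcarrier M) (mscale M)"
    "x \<in> mcarrier M \<Longrightarrow> linear_map (ascale A) (mscale M) (acarrier A) (mcarrier M) (mact M x)"
    "a \<in> acarrier A \<Longrightarrow> linear_map (mscale M) (mscale M) (mcarrier M) (mcarrier M) (\<lambda>x. mact M x a)"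
    "x \<in> mcarrier M \<Longrightarrow> a \<in> acarrier A \<Longrightarrow> mact M x a \<in> mcarrier M"
    "x \<in> mcarrier M \<Longrightarrow> a \<in> acarrier A \<Longrightarrow> b \<in> acarrier A \<Longrightarrow>
      mact M (mact M x a) b = mact M x (amult A a b)"
  using assms by (auto simp: right_module_def bilinear_map_def linear_map_def)

lemma right_mod_hom_compose:
  assumes "right_mod_hom A M N f" "right_mod_hom A N L g"
  shows "right_mod_hom A M L (\<lambda>x. g (f x))"
  using assms linear_map_compose[of "mscale M" "mscale N" "mcarrier M" "mcarrier N" f "mscale L" "mcarrier L" g]
  by (auto simp: right_mod_hom_def linear_mapD(1))

lemma right_mod_hom_inverse:
  assumes M: "right_module A M" and f: "right_mod_hom A M N f" "bij_betw f (mcarrier M) (mcarrier N)"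
  shows "right_mod_hom A N M (inv_into (mcarrier M) f)"
proof -
  have L: "linear_map (mscale M) (mscale N) (mcarrier M) (mcarrier N) f"
    using f(1) by (simp add: right_mod_hom_def)
  have "inv_into (mcarrier M) f (mact N y a) = mact M (inv_into (mcarrier M) f y) a"
    if y: "y \<in> mcarrier N" and a: "a \<in> acarrier A" for y a
  proof -
    let ?x = "inv_into (mcarrier M) f y"
    have x: "?x \<in> mcarrier M" "f ?x = y"
      using bij_betw_apply[OF bij_betw_inv_into[OF f(2)] y] bij_betw_inv_into_right[OF f(2) y] by auto
    have "f (mact M ?x a) = mact N y a" using f(1) x a by (simp add: right_mod_hom_def)
    then show ?thesis
      using bij_betw_inv_into_left[OF f(2) right_moduleD(4)[OF M x(1) a]] by simp
  qed
  then show ?thesis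
    using linear_map_inverse[OF L f(2) right_moduleD(1)[OF M]] by (simp add: right_mod_hom_def)
qed

text \<open>The two lemmas on dual bases, that is, on generators \<open>p\<close> and linear coordinates \<open>a\<close> with \<open>x = \<Sum>\<^sub>j p\<^sub>j a\<^sub>j(x)\<close>. As the
  generators are a family but \<^const>\<open>finitely_generated\<close> asks for a set, coefficients of equal generators
  are added up.\<close>

lemma dual_basis_finitely_generated:
  fixes p :: "'n::finite \<Rightarrow> 'm::ab_group_add" and a :: "'m \<Rightarrow> 'a::ab_group_add^'n"
  assumes A: "star_algebra A" and M: "right_module A M" and p: "\<And>j. p j \<in> mcarrier M"
    and a: "\<And>x j. x \<in> mcarrier M \<Longrightarrow> a x $ j \<in> acarrier A"
    and pa: "\<And>x. x \<in> mcarrier M \<Longrightarrow> x = (\<Sum>j\<in>UNIV. mact M (p j) (a x $ j))"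
  shows "finitely_generated A M"
  unfolding finitely_generated_def
proof (intro exI[of _ "range p"] conjI ballI)
  interpret A: star_alg_on A by unfold_locales (rule A)
  fix x assume x: "x \<in> mcarrier M"
  define c where "c g = (\<Sum>j | p j = g. a x $ j)" for g
  have "x = (\<Sum>j\<in>UNIV. mact M (p j) (a x $ j))" by (rule pa[OF x])
  also have "\<dots> = (\<Sum>g\<in>range p. \<Sum>j | j \<in> UNIV \<and> p j = g. mact M (p j) (a x $ j))"
    by (rule sum.image_gen) simp
  also have "\<dots> = (\<Sum>g\<in>range p. mact M g (c g))"
  proof (rule sum.cong[OF refl])
    fix g assume "g \<in> range p"
    then have "g \<in> mcarrier M" using p by auto
    from linear_map_sum[OF right_moduleD(2)[OF M this] A.c_module, of "{j. p j = g}" "\<lambda>j. a x $ j"]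
    show "(\<Sum>j | j \<in> UNIV \<and> p j = g. mact M (p j) (a x $ j)) = mact M g (c g)"
      using a[OF x] by (simp add: c_def)
  qed
  finally have "x = (\<Sum>g\<in>range p. mact M g (c g))" .
  moreover have "\<forall>g\<in>range p. c g \<in> acarrier A" using a[OF x] by (auto simp: c_def intro: A.sum_in)
  ultimately show "\<exists>c. (\<forall>g\<in>range p. c g \<in> acarrier A) \<and> x = (\<Sum>g\<in>range p. mact M g (c g))" by blast
qed (use p in auto)

text \<open>Lift the images of the generators, and extend by means of the coordinates.\<close>

lemma dual_basis_projective:
  fixes p :: "'n::finite \<Rightarrow> 'm::ab_group_add" and a :: "'m \<Rightarrow> 'a::ab_group_add^'n"
  assumes A: "star_algebra A" and M: "right_module A M" and p: "\<And>j. p j \<in> mcarrier M"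
    and a: "right_mod_hom A M (free_module A) a"
    and pa: "\<And>x. x \<in> mcarrier M \<Longrightarrow> x = (\<Sum>j\<in>UNIV. mact M (p j) (a x $ j))"
  shows "projective_wrt TYPE('k::ab_group_add) TYPE('l::ab_group_add) A M"
  unfolding projective_wrt_def
proof (intro allI impI, elim conjE)
  fix N :: "('b, 'a, 'k) right_mod" and L :: "('b, 'a, 'l) right_mod" and q f
  assume N: "right_module A N" and L: "right_module A L" and q: "right_mod_hom A N L q"
    and surj: "q ` mcarrier N = mcarrier L" and f: "right_mod_hom A M L f"
  interpret A: star_alg_on A by unfold_locales (rule A)
  have lin: "linear_map (mscale M) (mscale (free_module A)) (mcarrier M) (mcarrier (free_module A)) a"
    "linear_map (mscale M) (mscale L) (mcarrier M) (mcarrier L) f"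
    "linear_map (mscale N) (mscale L) (mcarrier N) (mcarrier L) q"
    using a f q by (simp_all add: right_mod_hom_def)
  have aD: "a x $ j \<in> acarrier A" "a (x + y) $ j = a x $ j + a y $ j"
    "a (mscale M c x) $ j = ascale A c (a x $ j)"
    if "x \<in> mcarrier M" "y \<in> mcarrier M" for x y c j
    using lin(1) that by (auto simp: linear_map_def free_module_def)
  have aact: "a (mact M x b) $ j = amult A (a x $ j) b" if "x \<in> mcarrier M" "b \<in> acarrier A" for x b j
    using a that by (simp add: right_mod_hom_def free_module_def)
  have "\<forall>j. \<exists>n. n \<in> mcarrier N \<and> q n = f (p j)"
    using linear_mapD(1)[OF lin(2) p] surj by (metis imageE)
  then obtain n where n: "\<And>j. n j \<in> mcarrier N" "\<And>j. q (n j) = f (p j)" by metis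
  note lN = right_moduleD(2)[OF N n(1)]
  define g where "g x = (\<Sum>j\<in>UNIV. mact N (n j) (a x $ j))" for x
  have t: "mact N (n j) (a x $ j) \<in> mcarrier N" if "x \<in> mcarrier M" for x j
    using right_moduleD(4)[OF N n(1) aD(1)[OF that that]] .
  have "right_mod_hom A M N g"
    unfolding right_mod_hom_def
  proof (intro conjI linear_mapI ballI)
    fix x y c b assume x: "x \<in> mcarrier M"
    show "g x \<in> mcarrier N" unfolding g_def using t[OF x] by (intro c_module_sum_in[OF right_moduleD(1)[OF N]])
    show "g (mscale M c x) = mscale N c (g x)"
      using linear_mapD(3)[OF lN aD(1)[OF x x]] t[OF x]
      by (simp add: g_def aD[OF x x] c_module_scale_sum[OF right_moduleD(1)[OF N]])
    show "g (x + y) = g x + g y" if y: "y \<in> mcarrier M"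
      using linear_mapD(2)[OF lN aD(1)[OF x x] aD(1)[OF y y]] by (simp add: g_def aD[OF x y] sum.distrib)
    show "g (mact M x b) = mact N (g x) b" if b: "b \<in> acarrier A"
      using linear_map_sum[OF right_moduleD(3)[OF N b] right_moduleD(1)[OF N], of UNIV "\<lambda>j. mact N (n j) (a x $ j)"]
        t[OF x] right_moduleD(5)[OF N n(1) aD(1)[OF x x] b]
      by (simp add: g_def aact[OF x b])
  qed
  moreover have "q (g x) = f x" if x: "x \<in> mcarrier M" for x
  proof -
    have "q (g x) = (\<Sum>j\<in>UNIV. q (mact N (n j) (a x $ j)))"
      unfolding g_def using t[OF x] by (intro linear_map_sum[OF lin(3) right_moduleD(1)[OF N]])
    also have "\<dots> = (\<Sum>j\<in>UNIV. f (mact M (p j) (a x $ j)))"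
      using q f n p aD(1)[OF x x] by (simp add: right_mod_hom_def)
    also have "\<dots> = f (\<Sum>j\<in>UNIV. mact M (p j) (a x $ j))"
      using right_moduleD(4)[OF M p aD(1)[OF x x]]
      by (intro linear_map_sum[OF lin(2) right_moduleD(1)[OF M], symmetric])
    finally show ?thesis using pa[OF x] by simp
  qed
  ultimately show "\<exists>g. right_mod_hom A M N g \<and> (\<forall>x\<in>mcarrier M. q (g x) = f x)" by blast
qed

lemma hermitian_inner_product_pullback:
  assumes f: "right_mod_hom A M N f" and h: "hermitian_inner_product A N h" and M: "right_module A M"
    and k: "\<And>x y. x \<in> mcarrier M \<Longrightarrow> y \<in> mcarrier M \<Longrightarrow> k x y = h (f x) (f y)"
  shows "hermitian_inner_product A M k"
proof -
  have lin: "linear_map (mscale M) (mscale N) (mcarrier M) (mcarrier N) f"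
    and act: "\<And>x a. x \<in> mcarrier M \<Longrightarrow> a \<in> acarrier A \<Longrightarrow> f (mact M x a) = mact N (f x) a"
    using f by (auto simp: right_mod_hom_def)
  note fN = linear_mapD(1)[OF lin]
  have hD: "\<And>x. x \<in> mcarrier N \<Longrightarrow> linear_map (mscale N) (ascale A) (mcarrier N) (acarrier A) (h x)"
    "\<And>x y. x \<in> mcarrier N \<Longrightarrow> y \<in> mcarrier N \<Longrightarrow> h x y = astar A (h y x)"
    "\<And>x y a. x \<in> mcarrier N \<Longrightarrow> y \<in> mcarrier N \<Longrightarrow> a \<in> acarrier A \<Longrightarrow> h x (mact N y a) = amult A (h x y) a"
    "\<And>x. x \<in> mcarrier N \<Longrightarrow> h x x \<in> positive_elements A"
    using h unfolding hermitian_inner_product_def by blast+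
  show ?thesis
    unfolding hermitian_inner_product_def
  proof (intro conjI ballI)
    fix x y a assume x: "x \<in> mcarrier M"
    show "linear_map (mscale M) (ascale A) (mcarrier M) (acarrier A) (k x)"
      using linear_map_compose[OF lin hD(1)[OF fN[OF x]]] k[OF x]
        c_moduleD(2,5)[OF right_moduleD(1)[OF M]] by (simp add: linear_map_def)
    show "k x x \<in> positive_elements A" using hD(4)[OF fN[OF x]] k[OF x x] by simp
    assume y: "y \<in> mcarrier M"
    show "k x y = astar A (k y x)" unfolding k[OF x y] k[OF y x] by (rule hD(2)[OF fN[OF x] fN[OF y]])
    show "k x (mact M y a) = amult A (k x y) a" if a: "a \<in> acarrier A"
      using k[OF x right_moduleD(4)[OF M y a]] hD(3)[OF fN[OF x] fN[OF y] a] k[OF x y] act[OF y a] by simp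
  qed
qed

lemma End_iso_transport_module:
  assumes End: "End_iso B A N \<Phi>" and M: "right_module A M" and N: "right_module A N"
    and f: "right_mod_hom A M N f" "bij_betw f (mcarrier M) (mcarrier N)"
    and B: "\<And>b c. b \<in> acarrier B \<Longrightarrow> c \<in> acarrier B \<Longrightarrow> b + c \<in> acarrier B"
  shows "End_iso B A M (\<lambda>b. \<lambda>x\<in>mcarrier M. inv_into (mcarrier M) f (\<Phi> b (f x)))"
proof -
  let ?M = "mcarrier M" and ?N = "mcarrier N"
  define g where "g = inv_into ?M f"
  define \<Psi> where "\<Psi> = (\<lambda>u. \<lambda>x\<in>?M. g (u (f x)))"
  have g: "right_mod_hom A N M g" unfolding g_def by (rule right_mod_hom_inverse[OF M f])
  have fN: "f x \<in> ?N" "g (f x) = x" if "x \<in> ?M" for x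
    using bij_betw_apply[OF f(2) that] bij_betw_inv_into_left[OF f(2) that] by (auto simp: g_def)
  have gM: "g y \<in> ?M" "f (g y) = y" if "y \<in> ?N" for y
    using bij_betw_apply[OF bij_betw_inv_into[OF f(2)] that] bij_betw_inv_into_right[OF f(2) that]
    by (auto simp: g_def)
  have hom_cong: "right_mod_hom A K L v"
    if "right_mod_hom A K L u" "right_module A K" "\<And>x. x \<in> mcarrier K \<Longrightarrow> u x = v x"
    for K :: "('a, 'c, 'z::ab_group_add) right_mod" and L :: "('a, 'c, 'y::ab_group_add) right_mod" and u v
    using that(1) that(3) c_moduleD(2)[OF right_moduleD(1)[OF that(2)]]
      c_moduleD(5)[OF right_moduleD(1)[OF that(2)]] right_moduleD(4)[OF that(2)]
    by (simp add: right_mod_hom_def linear_map_def)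
  have EndN: "right_mod_hom A N N u" "u \<in> extensional ?N" if "u \<in> module_End A N" for u
    using that by (auto simp: module_End_def)
  have \<Phi>: "\<Phi> b \<in> module_End A N" if "b \<in> acarrier B" for b
    using End that by (auto simp: End_iso_def dest: bij_betw_apply)
  have \<Phi>N: "\<Phi> b y \<in> ?N" if "b \<in> acarrier B" "y \<in> ?N" for b y
    using EndN(1)[OF \<Phi>[OF that(1)]] that(2) by (simp add: right_mod_hom_def linear_map_def)
  have \<Psi>: "\<Psi> u \<in> module_End A M" if "u \<in> module_End A N" for u
    using hom_cong[OF right_mod_hom_compose[OF right_mod_hom_compose[OF f(1) EndN(1)[OF that]] g] M]
    by (simp add: module_End_def \<Psi>_def)
  have bij: "bij_betw \<Psi> (module_End A N) (module_End A M)"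
  proof (rule bij_betw_byWitness[where f' = "\<lambda>u. \<lambda>y\<in>?N. f (u (g y))"])
    show "\<forall>u\<in>module_End A N. (\<lambda>y\<in>?N. f (\<Psi> u (g y))) = u"
    proof
      fix u assume u: "u \<in> module_End A N"
      have "u y \<in> ?N" if "y \<in> ?N" for y
        using EndN(1)[OF u] that by (simp add: right_mod_hom_def linear_map_def)
      then show "(\<lambda>y\<in>?N. f (\<Psi> u (g y))) = u"
        using EndN(2)[OF u] gM by (intro extensionalityI[of _ ?N]) (auto simp: \<Psi>_def)
    qed
    show "\<forall>u\<in>module_End A M. \<Psi> (\<lambda>y\<in>?N. f (u (g y))) = u"
    proof
      fix u assume u: "u \<in> module_End A M"
      then have "u x \<in> ?M" if "x \<in> ?M" for x
        using that by (simp add: module_End_def right_mod_hom_def linear_map_def)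
      then show "\<Psi> (\<lambda>y\<in>?N. f (u (g y))) = u"
        using u fN by (intro extensionalityI[of _ ?M]) (auto simp: \<Psi>_def module_End_def)
    qed
    show "\<Psi> ` module_End A N \<subseteq> module_End A M" using \<Psi> by blast
    show "(\<lambda>u. \<lambda>y\<in>?N. f (u (g y))) ` module_End A M \<subseteq> module_End A N"
    proof safe
      fix u assume u: "u \<in> module_End A M"
      then have "right_mod_hom A M M u" by (simp add: module_End_def)
      from hom_cong[OF right_mod_hom_compose[OF right_mod_hom_compose[OF g this] f(1)] N]
      show "(\<lambda>y\<in>?N. f (u (g y))) \<in> module_End A N" by (simp add: module_End_def)
    qed
  qed
  have eq: "(\<lambda>b. \<lambda>x\<in>?M. inv_into ?M f (\<Phi> b (f x))) = \<Psi> \<circ> \<Phi>"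
    by (simp add: \<Psi>_def g_def fun_eq_iff)
  have lin: "linear_map (mscale N) (mscale M) ?N ?M g" using g by (simp add: right_mod_hom_def)
  show ?thesis unfolding eq End_iso_def
  proof (intro conjI ballI allI)
    show "bij_betw (\<Psi> \<circ> \<Phi>) (acarrier B) (module_End A M)"
      using End bij by (auto simp: End_iso_def intro: bij_betw_trans)
    fix b c assume b: "b \<in> acarrier B" and c: "c \<in> acarrier B"
    have "\<Phi> (amult B b c) = compose ?N (\<Phi> b) (\<Phi> c)" using End b c by (simp add: End_iso_def)
    then show "(\<Psi> \<circ> \<Phi>) (amult B b c) = compose ?M ((\<Psi> \<circ> \<Phi>) b) ((\<Psi> \<circ> \<Phi>) c)"
      using fN \<Phi>N[OF c] gM by (auto simp: \<Psi>_def compose_def fun_eq_iff)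
    fix x assume x: "x \<in> ?M"
    have "\<Phi> (b + c) (f x) = \<Phi> b (f x) + \<Phi> c (f x)" using End b c fN[OF x] by (simp add: End_iso_def)
    then show "(\<Psi> \<circ> \<Phi>) (b + c) x = (\<Psi> \<circ> \<Phi>) b x + (\<Psi> \<circ> \<Phi>) c x"
      using x fN[OF x] \<Phi>N b c linear_mapD(2)[OF lin] by (simp add: \<Psi>_def)
  next
    fix z b x assume b: "b \<in> acarrier B" and x: "x \<in> ?M"
    have "\<Phi> (ascale B z b) (f x) = mscale N z (\<Phi> b (f x))" using End b fN[OF x] by (simp add: End_iso_def)
    then show "(\<Psi> \<circ> \<Phi>) (ascale B z b) x = mscale M z ((\<Psi> \<circ> \<Phi>) b x)"
      using x fN[OF x] \<Phi>N b linear_mapD(3)[OF lin] by (simp add: \<Psi>_def)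
  qed
qed

section \<open>Matrices and projection modules over a star algebra\<close>

definition vec_scale :: "('c \<Rightarrow> 'x \<Rightarrow> 'x) \<Rightarrow> 'c \<Rightarrow> 'x^'n \<Rightarrow> 'x^'n" where
  "vec_scale s c x = (\<chi> i. s c (x $ i))"

lemma c_module_vec:
  fixes X :: "'x::ab_group_add set"
  assumes "c_module X s"
  shows "c_module {x::'x^'n. \<forall>i. x $ i \<in> X} (vec_scale s)"
  using c_moduleD[OF assms] unfolding c_module_def vec_scale_def by (simp add: vec_eq_iff)

lemma column_mat_mult: "column j (mat_mult A M N) = mat_vec A M (column j N)"
  by (simp add: column_def mat_mult_def mat_vec_def vec_eq_iff)

lemma column_eqI: "(\<And>j. column j M = column j N) \<Longrightarrow> M = N"
  by (simp add: column_def vec_eq_iff)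

lemma column_nth: "column j M $ i = M $ i $ j"
  by (simp add: column_def)

lemma mat_vec_nth: "mat_vec A M x $ i = (\<Sum>k\<in>UNIV. amult A (M $ i $ k) (x $ k))"
  by (simp add: mat_vec_def)

lemma mat_mult_nth: "mat_mult A M N $ i $ j = (\<Sum>k\<in>UNIV. amult A (M $ i $ k) (N $ k $ j))"
  by (simp add: mat_mult_def)

context star_alg_on
begin

abbreviation vecs :: "('a^'n::finite) set" where "vecs \<equiv> {x. \<forall>i. x $ i \<in> acarrier A}"
abbreviation mats :: "('a^'n::finite^'n) set" where "mats \<equiv> {M. \<forall>i j. M $ i $ j \<in> acarrier A}"

lemma free_module_simps:
  "mcarrier (free_module A) = vecs" "mscale (free_module A) = vec_scale (ascale A)"
  "mact (free_module A) x a = (\<chi> i. amult A (x $ i) a)"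
  by (simp_all add: free_module_def vec_scale_def fun_eq_iff)

lemma matrix_algebra_simps:
  "acarrier (matrix_algebra A) = mats" "amult (matrix_algebra A) = mat_mult A"
  "ascale (matrix_algebra A) = vec_scale (vec_scale (ascale A))"
  "astar (matrix_algebra A) M = (\<chi> i j. astar A (M $ j $ i))"
  by (simp_all add: matrix_algebra_def vec_scale_def fun_eq_iff)

lemma c_module_vecs: "c_module (vecs :: ('a^'n) set) (vec_scale (ascale A))"
  by (rule c_module_vec[OF c_module])

lemma c_module_mats: "c_module (mats :: ('a^'n^'n) set) (vec_scale (vec_scale (ascale A)))"
  using c_module_vec[OF c_module_vecs] by simp

lemma mat_vec_in: "M \<in> mats \<Longrightarrow> x \<in> vecs \<Longrightarrow> mat_vec A M x \<in> vecs"
  by (auto simp: mat_vec_nth intro!: sum_in mult_in)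

lemma mat_mult_in: "M \<in> mats \<Longrightarrow> N \<in> mats \<Longrightarrow> mat_mult A M N \<in> mats"
  by (auto simp: mat_mult_nth intro!: sum_in mult_in)

lemma bilinear_mat_vec:
  "bilinear_map (vec_scale (vec_scale (ascale A))) (vec_scale (ascale A)) (vec_scale (ascale A))
    (mats :: ('a^'n^'n) set) vecs vecs (mat_vec A)"
  unfolding bilinear_map_def linear_map_def
  by (auto simp: vec_eq_iff mat_vec_nth mult_add sum.distrib vec_scale_def mult_scale
      c_module_scale_sum[OF c_module] mult_in intro!: sum_in)

lemma bilinear_mat_mult:
  "bilinear_map (vec_scale (vec_scale (ascale A))) (vec_scale (vec_scale (ascale A)))
    (vec_scale (vec_scale (ascale A))) (mats :: ('a^'n^'n) set) mats mats (mat_mult A)"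
  unfolding bilinear_map_def linear_map_def
  by (auto simp: vec_eq_iff mat_mult_nth mult_add sum.distrib vec_scale_def mult_scale
      c_module_scale_sum[OF c_module] mult_in intro!: sum_in)

lemma mat_vec_linear: "M \<in> mats \<Longrightarrow>
    linear_map (vec_scale (ascale A)) (vec_scale (ascale A)) vecs vecs (mat_vec A M)"
  using bilinear_mat_vec unfolding bilinear_map_def by blast

lemma mat_vec_assoc:
  assumes "M \<in> mats" "N \<in> mats" "x \<in> vecs"
  shows "mat_vec A (mat_mult A M N) x = mat_vec A M (mat_vec A N x)"
proof -
  have "(\<Sum>k\<in>UNIV. amult A (\<Sum>j\<in>UNIV. amult A (M$i$j) (N$j$k)) (x$k)) =
      (\<Sum>j\<in>UNIV. amult A (M$i$j) (\<Sum>k\<in>UNIV. amult A (N$j$k) (x$k)))" for i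
    using assms by (simp add: mult_sum mult_in mult_assoc) (rule sum.swap)
  then show ?thesis by (simp add: vec_eq_iff mat_vec_nth mat_mult_nth)
qed

lemma mat_mult_assoc:
  "M \<in> mats \<Longrightarrow> N \<in> mats \<Longrightarrow> K \<in> mats \<Longrightarrow> mat_mult A (mat_mult A M N) K = mat_mult A M (mat_mult A N K)"
  by (rule column_eqI) (simp add: column_mat_mult mat_vec_assoc column_nth)

lemma mat_vec_act:
  "M \<in> mats \<Longrightarrow> x \<in> vecs \<Longrightarrow> a \<in> acarrier A \<Longrightarrow>
    mat_vec A M (\<chi> i. amult A (x $ i) a) = (\<chi> i. amult A (mat_vec A M x $ i) a)"
  by (simp add: vec_eq_iff mat_vec_nth mult_sum mult_in mult_assoc)

lemma mat_vec_columns: "mat_vec A M x = (\<Sum>j\<in>UNIV. \<chi> i. amult A (column j M $ i) (x $ j))"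
  by (simp add: vec_eq_iff mat_vec_nth column_nth)

lemma star_algebra_matrix: "star_algebra (matrix_algebra A :: ('r, 'a^'n^'n) star_alg)"
proof -
  have "linear_map (vec_scale (vec_scale (ascale A))) (\<lambda>c. vec_scale (vec_scale (ascale A)) (cconj c))
      (mats :: ('a^'n^'n) set) mats (\<lambda>M. \<chi> i j. astar A (M $ j $ i))"
    unfolding linear_map_def by (auto simp: vec_eq_iff vec_scale_def star_in star_add star_scale)
  moreover have "(\<chi> i j. astar A (mat_mult A M N $ j $ i)) =
      mat_mult A (\<chi> i j. astar A (N $ j $ i)) (\<chi> i j. astar A (M $ j $ i))"
    if "M \<in> mats" "N \<in> mats" for M N :: "'a^'n^'n"
    using that by (simp add: vec_eq_iff mat_mult_nth star_sum star_mult mult_in)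
  ultimately show ?thesis
    using c_module_mats bilinear_mat_mult
    unfolding star_algebra_def matrix_algebra_simps
    by (auto simp: mat_mult_assoc star_star vec_eq_iff)
qed

end

locale projection = star_alg_on A
  for A :: "('r::linordered_idom, 'a::ab_group_add) star_alg" +
  fixes P :: "'a^'n::finite^'n"
  assumes P_in: "P \<in> mats" and P_idem: "mat_mult A P P = P" and P_star: "(\<chi> i j. astar A (P $ j $ i)) = P"
begin

abbreviation "E \<equiv> projection_module A P"
abbreviation "B \<equiv> corner_algebra A P"

lemma E_simps: "mcarrier E = {x \<in> vecs. mat_vec A P x = x}" "mscale E = vec_scale (ascale A)"
  "mact E x a = (\<chi> i. amult A (x $ i) a)"
proof -
  show "mcarrier E = {x \<in> vecs. mat_vec A P x = x}"
    using mat_vec_assoc[OF P_in P_in] P_idem mat_vec_in[OF P_in]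
    unfolding projection_module_def by (auto simp: free_module_simps image_iff) metis
qed (simp_all add: projection_module_def free_module_def vec_scale_def fun_eq_iff)

lemma E_image: "mcarrier E = mat_vec A P ` vecs"
  by (simp add: projection_module_def free_module_simps)

lemma B_image: "acarrier B = (\<lambda>M. mat_mult A P (mat_mult A M P)) ` mats"
  by (simp add: corner_algebra_def matrix_algebra_simps)

lemma B_simps: "acarrier B = {M \<in> mats. mat_mult A P M = M \<and> mat_mult A M P = M}"
  "amult B = mat_mult A" "ascale B = vec_scale (vec_scale (ascale A))"
  "astar B M = (\<chi> i j. astar A (M $ j $ i))"
proof -
  have "mat_mult A P (mat_mult A M P) \<in> {M \<in> mats. mat_mult A P M = M \<and> mat_mult A M P = M}" if M: "M \<in> mats" for M
    using mat_mult_assoc[OF P_in P_in mat_mult_in[OF M P_in]] mat_mult_assoc[OF P_in mat_mult_in[OF M P_in] P_in]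
      mat_mult_assoc[OF M P_in P_in] mat_mult_in[OF P_in mat_mult_in[OF M P_in]] P_idem by simp
  moreover have "M \<in> (\<lambda>M. mat_mult A P (mat_mult A M P)) ` mats"
    if "M \<in> {M \<in> mats. mat_mult A P M = M \<and> mat_mult A M P = M}" for M
    using that by (intro image_eqI[of _ _ M]) auto
  ultimately show "acarrier B = {M \<in> mats. mat_mult A P M = M \<and> mat_mult A M P = M}"
    unfolding B_image by blast
qed (simp_all add: corner_algebra_def matrix_algebra_def vec_scale_def fun_eq_iff)

lemma c_module_E: "c_module (mcarrier E) (vec_scale (ascale A))"
  using c_moduleD[OF c_module_vecs[where 'n = 'n]] linear_mapD[OF mat_vec_linear[OF P_in]]
    linear_map_zero[OF mat_vec_linear[OF P_in] c_module_vecs]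
    linear_map_diff[OF mat_vec_linear[OF P_in] c_module_vecs c_moduleD(1)[OF c_module_vecs]]
  unfolding c_module_def E_simps(1) by simp

lemma column_P_in: "column j P \<in> mcarrier E"
  using P_in column_mat_mult[of j A P P] P_idem by (auto simp: E_simps column_nth)

lemma act_in: "x \<in> mcarrier E \<Longrightarrow> a \<in> acarrier A \<Longrightarrow> (\<chi> i. amult A (x $ i) a) \<in> mcarrier E"
  using mat_vec_act[OF P_in] by (auto simp: E_simps intro: mult_in)

lemma E_expansion: "x \<in> mcarrier E \<Longrightarrow> x = (\<Sum>j\<in>UNIV. mact E (column j P) (x $ j))"
  using mat_vec_columns[of P x] by (simp add: E_simps)

lemma right_module_E: "right_module A E"
proof -
  have "bilinear_map (vec_scale (ascale A)) (ascale A) (vec_scale (ascale A)) (mcarrier E) (acarrier A)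
      (mcarrier E) (mact E)"
    unfolding bilinear_map_def linear_map_def
    using act_in by (auto simp: E_simps vec_eq_iff mult_add mult_scale vec_scale_def)
  then show ?thesis
    using c_module_E unfolding right_module_def E_simps(2)
    by (auto simp: E_simps vec_eq_iff mult_assoc is_one_def)
qed

lemma mat_vec_B_in: "M \<in> acarrier B \<Longrightarrow> x \<in> mcarrier E \<Longrightarrow> mat_vec A M x \<in> mcarrier E"
  using mat_vec_assoc[OF P_in, of M x] mat_vec_in[of M x] by (auto simp: E_simps B_simps)

lemma star_algebra_B: "star_algebra B"
proof -
  interpret M: star_alg_on "matrix_algebra A :: ('r, 'a^'n^'n) star_alg"
    by unfold_locales (rule star_algebra_matrix)
  note m = matrix_algebra_simps
  have Bm: "acarrier B = {M \<in> acarrier (matrix_algebra A). amult (matrix_algebra A) P M = M \<and> amult (matrix_algebra A) M P = M}"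
    "amult B = amult (matrix_algebra A)" "ascale B = ascale (matrix_algebra A)" "astar B = astar (matrix_algebra A)"
    by (simp_all add: B_simps m fun_eq_iff)
  have P: "P \<in> acarrier (matrix_algebra A)" "astar (matrix_algebra A) P = P"
    using P_in P_star by (simp_all add: m)
  have "amult (matrix_algebra A) P (astar (matrix_algebra A) M) = astar (matrix_algebra A) M"
    "amult (matrix_algebra A) (astar (matrix_algebra A) M) P = astar (matrix_algebra A) M"
    if "M \<in> acarrier B" for M
    using that M.star_mult[of M P] M.star_mult[of P M] P by (auto simp: Bm)
  then have "linear_map (ascale B) (\<lambda>c. ascale B (cconj c)) (acarrier B) (acarrier B) (astar B)"
    unfolding linear_map_def Bm by (auto simp: M.star_in M.star_add M.star_scale)
  moreover have "c_module (acarrier B) (ascale B)"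
    using c_moduleD(1-3,5-)[OF M.c_module] M.mult_zero[OF P(1)] P(1) M.mult_diff(1)[OF P(1) M.zero_in]
      M.mult_diff(2)[OF M.zero_in _ P(1)]
    unfolding c_module_def Bm by (auto simp: M.mult_add M.mult_scale)
  moreover have "amult (matrix_algebra A) P (amult (matrix_algebra A) M N) = amult (matrix_algebra A) M N"
    if "M \<in> acarrier B" "N \<in> acarrier B" for M N
    using that M.mult_assoc[of P M N] P(1) by (simp add: Bm)
  then have "bilinear_map (ascale B) (ascale B) (ascale B) (acarrier B) (acarrier B) (acarrier B) (amult B)"
    unfolding bilinear_map_def linear_map_def Bm using P(1)
    by (auto simp: M.mult_in M.mult_add M.mult_scale M.mult_assoc)
  ultimately show ?thesis
    unfolding star_algebra_def by (auto simp: Bm M.mult_assoc M.star_star M.star_mult)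
qed

lemma is_one_B: "is_one B P"
  using P_in P_idem by (auto simp: is_one_def B_simps)

lemma compress_linear:
  "linear_map (vec_scale (vec_scale (ascale A))) (vec_scale (vec_scale (ascale A))) mats mats
    (\<lambda>M. mat_mult A P (mat_mult A M P))"
proof -
  note b = bilinear_mat_mult[where 'n = 'n, unfolded bilinear_map_def]
  show ?thesis
    by (rule linear_map_compose[OF bspec[OF conjunct2[OF b] P_in] bspec[OF conjunct1[OF b] P_in]])
qed

lemma compress_idem:
  assumes "M \<in> mats"
  shows "mat_mult A P (mat_mult A (mat_mult A P (mat_mult A M P)) P) = mat_mult A P (mat_mult A M P)"
proof -
  have "mat_mult A P (mat_mult A M P) \<in> acarrier B" unfolding B_image using assms by blast
  then show ?thesis by (simp add: B_simps(1))
qed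

lemma c_module_B: "c_module (acarrier B) (vec_scale (vec_scale (ascale A)))"
  using star_algebra_B by (simp add: star_algebra_def B_simps(3))

text \<open>An element \<open>M = M P\<close> is recovered from its action on the columns of \<open>P\<close>, which lie in \<open>P A\<^sup>n\<close>.\<close>

lemma B_faithful:
  assumes "M \<in> acarrier B" "N \<in> acarrier B" "\<And>x. x \<in> mcarrier E \<Longrightarrow> mat_vec A M x = mat_vec A N x"
  shows "M = N"
proof -
  have "mat_mult A M P = mat_mult A N P"
    by (rule column_eqI) (simp add: column_mat_mult assms(3)[OF column_P_in])
  then show ?thesis using assms(1,2) by (simp add: B_simps(1))
qed

subsection \<open>Inner products\<close>

lemma canonical_sesquilinear:
  "bilinear_map (\<lambda>c. vec_scale (ascale A) (cconj c)) (vec_scale (ascale A)) (ascale A)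
    vecs vecs (acarrier A) (canonical_inner_product A :: 'a^'n \<Rightarrow> 'a^'n \<Rightarrow> 'a)"
proof -
  have "cconj (cconj c) = c" for c :: "'r cext" by (simp add: cconj_def)
  then show ?thesis
    unfolding bilinear_map_def linear_map_def canonical_inner_product_def
    by (auto simp: vec_scale_def star_in mult_in mult_add mult_scale star_add star_scale scale_in
        sum.distrib c_module_scale_sum[OF c_module] intro!: sum_in)
qed

lemma hermitian_canonical: "hermitian_inner_product A E (canonical_inner_product A)"
  unfolding hermitian_inner_product_def
proof (intro conjI ballI)
  fix x y a assume x: "x \<in> mcarrier E"
  then have x': "x $ i \<in> acarrier A" for i by (simp add: E_simps)
  show "linear_map (mscale E) (ascale A) (mcarrier E) (acarrier A) (canonical_inner_product A x)"
    using canonical_sesquilinear x by (auto simp: bilinear_map_def linear_map_def E_simps)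
  show "canonical_inner_product A x x \<in> positive_elements A"
    unfolding canonical_inner_product_def by (rule star_mult_self_positive) (rule x')
  assume y: "y \<in> mcarrier E"
  then have y': "y $ i \<in> acarrier A" for i by (simp add: E_simps)
  show "canonical_inner_product A x y = astar A (canonical_inner_product A y x)"
    using x' y' by (simp add: canonical_inner_product_def star_sum mult_in star_in star_mult star_star)
  show "canonical_inner_product A x (mact E y a) = amult A (canonical_inner_product A x y) a"
    if "a \<in> acarrier A"
    using x' y' that by (simp add: canonical_inner_product_def E_simps mult_sum mult_in star_in mult_assoc)
qed

lemma canonical_adjoint:
  assumes "M \<in> mats" "x \<in> vecs" "y \<in> vecs"
  shows "canonical_inner_product A (mat_vec A M x) y =
    canonical_inner_product A x (mat_vec A (\<chi> i j. astar A (M $ j $ i)) y)"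
  unfolding canonical_inner_product_def mat_vec_nth using assms
  by (simp add: star_sum mult_in star_mult mult_sum star_in mult_assoc) (rule sum.swap)

text \<open>Expand both arguments in the columns of \<open>P\<close>. That \<open>P H = H = H P\<close> is this expansion applied to the columns
  themselves.\<close>

lemma gram_matrix:
  fixes h :: "'a^'n \<Rightarrow> 'a^'n \<Rightarrow> 'a"
  assumes h: "hermitian_inner_product A E h"
  defines "H \<equiv> \<chi> i j. h (column i P) (column j P)"
  shows "H \<in> acarrier B" "astar B H = H"
    "\<And>x y. x \<in> mcarrier E \<Longrightarrow> y \<in> mcarrier E \<Longrightarrow> h x y = canonical_inner_product A x (mat_vec A H y)"
proof -
  have L: "linear_map (mscale E) (ascale A) (mcarrier E) (acarrier A) (h x)" if "x \<in> mcarrier E" for x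
    using h that by (simp add: hermitian_inner_product_def)
  have hs: "h x y = astar A (h y x)" and ha: "a \<in> acarrier A \<Longrightarrow> h x (mact E y a) = amult A (h x y) a"
    if "x \<in> mcarrier E" "y \<in> mcarrier E" for x y a
    using h that unfolding hermitian_inner_product_def by blast+
  have hin: "h x y \<in> acarrier A" if "x \<in> mcarrier E" "y \<in> mcarrier E" for x y
    using linear_mapD(1)[OF L[OF that(1)] that(2)] .
  have vin: "x $ i \<in> acarrier A" if "x \<in> mcarrier E" for x i using that by (simp add: E_simps)
  note c = column_P_in
  have right: "h x y = (\<Sum>j\<in>UNIV. amult A (h x (column j P)) (y $ j))" if x: "x \<in> mcarrier E" and y: "y \<in> mcarrier E" for x y
  proof -
    have "h x y = h x (\<Sum>j\<in>UNIV. mact E (column j P) (y $ j))" using E_expansion[OF y] by simp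
    also have "\<dots> = (\<Sum>j\<in>UNIV. h x (mact E (column j P) (y $ j)))"
      using right_moduleD(4)[OF right_module_E c vin[OF y]]
      by (intro linear_map_sum[OF L[OF x] c_module_E[folded E_simps(2)]])
    also have "\<dots> = (\<Sum>j\<in>UNIV. amult A (h x (column j P)) (y $ j))" using ha[OF x c vin[OF y]] by simp
    finally show ?thesis .
  qed
  have left: "h x y = (\<Sum>i\<in>UNIV. amult A (astar A (x $ i)) (h (column i P) y))"
    if x: "x \<in> mcarrier E" and y: "y \<in> mcarrier E" for x y
  proof -
    have "h x y = (\<Sum>i\<in>UNIV. astar A (amult A (h y (column i P)) (x $ i)))"
      unfolding hs[OF x y] right[OF y x] using hin[OF y c] vin[OF x] by (simp add: star_sum mult_in)
    also have "\<dots> = (\<Sum>i\<in>UNIV. amult A (astar A (x $ i)) (h (column i P) y))"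
      using hin[OF y c] vin[OF x] by (simp add: star_mult hs[OF c y, symmetric])
    finally show ?thesis .
  qed
  have P_star_nth: "astar A (P $ k $ i) = P $ i $ k" for i k
    using arg_cong[OF P_star, of "\<lambda>M. M $ i $ k"] by simp
  have "(\<Sum>k\<in>UNIV. amult A (P $ i $ k) (h (column k P) (column j P))) = h (column i P) (column j P)" for i j
    using left[OF c[of i] c[of j]] by (simp add: column_nth P_star_nth)
  then have "mat_mult A P H = H" by (simp add: vec_eq_iff mat_mult_nth H_def)
  moreover have "(\<Sum>k\<in>UNIV. amult A (h (column i P) (column k P)) (P $ k $ j)) = h (column i P) (column j P)" for i j
    using right[OF c[of i] c[of j]] by (simp add: column_nth)
  then have "mat_mult A H P = H" by (simp add: vec_eq_iff mat_mult_nth H_def)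
  ultimately show "H \<in> acarrier B" using hin[OF c c] by (simp add: B_simps H_def)
  show "astar B H = H" by (simp add: B_simps H_def vec_eq_iff hs[OF c c, symmetric])
  show "h x y = canonical_inner_product A x (mat_vec A H y)"
    if x: "x \<in> mcarrier E" and y: "y \<in> mcarrier E" for x y
    unfolding left[OF x y] canonical_inner_product_def mat_vec_nth
    by (intro sum.cong refl arg_cong2[where f = "amult A"]) (simp add: right[OF c y] H_def)
qed

end

section \<open>Vectors and matrices of power series\<close>

definition vec_swap :: "('x^'n) fps \<Rightarrow> 'x fps^'n" where
  "vec_swap f = (\<chi> i. Abs_fps (\<lambda>n. fps_nth f n $ i))"

definition mat_swap :: "('x^'n^'m) fps \<Rightarrow> 'x fps^'n^'m" where
  "mat_swap f = (\<chi> i j. Abs_fps (\<lambda>n. fps_nth f n $ i $ j))"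

definition vec_head :: "'x fps^'n \<Rightarrow> 'x^'n" where
  "vec_head x = (\<chi> i. fps_nth (x $ i) 0)"

definition mat_head :: "'x fps^'n^'m \<Rightarrow> 'x^'n^'m" where
  "mat_head M = (\<chi> i j. fps_nth (M $ i $ j) 0)"

lemma vec_swap_nth: "fps_nth (vec_swap f $ i) n = fps_nth f n $ i"
  by (simp add: vec_swap_def)

lemma mat_swap_nth: "fps_nth (mat_swap f $ i $ j) n = fps_nth f n $ i $ j"
  by (simp add: mat_swap_def)

lemma head_swap: "vec_head (vec_swap f) = fps_nth f 0" "mat_head (mat_swap g) = fps_nth g 0"
  by (simp_all add: vec_eq_iff vec_head_def mat_head_def vec_swap_nth mat_swap_nth)

lemma vec_swap_bij:
  "bij_betw vec_swap (fps_carrier {x. \<forall>i. x $ i \<in> X}) {x. \<forall>i. x $ i \<in> fps_carrier X}"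
proof (rule bij_betw_byWitness[where f' = "\<lambda>y. Abs_fps (\<lambda>n. \<chi> i. fps_nth (y $ i) n)"])
qed (auto simp: fps_carrier_def vec_swap_nth vec_eq_iff fps_eq_iff)

lemma mat_swap_bij:
  "bij_betw mat_swap (fps_carrier {x. \<forall>i j. x $ i $ j \<in> X}) {x. \<forall>i j. x $ i $ j \<in> fps_carrier X}"
proof (rule bij_betw_byWitness[where f' = "\<lambda>y. Abs_fps (\<lambda>n. \<chi> i j. fps_nth (y $ i $ j) n)"])
qed (auto simp: fps_carrier_def mat_swap_nth vec_eq_iff fps_eq_iff)

lemma vec_swap_linear:
  fixes s :: "'r cext \<Rightarrow> 'x::ab_group_add \<Rightarrow> 'x"
  shows "linear_map (fps_scale (vec_scale s)) (vec_scale (fps_scale s))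
    (fps_carrier {x::'x^'n. \<forall>i. x $ i \<in> X}) {x. \<forall>i. x $ i \<in> fps_carrier X} vec_swap"
  unfolding linear_map_def
  by (auto simp: vec_eq_iff fps_eq_iff vec_swap_nth vec_scale_def fps_scale_nth fps_carrier_def)

lemma mat_swap_linear:
  fixes s :: "'r cext \<Rightarrow> 'x::ab_group_add \<Rightarrow> 'x"
  shows "linear_map (fps_scale (vec_scale (vec_scale s))) (vec_scale (vec_scale (fps_scale s)))
    (fps_carrier {x::'x^'n^'m. \<forall>i j. x $ i $ j \<in> X}) {x. \<forall>i j. x $ i $ j \<in> fps_carrier X} mat_swap"
  unfolding linear_map_def
  by (auto simp: vec_eq_iff fps_eq_iff mat_swap_nth vec_scale_def fps_scale_nth fps_carrier_def)

context hermitian_deform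
begin

lemma mat_swap_star:
  "mat_swap (Abs_fps (\<lambda>n. \<chi> i j. astar A (fps_nth f n $ j $ i))) = (\<chi> i j. astar DA (mat_swap f $ j $ i))"
  by (simp add: vec_eq_iff fps_eq_iff mat_swap_nth DA_simps)

lemma vec_head_mat_vec:
  "M \<in> DA.mats \<Longrightarrow> x \<in> DA.vecs \<Longrightarrow> vec_head (mat_vec DA M x) = mat_vec A (mat_head M) (vec_head x)"
  by (simp add: vec_eq_iff vec_head_def mat_head_def mat_vec_nth fps_sum_nth mult_nth_0)

lemma mat_head_mat_mult:
  "M \<in> DA.mats \<Longrightarrow> N \<in> DA.mats \<Longrightarrow> mat_head (mat_mult DA M N) = mat_mult A (mat_head M) (mat_head N)"
  by (simp add: vec_eq_iff mat_head_def mat_mult_nth fps_sum_nth mult_nth_0)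

lemma vec_head_in: "x \<in> DA.vecs \<Longrightarrow> vec_head x \<in> vecs"
  by (simp add: vec_head_def nth_in)

text \<open>Read entrywise, \<open>M\<^sub>n(A)[[\<lambda>]]\<close> is the algebra of matrices over the deformed algebra. This is a Hermitian
  deformation of \<open>M\<^sub>n(A)\<close>, in which projections can be lifted.\<close>

lemma lift_matrix_projection:
  fixes P\<^sub>0 :: "'a^'n^'n"
  assumes "projection A P\<^sub>0"
  obtains P where "projection DA P" "mat_head P = P\<^sub>0"
proof -
  interpret p: projection A P\<^sub>0 by (rule assms)
  let ?M = "matrix_algebra A :: ('r, 'a^'n^'n) star_alg" and ?Y = "matrix_algebra DA :: ('r fps, 'a fps^'n^'n) star_alg"
  note m = matrix_algebra_simps and dm = DA.matrix_algebra_simps[unfolded DA_simps(1,3)]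
  have mul0: "fps_nth k 0 = amult ?M (fps_nth f 0) (fps_nth g 0)"
    if f: "f \<in> fps_carrier (acarrier ?M)" and g: "g \<in> fps_carrier (acarrier ?M)"
      and k: "mat_swap k = amult ?Y (mat_swap f) (mat_swap g)" for f g k
  proof -
    have "mat_swap f \<in> DA.mats" "mat_swap g \<in> DA.mats"
      using bij_betw_apply[OF mat_swap_bij] f g by (auto simp: m DA_simps(1))
    then have "mat_head (amult ?Y (mat_swap f) (mat_swap g)) = amult ?M (fps_nth f 0) (fps_nth g 0)"
      by (simp add: mat_head_mat_mult head_swap m dm)
    then show ?thesis using k head_swap(2)[of k] by simp
  qed
  have st: "mat_swap (Abs_fps (\<lambda>n. astar ?M (fps_nth f n))) = astar ?Y (mat_swap f)" for f
    by (simp only: m dm mat_swap_star)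
  have bij: "bij_betw mat_swap (fps_carrier (acarrier ?M)) (acarrier ?Y)"
    unfolding m dm by (rule mat_swap_bij)
  have lin: "linear_map (fps_scale (ascale ?M)) (ascale ?Y) (fps_carrier (acarrier ?M)) (acarrier ?Y) mat_swap"
    unfolding m dm by (rule mat_swap_linear)
  obtain D where D: "hermitian_deformation ?M D"
    "\<And>f g. f \<in> fps_carrier (acarrier ?M) \<Longrightarrow> g \<in> fps_carrier (acarrier ?M) \<Longrightarrow>
      mat_swap (fps_extend2 D f g) = amult ?Y (mat_swap f) (mat_swap g)"
    by (rule transport_hermitian_deformation[OF star_algebra_matrix DA.star_algebra_matrix bij lin st mul0]) (assumption+, rule that, simp_all)
  interpret M: hermitian_deform ?M D
    by unfold_locales (rule star_algebra_matrix, rule D(1))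
  have "P\<^sub>0 \<in> acarrier ?M" "amult ?M P\<^sub>0 P\<^sub>0 = P\<^sub>0" "astar ?M P\<^sub>0 = P\<^sub>0"
    using p.P_in p.P_idem p.P_star by (simp_all add: m)
  then obtain Q where Q: "Q \<in> acarrier M.DA" "amult M.DA Q Q = Q" "astar M.DA Q = Q" "fps_nth Q 0 = P\<^sub>0"
    by (rule M.lift_projection)
  have Qc: "Q \<in> fps_carrier (acarrier ?M)" using Q(1) by (simp add: M.DA_simps(1))
  have "projection DA (mat_swap Q)"
  proof unfold_locales
    show "mat_swap Q \<in> DA.mats"
      using bij_betw_apply[OF bij Qc] by (simp add: DA.matrix_algebra_simps(1))
    show "mat_mult DA (mat_swap Q) (mat_swap Q) = mat_swap Q"
      using D(2)[OF Qc Qc] Q(2) by (simp add: M.DA_simps(2) DA.matrix_algebra_simps(2))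
    have "Abs_fps (\<lambda>n. astar ?M (fps_nth Q n)) = Q"
      using Q(3) by (simp add: fps_eq_iff) (metis M.DA_simps(4))
    then show "(\<chi> i j. astar DA (mat_swap Q $ j $ i)) = mat_swap Q"
      using st[of Q] by (simp add: DA.matrix_algebra_simps(4))
  qed
  then show thesis using that[of "mat_swap Q"] Q(4) by (simp add: head_swap)
qed

end

section \<open>The deformed projection module\<close>

locale deformed_projection = hermitian_deform A C + projection A P\<^sub>0
  for A :: "('r::linordered_idom, 'a::ab_group_add) star_alg" and C and P\<^sub>0 :: "'a^'n::finite^'n" +
  fixes P :: "'a fps^'n^'n"
  assumes P: "projection DA P" and P_head: "mat_head P = P\<^sub>0"
begin

sublocale DP: projection DA P by (rule P)

abbreviation "EE \<equiv> fps_carrier (mcarrier E)"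
abbreviation "BB \<equiv> fps_carrier (acarrier B)"

lemma vec_swap_in: "f \<in> EE \<Longrightarrow> vec_swap f \<in> DA.vecs"
  by (auto simp: DA_simps(1) E_simps(1) vec_swap_nth fps_carrier_def)

lemma mat_swap_in: "f \<in> BB \<Longrightarrow> mat_swap f \<in> DA.mats"
  by (auto simp: DA_simps(1) B_simps(1) mat_swap_nth fps_carrier_def)

lemma vec_head_E: "y \<in> mcarrier DP.E \<Longrightarrow> vec_head y \<in> mcarrier E"
  using vec_head_mat_vec[OF DP.P_in, of y] vec_head_in[of y] by (simp add: E_simps(1) DP.E_simps(1) P_head)

text \<open>The identification of \<open>E[[\<lambda>]]\<close> with \<open>P \<star> A[[\<lambda>]]\<^sup>n\<close>. It is bijective since \<open>x \<mapsto> P \<star> x\<close> deforms the idempotent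
  \<open>x \<mapsto> P\<^sub>0 x\<close> with range \<open>E\<close>.\<close>

definition lift_module :: "('a^'n) fps \<Rightarrow> 'a fps^'n" where
  "lift_module f = mat_vec DA P (vec_swap f)"

lemma vec_swap_lin:
  "linear_map (fps_scale (vec_scale (ascale A))) (vec_scale (ascale DA)) (fps_carrier vecs) DA.vecs vec_swap"
  unfolding DA_simps(1,3) by (rule vec_swap_linear)

lemma mat_swap_lin:
  "linear_map (fps_scale (vec_scale (vec_scale (ascale A)))) (vec_scale (vec_scale (ascale DA)))
    (fps_carrier mats) DA.mats mat_swap"
  unfolding DA_simps(1,3) by (rule mat_swap_linear)

lemma lift_module_bij: "bij_betw lift_module EE (mcarrier DP.E)"
proof -
  have 1: "mat_vec A P\<^sub>0 (mat_vec A P\<^sub>0 x) = mat_vec A P\<^sub>0 x" if "x \<in> vecs" for x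
    using mat_vec_assoc[OF P_in P_in that] P_idem by simp
  have 2: "mat_vec DA P (mat_vec DA P x) = mat_vec DA P x" if "x \<in> DA.vecs" for x
    using DA.mat_vec_assoc[OF DP.P_in DP.P_in that] DP.P_idem by simp
  have 3: "vec_head (mat_vec DA P x) = mat_vec A P\<^sub>0 (vec_head x)" if "x \<in> DA.vecs" for x
    using vec_head_mat_vec[OF DP.P_in that] P_head by simp
  have 4: "bij_betw vec_swap (fps_carrier vecs) DA.vecs" unfolding DA_simps(1) by (rule vec_swap_bij)
  show ?thesis
    unfolding lift_module_def[abs_def] E_image DP.E_image
    by (rule swapped_idempotent_bij[where head = vec_head, OF c_module_vecs mat_vec_linear[OF P_in] 1
          c_module_E[unfolded E_image] vec_swap_lin 4 DA.mat_vec_linear[OF DP.P_in] 2 head_swap(1) 3])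
qed

lemma lift_module_linear: "linear_map (fps_scale (mscale E)) (mscale DP.E) EE (mcarrier DP.E) lift_module"
  unfolding lift_module_def[abs_def] E_simps(2) DP.E_simps(2)
  by (rule linear_map_restrict[OF linear_map_compose[OF vec_swap_lin DA.mat_vec_linear[OF DP.P_in]]])
    (use bij_betw_apply[OF lift_module_bij] in \<open>auto simp: lift_module_def E_simps(1) fps_carrier_def\<close>)

lemma lift_module_head: "f \<in> EE \<Longrightarrow> vec_head (lift_module f) = fps_nth f 0"
  using vec_head_mat_vec[OF DP.P_in vec_swap_in, of f] fps_carrierD[of f "mcarrier E" 0]
  by (simp add: lift_module_def P_head head_swap E_simps(1))

text \<open>The identification of \<open>B[[\<lambda>]]\<close> with \<open>P \<star> M\<^sub>n(A[[\<lambda>]]) \<star> P\<close>. It is bijective since \<open>b \<mapsto> P \<star> b \<star> P\<close> deforms the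
  idempotent \<open>b \<mapsto> P\<^sub>0 b P\<^sub>0\<close> with range \<open>B\<close>, and compatible with the involutions since \<open>P\<close> is Hermitian.\<close>

definition lift_corner :: "('a^'n^'n) fps \<Rightarrow> 'a fps^'n^'n" where
  "lift_corner f = mat_mult DA P (mat_mult DA (mat_swap f) P)"

lemma lift_corner_bij: "bij_betw lift_corner BB (acarrier DP.B)"
proof -
  have 1: "mat_head (mat_mult DA P (mat_mult DA M P)) = mat_mult A P\<^sub>0 (mat_mult A (mat_head M) P\<^sub>0)"
    if "M \<in> DA.mats" for M
    using mat_head_mat_mult[OF DP.P_in DA.mat_mult_in[OF that DP.P_in]] mat_head_mat_mult[OF that DP.P_in] P_head
    by simp
  have 2: "bij_betw mat_swap (fps_carrier mats) DA.mats" unfolding DA_simps(1) by (rule mat_swap_bij)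
  show ?thesis
    unfolding lift_corner_def[abs_def] B_image DP.B_image
    by (rule swapped_idempotent_bij[where head = mat_head, OF c_module_mats compress_linear compress_idem
          c_module_B[unfolded B_image] mat_swap_lin 2 DP.compress_linear DP.compress_idem head_swap(2) 1])
qed

lemma lift_corner_linear: "linear_map (fps_scale (ascale B)) (ascale DP.B) BB (acarrier DP.B) lift_corner"
  unfolding lift_corner_def[abs_def] B_simps(3) DP.B_simps(3)
  by (rule linear_map_restrict[OF linear_map_compose[OF mat_swap_lin DP.compress_linear]])
    (use bij_betw_apply[OF lift_corner_bij] in \<open>auto simp: lift_corner_def B_simps(1) fps_carrier_def\<close>)

lemma lift_corner_head: "f \<in> BB \<Longrightarrow> mat_head (lift_corner f) = fps_nth f 0"
  using mat_head_mat_mult[OF DP.P_in DA.mat_mult_in[OF mat_swap_in DP.P_in], of f]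
    mat_head_mat_mult[OF mat_swap_in DP.P_in, of f] fps_carrierD[of f "acarrier B" 0]
  by (simp add: lift_corner_def P_head head_swap B_simps(1))

lemma lift_corner_star: "f \<in> BB \<Longrightarrow> lift_corner (Abs_fps (\<lambda>n. astar B (fps_nth f n))) = astar DP.B (lift_corner f)"
proof -
  assume f: "f \<in> BB"
  interpret M: star_alg_on "matrix_algebra DA :: ('r fps, 'a fps^'n^'n) star_alg"
    by unfold_locales (rule DA.star_algebra_matrix)
  note m = DA.matrix_algebra_simps
  have "astar (matrix_algebra DA) P = P" "P \<in> acarrier (matrix_algebra DA)" "mat_swap f \<in> acarrier (matrix_algebra DA)"
    using DP.P_star DP.P_in mat_swap_in[OF f] by (simp_all add: m)
  then have "astar (matrix_algebra DA) (lift_corner f) = mat_mult DA (mat_mult DA P (astar (matrix_algebra DA) (mat_swap f))) P"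
    using M.star_mult[of P "mat_mult DA (mat_swap f) P"] M.star_mult[of "mat_swap f" P] M.mult_in[of "mat_swap f" P]
    by (simp add: lift_corner_def m(2))
  also have "\<dots> = mat_mult DA P (mat_mult DA (astar (matrix_algebra DA) (mat_swap f)) P)"
    using M.mult_assoc[of P "astar (matrix_algebra DA) (mat_swap f)" P] M.star_in[of "mat_swap f"]
      DP.P_in mat_swap_in[OF f] by (simp add: m(1,2))
  finally show ?thesis
    unfolding lift_corner_def B_simps(4) mat_swap_star m(4) DP.B_simps(4) by simp
qed

lemma corner_deformation:
  obtains D where "hermitian_deformation B D"
    "\<And>f g. f \<in> BB \<Longrightarrow> g \<in> BB \<Longrightarrow> lift_corner (fps_extend2 D f g) = mat_mult DA (lift_corner f) (lift_corner g)"
proof (rule transport_hermitian_deformation[OF star_algebra_B DP.star_algebra_B lift_corner_bij lift_corner_linear lift_corner_star])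
  fix f g k assume f: "f \<in> BB" and g: "g \<in> BB" and k: "k \<in> BB" and eq: "lift_corner k = amult DP.B (lift_corner f) (lift_corner g)"
  have "lift_corner f \<in> DA.mats" "lift_corner g \<in> DA.mats"
    using bij_betw_apply[OF lift_corner_bij f] bij_betw_apply[OF lift_corner_bij g] by (simp_all add: DP.B_simps(1))
  then show "fps_nth k 0 = amult B (fps_nth f 0) (fps_nth g 0)"
    using arg_cong[OF eq, of mat_head] by (simp add: lift_corner_head f g k DP.B_simps(2) B_simps(2) mat_head_mat_mult)
qed (use that in \<open>auto simp: DP.B_simps(2)\<close>)

subsection \<open>Trivializations\<close>

text \<open>Deformations of \<open>E\<close> are compared by identifying each of them with \<open>P \<star> A[[\<lambda>]]\<^sup>n\<close>, by an isomorphism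
  that is the identity in order \<open>\<lambda>\<^sup>0\<close>. A map with these properties is automatically bijective, since
  it differs from \<open>lift_module\<close> by a map \<open>id + O(\<lambda>)\<close>.\<close>

definition trivialization :: "(nat \<Rightarrow> 'a^'n \<Rightarrow> 'a \<Rightarrow> 'a^'n) \<Rightarrow> (('a^'n) fps \<Rightarrow> 'a fps^'n) \<Rightarrow> bool" where
  "trivialization \<rho> Q \<longleftrightarrow> right_mod_hom DA (deformed_module E \<rho>) DP.E Q \<and>
     (\<forall>x\<in>EE. vec_head (Q x) = fps_nth x 0)"

lemma DM_simps: "mcarrier (deformed_module E \<rho>) = EE" "mscale (deformed_module E \<rho>) = fps_scale (mscale E)"
  "mact (deformed_module E \<rho>) = fps_extend2 \<rho>"
  by (simp_all add: deformed_module_def)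

lemma c_moduleE: "c_module (mcarrier E) (mscale E)"
  using c_module_E by (simp add: E_simps)

lemma trivializationD:
  assumes "trivialization \<rho> Q"
  shows "right_mod_hom DA (deformed_module E \<rho>) DP.E Q"
    "linear_map (fps_scale (mscale E)) (mscale DP.E) EE (mcarrier DP.E) Q"
    "x \<in> EE \<Longrightarrow> Q x \<in> mcarrier DP.E"
    "x \<in> EE \<Longrightarrow> a \<in> acarrier DA \<Longrightarrow> Q (fps_extend2 \<rho> x a) = mact DP.E (Q x) a"
    "x \<in> EE \<Longrightarrow> vec_head (Q x) = fps_nth x 0"
    "bij_betw Q EE (mcarrier DP.E)"
proof -
  show h: "right_mod_hom DA (deformed_module E \<rho>) DP.E Q" and 0: "x \<in> EE \<Longrightarrow> vec_head (Q x) = fps_nth x 0" for x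
    using assms by (auto simp: trivialization_def)
  show lin: "linear_map (fps_scale (mscale E)) (mscale DP.E) EE (mcarrier DP.E) Q"
    and "x \<in> EE \<Longrightarrow> a \<in> acarrier DA \<Longrightarrow> Q (fps_extend2 \<rho> x a) = mact DP.E (Q x) a"
    using h by (auto simp: right_mod_hom_def DM_simps)
  show in_E: "x \<in> EE \<Longrightarrow> Q x \<in> mcarrier DP.E" for x by (rule linear_mapD(1)[OF lin])
  have "perturbs_id (mcarrier E) (mscale E) (\<lambda>f. inv_into EE lift_module (Q f))"
    by (rule perturbs_id_compose_inverse[OF c_moduleE lift_module_linear lift_module_bij lin lift_module_head 0])
  from bij_betw_trans[OF perturbs_id_bij[OF c_moduleE this] lift_module_bij]
  have "bij_betw (lift_module \<circ> (\<lambda>f. inv_into EE lift_module (Q f))) EE (mcarrier DP.E)" .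
  then show "bij_betw Q EE (mcarrier DP.E)"
    by (rule iffD1[OF bij_betw_cong, rotated]) (simp add: bij_betw_inv_into_right[OF lift_module_bij in_E])
qed

text \<open>The basis of \<open>A[[\<lambda>]]\<^sup>n\<close> can be mapped to arbitrary elements. Choosing the columns of \<open>P\<^sub>0\<close>, read as constant
  series in \<open>E[[\<lambda>]]\<close>, gives a module map that is the identity in order \<open>\<lambda>\<^sup>0\<close> on \<open>P \<star> A[[\<lambda>]]\<^sup>n\<close>; its inverse is a
  trivialization.\<close>

lemma trivialization_exists:
  assumes \<rho>: "module_deformation A C E \<rho>"
  obtains Q where "trivialization \<rho> Q"
proof -
  let ?M = "deformed_module E \<rho>"
  have M: "right_module DA ?M" and \<rho>0: "\<And>x a. x \<in> mcarrier E \<Longrightarrow> a \<in> acarrier A \<Longrightarrow> \<rho> 0 x a = mact E x a"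
    using \<rho> by (auto simp: module_deformation_def)
  define p where "p j = fps_const (column j P\<^sub>0)" for j
  have p: "p j \<in> EE" for j
    unfolding p_def by (rule fps_const_in[OF c_moduleD(1)[OF c_module_E] column_P_in])
  note pl = right_moduleD(2)[OF M, unfolded DM_simps(1), OF p]
  define K where "K y = (\<Sum>j\<in>UNIV. mact ?M (p j) (y $ j))" for y :: "'a fps^'n"
  have vin: "y $ j \<in> acarrier DA" if "y \<in> mcarrier DP.E" for y j using that by (simp add: DP.E_simps(1))
  have t: "mact ?M (p j) (y $ j) \<in> EE" if "y \<in> mcarrier DP.E" for y j
    using linear_mapD(1)[OF pl vin[OF that]] by (simp add: DM_simps)
  note MM = right_moduleD(1)[OF M, unfolded DM_simps(1)]
  have Khom: "right_mod_hom DA DP.E ?M K"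
    unfolding right_mod_hom_def DM_simps(1)
  proof (intro conjI linear_mapI ballI)
    fix x y c b assume x: "x \<in> mcarrier DP.E"
    show "K x \<in> EE" unfolding K_def by (rule c_module_sum_in[OF MM t[OF x]])
    show "K (mscale DP.E c x) = mscale ?M c (K x)"
      using linear_mapD(3)[OF pl vin[OF x]] t[OF x]
      by (simp add: K_def DP.E_simps(2) vec_scale_def c_module_scale_sum[OF MM])
    show "K (x + y) = K x + K y" if y: "y \<in> mcarrier DP.E"
      using linear_mapD(2)[OF pl vin[OF x] vin[OF y]] by (simp add: K_def sum.distrib)
    show "K (mact DP.E x b) = mact ?M (K x) b" if b: "b \<in> acarrier DA"
    proof -
      have "mact ?M (K x) b = (\<Sum>j\<in>UNIV. mact ?M (mact ?M (p j) (x $ j)) b)"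
        unfolding K_def by (rule linear_map_sum[OF right_moduleD(3)[OF M b, unfolded DM_simps(1)] MM t[OF x]])
      then show ?thesis
        using right_moduleD(5)[OF M, unfolded DM_simps(1), OF p vin[OF x] b]
        by (simp add: K_def DP.E_simps(3))
    qed
  qed
  have Khead: "fps_nth (K y) 0 = vec_head y" if y: "y \<in> mcarrier DP.E" for y
  proof -
    have "fps_nth (K y) 0 = (\<Sum>j\<in>UNIV. mact E (column j P\<^sub>0) (fps_nth (y $ j) 0))"
      using \<rho>0[OF column_P_in nth_in[OF vin[OF y]]]
      by (simp add: K_def fps_sum_nth DM_simps(3) fps_extend2_0 p_def)
    then show ?thesis using E_expansion[OF vec_head_E[OF y]] by (simp add: vec_head_def)
  qed
  have Klin: "linear_map (mscale DP.E) (fps_scale (mscale E)) (mcarrier DP.E) EE K"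
    using Khom by (simp add: right_mod_hom_def DM_simps)
  have "perturbs_id (mcarrier E) (mscale E) (\<lambda>f. K (lift_module f))"
    unfolding perturbs_id_def
    using linear_map_compose[OF lift_module_linear Klin] Khead[OF bij_betw_apply[OF lift_module_bij]] lift_module_head by simp
  from bij_betw_trans[OF bij_betw_inv_into[OF lift_module_bij] perturbs_id_bij[OF c_moduleE this]]
  have "bij_betw ((\<lambda>f. K (lift_module f)) \<circ> inv_into EE lift_module) (mcarrier DP.E) EE" .
  then have Kbij: "bij_betw K (mcarrier DP.E) EE"
    by (rule iffD1[OF bij_betw_cong, rotated]) (simp add: bij_betw_inv_into_right[OF lift_module_bij])
  define Q where "Q = inv_into (mcarrier DP.E) K"
  have "right_mod_hom DA ?M DP.E Q"
    unfolding Q_def using Kbij by (intro right_mod_hom_inverse[OF DP.right_module_E Khom]) (simp add: DM_simps)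
  moreover have "vec_head (Q x) = fps_nth x 0" if x: "x \<in> EE" for x
    using Khead[of "Q x"] bij_betw_apply[OF bij_betw_inv_into[OF Kbij] x] bij_betw_inv_into_right[OF Kbij x]
    by (simp add: Q_def)
  ultimately show thesis using that[of Q] by (simp add: trivialization_def)
qed

text \<open>The equivalence is \<open>Q'\<^sup>-\<^sup>1 Q\<close>. That it intertwines \<open>Q\<close> and \<open>Q'\<close> is recorded in order to compare inner products.\<close>

lemma trivializations_equivalence:
  assumes Q: "trivialization \<rho> Q" and Q': "trivialization \<rho>' Q'" and \<rho>': "module_deformation A C E \<rho>'"
    and \<rho>: "module_deformation A C E \<rho>"
  obtains T where "formal_perturbation_of_id (mcarrier E) (mscale E) T"
    "\<And>x a. x \<in> EE \<Longrightarrow> a \<in> acarrier DA \<Longrightarrow> fps_extend T (fps_extend2 \<rho> x a) = fps_extend2 \<rho>' (fps_extend T x) a"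
    "\<And>x. x \<in> EE \<Longrightarrow> fps_extend T x \<in> EE" "\<And>x. x \<in> EE \<Longrightarrow> Q' (fps_extend T x) = Q x"
proof -
  note q = trivializationD[OF Q] and q' = trivializationD[OF Q']
  let ?F = "\<lambda>f. inv_into EE Q' (Q f)"
  have F: "?F x \<in> EE" "Q' (?F x) = Q x" if "x \<in> EE" for x
    using bij_betw_apply[OF bij_betw_inv_into[OF q'(6)] q(3)[OF that]]
      bij_betw_inv_into_right[OF q'(6) q(3)[OF that]] by auto
  have act: "fps_extend2 \<rho> x a \<in> EE" if "module_deformation A C E \<rho>" "x \<in> EE" "a \<in> acarrier DA" for \<rho> x a
    using that right_moduleD(4)[of DA "deformed_module E \<rho>" x a] by (simp add: module_deformation_def DM_simps)
  have "perturbs_id (mcarrier E) (mscale E) ?F"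
    by (rule perturbs_id_compose_inverse[OF c_moduleE q'(2,6) q(2) q'(5) q(5)])
  then obtain T where T: "formal_perturbation_of_id (mcarrier E) (mscale E) T" "\<And>f. f \<in> EE \<Longrightarrow> fps_extend T f = ?F f"
    by (rule perturbs_id_coeffs[OF c_moduleE]) (rule that, simp_all)
  have "?F (fps_extend2 \<rho> x a) = fps_extend2 \<rho>' (?F x) a" if x: "x \<in> EE" and a: "a \<in> acarrier DA" for x a
  proof (rule inj_onD[OF bij_betw_imp_inj_on[OF q'(6)]])
    show "Q' (?F (fps_extend2 \<rho> x a)) = Q' (fps_extend2 \<rho>' (?F x) a)"
      using F(2)[OF act[OF \<rho> x a]] q(4)[OF x a] q'(4)[OF F(1)[OF x] a] F(2)[OF x] by simp
  qed (use F(1)[OF act[OF \<rho> x a]] act[OF \<rho>' F(1)[OF x] a] in auto)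
  then show thesis using that[OF T(1)] T(2) F act[OF \<rho>] by simp
qed

lemma vec_head_act:
  "y \<in> DA.vecs \<Longrightarrow> a \<in> acarrier DA \<Longrightarrow> vec_head (mact DP.E y a) = mact E (vec_head y) (fps_nth a 0)"
  by (simp add: vec_head_def DP.E_simps(3) E_simps(3) vec_eq_iff mult_nth_0)

lemma DP_vecs: "y \<in> mcarrier DP.E \<Longrightarrow> y \<in> DA.vecs"
  by (simp add: DP.E_simps(1))

lemma head_canonical:
  "x \<in> DA.vecs \<Longrightarrow> y \<in> DA.vecs \<Longrightarrow>
    fps_nth (canonical_inner_product DA x y) 0 = canonical_inner_product A (vec_head x) (vec_head y)"
  by (simp add: canonical_inner_product_def fps_sum_nth mult_nth_0 DA.star_in vec_head_def DA_simps(4))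

text \<open>The action of the deformed algebra on \<open>P \<star> A[[\<lambda>]]\<^sup>n\<close>, pulled back to \<open>E[[\<lambda>]]\<close>.\<close>

lemma module_deformation_exists:
  obtains \<rho> where "module_deformation A C E \<rho>" "trivialization \<rho> lift_module"
proof -
  let ?S = "fps_carrier (acarrier A)"
  define F where "F x a = inv_into EE lift_module (mact DP.E (lift_module x) a)" for x a
  define \<rho> where "\<rho> r x a = fps_nth (F (fps_const x) (fps_const a)) r" for r x a
  note JE = bij_betw_apply[OF lift_module_bij]
  have act: "mact DP.E (lift_module x) a \<in> mcarrier DP.E" if "x \<in> EE" "a \<in> acarrier DA" for x a
    by (rule right_moduleD(4)[OF DP.right_module_E JE[OF that(1)] that(2)])
  have F: "F x a \<in> EE" "lift_module (F x a) = mact DP.E (lift_module x) a" if "x \<in> EE" "a \<in> acarrier DA" for x a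
    using bij_betw_apply[OF bij_betw_inv_into[OF lift_module_bij] act[OF that]] bij_betw_inv_into_right[OF lift_module_bij act[OF that]]
    by (auto simp: F_def)
  note Jinv = linear_map_inverse[OF lift_module_linear lift_module_bij c_module_fps[OF c_moduleE]]
  have bil: "bilinear_map (fps_scale (mscale E)) (fps_scale (ascale A)) (fps_scale (mscale E)) EE ?S EE F"
    unfolding bilinear_map_def F_def[abs_def]
  proof (intro conjI ballI)
    show "linear_map (fps_scale (ascale A)) (fps_scale (mscale E)) ?S EE (\<lambda>a. inv_into EE lift_module (mact DP.E (lift_module x) a))"
      if "x \<in> EE" for x
      using linear_map_compose[OF right_moduleD(2)[OF DP.right_module_E JE[OF that]] Jinv] by (simp add: DA_simps)
    show "linear_map (fps_scale (mscale E)) (fps_scale (mscale E)) EE EE (\<lambda>x. inv_into EE lift_module (mact DP.E (lift_module x) a))"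
      if "a \<in> ?S" for a
      by (rule linear_map_compose[OF linear_map_compose[OF lift_module_linear right_moduleD(3)[OF DP.right_module_E]] Jinv])
        (use that in \<open>simp add: DA_simps\<close>)
  qed
  note co = bilinear_map_fps_coeffs[OF c_moduleE c_module c_moduleE bil, folded \<rho>_def]
  have ext: "fps_extend2 \<rho> x a = F x a" if "x \<in> EE" "a \<in> acarrier DA" for x a
    using co(1) that by (simp add: DA_simps)
  have cE: "fps_const x \<in> EE" if "x \<in> mcarrier E" for x by (rule fps_const_in[OF c_moduleD(1)[OF c_moduleE] that])
  have inj: "x = y" if "x \<in> EE" "y \<in> EE" "lift_module x = lift_module y" for x y
    using bij_betw_imp_inj_on[OF lift_module_bij] that by (auto dest: inj_onD)
  have bil': "bilinear_map (mscale E) (ascale A) (mscale E) (mcarrier E) (acarrier A) (mcarrier E) (\<rho> r)" for r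
    using co(2)[of r] unfolding \<rho>_def[abs_def] .
  have "right_module DA (deformed_module E \<rho>)"
    unfolding right_module_def DM_simps
  proof (intro conjI ballI allI impI)
    show "c_module EE (fps_scale (mscale E))" by (rule c_module_fps[OF c_moduleE])
    show "bilinear_map (fps_scale (mscale E)) (ascale DA) (fps_scale (mscale E)) EE (acarrier DA) EE (fps_extend2 \<rho>)"
      unfolding DA_simps by (rule bilinear_map_fps_extend2[OF c_moduleE c_module c_moduleE bil'])
    fix x assume x: "x \<in> EE"
    show "fps_extend2 \<rho> (fps_extend2 \<rho> x a) b = fps_extend2 \<rho> x (amult DA a b)"
      if a: "a \<in> acarrier DA" and b: "b \<in> acarrier DA" for a b
      unfolding ext[OF x a] ext[OF F(1)[OF x a] b] ext[OF x DA.mult_in[OF a b]]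
      using F(2)[OF F(1)[OF x a] b] F(2)[OF x a] F(2)[OF x DA.mult_in[OF a b]]
        right_moduleD(5)[OF DP.right_module_E JE[OF x] a b]
      by (intro inj F(1) x a b DA.mult_in) simp
    show "fps_extend2 \<rho> x e = x" if e: "is_one DA e" for e
    proof -
      have e': "e \<in> acarrier DA" using e by (simp add: is_one_def)
      have "mact DP.E (lift_module x) e = lift_module x" using DP.right_module_E e JE[OF x] by (simp add: right_module_def)
      then show ?thesis unfolding ext[OF x e'] using F[OF x e'] x by (intro inj) auto
    qed
  qed
  moreover have "\<rho> 0 x a = mact E x a" if x: "x \<in> mcarrier E" and a: "a \<in> acarrier A" for x a
    using lift_module_head[OF F(1)[OF cE[OF x] const_in[OF a]]] F(2)[OF cE[OF x] const_in[OF a]]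
      vec_head_act[OF DP_vecs[OF JE[OF cE[OF x]]] const_in[OF a]] lift_module_head[OF cE[OF x]]
    by (simp add: \<rho>_def)
  ultimately have "module_deformation A C E \<rho>" using bil' by (simp add: module_deformation_def)
  moreover have "trivialization \<rho> lift_module"
    using lift_module_linear lift_module_head ext F(2) by (simp add: trivialization_def right_mod_hom_def DM_simps)
  ultimately show thesis by (rule that)
qed

text \<open>The canonical inner product of \<open>P \<star> A[[\<lambda>]]\<^sup>n\<close>, pulled back to \<open>E[[\<lambda>]]\<close>.\<close>

lemma inner_product_deformation_exists:
  assumes \<rho>: "module_deformation A C E \<rho>" and Q: "trivialization \<rho> Q"
  obtains h where "inner_product_deformation A C E (canonical_inner_product A) \<rho> h"
proof -
  note q = trivializationD[OF Q]
  have M: "right_module DA (deformed_module E \<rho>)" using \<rho> by (simp add: module_deformation_def)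
  define F where "F x y = canonical_inner_product DA (Q x) (Q y)" for x y
  define h where "h r x y = fps_nth (F (fps_const x) (fps_const y)) r" for r x y
  note S = DP.canonical_sesquilinear[unfolded bilinear_map_def]
  have Qlin: "linear_map (fps_scale (mscale E)) (vec_scale (ascale DA)) EE DA.vecs Q"
    by (rule linear_map_restrict[OF q(2)[unfolded DP.E_simps(2)]]) (use q(3) DP_vecs in auto)
  then have Qlin': "linear_map (\<lambda>c. fps_scale (mscale E) (cconj c)) (\<lambda>c. vec_scale (ascale DA) (cconj c)) EE DA.vecs Q"
    by (simp add: linear_map_def)
  have "bilinear_map (fps_scale (\<lambda>c. mscale E (cconj c))) (fps_scale (mscale E)) (fps_scale (ascale A))
      EE EE (fps_carrier (acarrier A)) F"
    unfolding bilinear_map_def fps_scale_cconj F_def[abs_def] DA_simps(1,3)[symmetric]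
  proof (intro conjI ballI)
    fix x assume x: "x \<in> EE"
    note Qx = DP_vecs[OF q(3)[OF x]]
    show "linear_map (fps_scale (mscale E)) (ascale DA) EE (acarrier DA) (\<lambda>y. canonical_inner_product DA (Q x) (Q y))"
      by (rule linear_map_compose[OF Qlin bspec[OF conjunct1[OF S] Qx]])
    show "linear_map (\<lambda>c. fps_scale (mscale E) (cconj c)) (ascale DA) EE (acarrier DA)
        (\<lambda>y. canonical_inner_product DA (Q y) (Q x))"
      by (rule linear_map_compose[OF Qlin' bspec[OF conjunct2[OF S] Qx]])
  qed
  note co = bilinear_map_fps_coeffs[OF c_module_cconj[OF c_moduleE] c_moduleE c_module this, folded h_def]
  have cE: "fps_const x \<in> EE" if "x \<in> mcarrier E" for x by (rule fps_const_in[OF c_moduleD(1)[OF c_moduleE] that])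
  have "hermitian_inner_product DA (deformed_module E \<rho>) (fps_extend2 h)"
    by (rule hermitian_inner_product_pullback[OF q(1) DP.hermitian_canonical M]) (simp add: DM_simps co(1)[symmetric] F_def)
  moreover have "h 0 x y = canonical_inner_product A x y" if x: "x \<in> mcarrier E" and y: "y \<in> mcarrier E" for x y
    using head_canonical[OF DP_vecs[OF q(3)[OF cE[OF x]]] DP_vecs[OF q(3)[OF cE[OF y]]]]
      q(5)[OF cE[OF x]] q(5)[OF cE[OF y]] by (simp add: h_def F_def)
  moreover have "bilinear_map (\<lambda>c. mscale E (cconj c)) (mscale E) (ascale A) (mcarrier E) (mcarrier E) (acarrier A) (h r)" for r
    using co(2)[of r] unfolding h_def[abs_def] .
  ultimately show thesis by (intro that[of h]) (simp add: inner_product_deformation_def)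
qed

text \<open>A deformation of \<open>h\<^sub>0\<close> becomes an inner product on \<open>P \<star> A[[\<lambda>]]\<^sup>n\<close>, with a Gram matrix \<open>H = P + O(\<lambda>)\<close>. In the
  deformation of \<open>B\<close> carried by \<open>P \<star> M\<^sub>n(A[[\<lambda>]]) \<star> P\<close> this is a Hermitian element of the form unit plus
  \<open>O(\<lambda>)\<close>, so that \<open>H = U \<star> U = U\<^sup>* \<star> U\<close>. Then \<open>U\<close> turns the given inner product into the canonical one.\<close>

lemma isometric_trivialization:
  fixes c :: "'r fps cext"
  assumes \<rho>: "module_deformation A C E \<rho>"
    and h: "inner_product_deformation A C E (canonical_inner_product A) \<rho> h"
    and half: "c + c = 1" "cconj c = c"
  obtains G where "trivialization \<rho> G"
    "\<forall>x\<in>EE. \<forall>y\<in>EE. canonical_inner_product DA (G x) (G y) = fps_extend2 h x y"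
proof -
  obtain Q where Q: "trivialization \<rho> Q" by (rule trivialization_exists[OF \<rho>])
  note q = trivializationD[OF Q]
  let ?M = "deformed_module E \<rho>"
  have M: "right_module DA ?M" using \<rho> by (simp add: module_deformation_def)
  define R where "R = inv_into EE Q"
  have R: "R y \<in> EE" "Q (R y) = y" if "y \<in> mcarrier DP.E" for y
    using bij_betw_apply[OF bij_betw_inv_into[OF q(6)] that] bij_betw_inv_into_right[OF q(6) that]
    by (auto simp: R_def)
  have RQ: "R (Q x) = x" if "x \<in> EE" for x
    using bij_betw_inv_into_left[OF q(6) that] by (simp add: R_def)
  have Rhom: "right_mod_hom DA DP.E ?M R"
    using right_mod_hom_inverse[OF M q(1)] q(6) by (simp add: R_def DM_simps)
  define k where "k u v = fps_extend2 h (R u) (R v)" for u v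
  have h0: "\<And>x y. x \<in> mcarrier E \<Longrightarrow> y \<in> mcarrier E \<Longrightarrow> h 0 x y = canonical_inner_product A x y"
    and hh: "hermitian_inner_product DA ?M (fps_extend2 h)"
    using h by (auto simp: inner_product_deformation_def)
  have "hermitian_inner_product DA DP.E k"
    by (rule hermitian_inner_product_pullback[OF Rhom hh DP.right_module_E]) (simp add: k_def)
  note gram = DP.gram_matrix[OF this]
  define H where "H = (\<chi> i j. k (column i P) (column j P))"
  note gram = gram[folded H_def]
  have col_head: "fps_nth (R (column j P)) 0 = column j P\<^sub>0" for j
  proof -
    have "vec_head (column j P) = column j P\<^sub>0"
      using P_head by (auto simp: vec_eq_iff vec_head_def mat_head_def column_nth)
    then show ?thesis
      using q(5)[OF R(1)[OF DP.column_P_in[of j]]] R(2)[OF DP.column_P_in[of j]] by simp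
  qed
  have "canonical_inner_product A (column i P\<^sub>0) (column j P\<^sub>0) = P\<^sub>0 $ i $ j" for i j
  proof -
    have "astar A (P\<^sub>0 $ k $ i) = P\<^sub>0 $ i $ k" for k using arg_cong[OF P_star, of "\<lambda>M. M $ i $ k"] by simp
    then show ?thesis
      using arg_cong[OF P_idem, of "\<lambda>M. M $ i $ j"] by (simp add: canonical_inner_product_def column_nth mat_mult_nth)
  qed
  then have H_head: "mat_head H = P\<^sub>0"
    using h0[OF column_P_in column_P_in] by (simp add: vec_eq_iff mat_head_def H_def k_def fps_extend2_0 col_head)
  obtain D where D: "hermitian_deformation B D" "\<forall>f\<in>BB. \<forall>g\<in>BB. lift_corner (fps_extend2 D f g) = mat_mult DA (lift_corner f) (lift_corner g)"
    by (rule corner_deformation) blast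
  interpret B: hermitian_deform B D by unfold_locales (rule star_algebra_B, rule D(1))
  define H' where "H' = inv_into BB lift_corner H"
  have H': "H' \<in> BB" "lift_corner H' = H"
    using bij_betw_apply[OF bij_betw_inv_into[OF lift_corner_bij] gram(1)] bij_betw_inv_into_right[OF lift_corner_bij gram(1)]
    by (auto simp: H'_def)
  have sB: "astar B.DA f \<in> BB" "lift_corner (astar B.DA f) = astar DP.B (lift_corner f)" if "f \<in> BB" for f
    using that B.DA.star_in[of f] lift_corner_star[OF that] by (simp_all add: B.DA_simps(1)) (simp add: deformed_algebra_def)
  have "astar B.DA H' = H'"
    by (rule inj_onD[OF bij_betw_imp_inj_on[OF lift_corner_bij]]) (use sB[OF H'(1)] H' gram(2) in auto)
  moreover have "fps_nth H' 0 = P\<^sub>0" using lift_corner_head[OF H'(1)] H'(2) H_head by simp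
  ultimately obtain U' where U': "U' \<in> BB" "astar B.DA U' = U'" "fps_nth U' 0 = P\<^sub>0" "amult B.DA U' U' = H'"
    using B.hermitian_square_root[OF is_one_B _ _ _ half, of H'] H'(1) by (auto simp: B.DA_simps(1))
  define U where "U = lift_corner U'"
  have U: "U \<in> acarrier DP.B" "astar DP.B U = U" "mat_mult DA U U = H" "mat_head U = P\<^sub>0"
    using bij_betw_apply[OF lift_corner_bij U'(1)] sB[OF U'(1)] U' D(2) H'(2) lift_corner_head[OF U'(1)]
    by (auto simp: U_def B.DA_simps(2))
  have U_mats: "U \<in> DA.mats" using U(1) by (simp add: DP.B_simps(1))
  define G where "G x = mat_vec DA U (Q x)" for x
  have GE: "G x \<in> mcarrier DP.E" if "x \<in> EE" for x
    unfolding G_def by (rule DP.mat_vec_B_in[OF U(1) q(3)[OF that]])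
  have "right_mod_hom DA ?M DP.E G"
    unfolding right_mod_hom_def DM_simps
  proof (intro conjI ballI)
    show "linear_map (fps_scale (mscale E)) (mscale DP.E) EE (mcarrier DP.E) G"
      unfolding G_def[abs_def] DP.E_simps(2)
    proof (rule linear_map_restrict[OF linear_map_compose[OF _ DA.mat_vec_linear[OF U_mats]] subset_refl])
      show "linear_map (fps_scale (mscale E)) (vec_scale (ascale DA)) EE DA.vecs Q"
        by (rule linear_map_restrict[OF q(2)[unfolded DP.E_simps(2)]]) (use q(3) DP_vecs in auto)
    qed (use GE in \<open>simp add: G_def\<close>)
    show "G (fps_extend2 \<rho> x a) = mact DP.E (G x) a" if "x \<in> EE" "a \<in> acarrier DA" for x a
      using q(4)[OF that] DA.mat_vec_act[OF U_mats DP_vecs[OF q(3)[OF that(1)]] that(2)]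
      by (simp add: G_def DP.E_simps(3))
  qed
  moreover have "vec_head (G x) = fps_nth x 0" if x: "x \<in> EE" for x
    using vec_head_mat_vec[OF U_mats DP_vecs[OF q(3)[OF x]]] q(5)[OF x] U(4) fps_carrierD[OF x, of 0]
    by (simp add: G_def E_simps(1))
  ultimately have "trivialization \<rho> G" by (simp add: trivialization_def)
  moreover have "canonical_inner_product DA (G x) (G y) = fps_extend2 h x y" if x: "x \<in> EE" and y: "y \<in> EE" for x y
  proof -
    note xv = DP_vecs[OF q(3)[OF x]] and yv = DP_vecs[OF q(3)[OF y]]
    have "canonical_inner_product DA (G x) (G y) =
        canonical_inner_product DA (Q x) (mat_vec DA (astar DP.B U) (mat_vec DA U (Q y)))"
      unfolding G_def DP.B_simps(4) by (rule DP.canonical_adjoint[OF U_mats xv DA.mat_vec_in[OF U_mats yv]])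
    also have "\<dots> = canonical_inner_product DA (Q x) (mat_vec DA H (Q y))"
      using DA.mat_vec_assoc[OF U_mats U_mats yv] U(2,3) by simp
    also have "\<dots> = fps_extend2 h x y"
      using gram(3)[OF q(3)[OF x] q(3)[OF y]] RQ x y by (simp add: k_def)
    finally show ?thesis .
  qed
  ultimately show thesis using that[of G] by blast
qed

text \<open>The columns of \<open>P\<close>, together with the coordinates of vectors, are a dual basis of \<open>P \<star> A[[\<lambda>]]\<^sup>n\<close>.\<close>

lemma deformed_module_dual_basis:
  assumes \<rho>: "module_deformation A C E \<rho>"
  shows "finitely_generated DA (deformed_module E \<rho>)"
    and "projective_wrt TYPE('k::ab_group_add) TYPE('l::ab_group_add) DA (deformed_module E \<rho>)"
proof -
  let ?M = "deformed_module E \<rho>"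
  have M: "right_module DA ?M" using \<rho> by (simp add: module_deformation_def)
  obtain Q where Q: "trivialization \<rho> Q" by (rule trivialization_exists[OF \<rho>])
  note q = trivializationD[OF Q]
  define p where "p j = inv_into EE Q (column j P)" for j
  have p: "p j \<in> EE" "Q (p j) = column j P" for j
    using bij_betw_apply[OF bij_betw_inv_into[OF q(6)] DP.column_P_in] bij_betw_inv_into_right[OF q(6) DP.column_P_in]
    by (auto simp: p_def)
  have Qin: "Q x $ j \<in> acarrier DA" if "x \<in> EE" for x j using q(3)[OF that] by (simp add: DP.E_simps(1))
  have t: "fps_extend2 \<rho> (p j) (Q x $ j) \<in> EE" if "x \<in> EE" for x j
    using right_moduleD(4)[OF M, of "p j" "Q x $ j"] p(1) Qin[OF that] by (simp add: DM_simps)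
  have sum: "x = (\<Sum>j\<in>UNIV. mact ?M (p j) (Q x $ j))" if x: "x \<in> mcarrier ?M" for x
  proof -
    have x': "x \<in> EE" using x by (simp add: DM_simps)
    note tx = t[OF x']
    have "Q (\<Sum>j\<in>UNIV. fps_extend2 \<rho> (p j) (Q x $ j)) = (\<Sum>j\<in>UNIV. Q (fps_extend2 \<rho> (p j) (Q x $ j)))"
      by (rule linear_map_sum[OF q(2) c_module_fps[OF c_moduleE] tx])
    also have "\<dots> = Q x"
      using DP.E_expansion[OF q(3)[OF x']] q(4)[OF p(1) Qin[OF x']] p(2) by simp
    finally have "Q (\<Sum>j\<in>UNIV. fps_extend2 \<rho> (p j) (Q x $ j)) = Q x" .
    from inj_onD[OF bij_betw_imp_inj_on[OF q(6)] this c_module_sum_in[OF c_module_fps[OF c_moduleE] tx] x']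
    show ?thesis by (simp add: DM_simps)
  qed
  have "right_mod_hom DA ?M (free_module DA) Q"
    using q(1) linear_map_restrict[OF q(2) subset_refl, of DA.vecs] q(3) DP_vecs
    by (auto simp: right_mod_hom_def DA.free_module_simps DM_simps DP.E_simps(2,3))
  from dual_basis_projective[OF star_algebra_DA M _ this sum]
  show "projective_wrt TYPE('k) TYPE('l) DA ?M" using p(1) by (simp add: DM_simps)
  show "finitely_generated DA ?M"
    by (rule dual_basis_finitely_generated[OF star_algebra_DA M _ _ sum]) (use p(1) Qin in \<open>simp_all add: DM_simps\<close>)
qed

text \<open>The endomorphisms of \<open>P \<star> A[[\<lambda>]]\<^sup>n\<close> are the matrices in \<open>P \<star> M\<^sub>n(A[[\<lambda>]]) \<star> P\<close>. Identify the former module with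
  \<open>E[[\<lambda>]]\<close> by a trivialization, and the latter algebra with \<open>B[[\<lambda>]]\<close> by \<^term>\<open>lift_corner\<close>.\<close>

lemma deformed_bimodule_exists:
  assumes \<rho>: "module_deformation A C E \<rho>" and one: "is_one A e"
  obtains D where "hermitian_deformation B D" "deformed_bimodule B D (mat_vec A) A C E \<rho>"
proof -
  let ?M = "deformed_module E \<rho>"
  have M: "right_module DA ?M" using \<rho> by (simp add: module_deformation_def)
  obtain Q where Q: "trivialization \<rho> Q" by (rule trivialization_exists[OF \<rho>])
  note q = trivializationD[OF Q]
  obtain D where D: "hermitian_deformation B D" "\<forall>f\<in>BB. \<forall>g\<in>BB. lift_corner (fps_extend2 D f g) = mat_mult DA (lift_corner f) (lift_corner g)"
    by (rule corner_deformation) blast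
  interpret B: hermitian_deform B D by unfold_locales (rule star_algebra_B, rule D(1))
  have "unital_star_algebra DA"
    using star_algebra_DA deformed_unit[OF one] by (simp add: unital_star_algebra_def)
  moreover have "P \<in> acarrier (matrix_algebra DA)" "P = amult (matrix_algebra DA) P P"
    using DP.P_in DP.P_idem by (simp_all add: DA.matrix_algebra_simps)
  ultimately have "End_iso DP.B DA DP.E (\<lambda>M. restrict (mat_vec DA M) (mcarrier DP.E))"
    by (rule corner_algebra_End_iso)
  from End_iso_transport_module[OF this M DP.right_module_E q(1)]
  have "End_iso DP.B DA ?M (\<lambda>b. \<lambda>x\<in>EE. inv_into EE Q (restrict (mat_vec DA b) (mcarrier DP.E) (Q x)))" (is "End_iso _ _ _ ?\<Psi>")
    using q(6) DP.c_module_B c_moduleD(2)[OF DP.c_module_B] by (simp add: DM_simps)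
  then have \<Psi>: "bij_betw ?\<Psi> (acarrier DP.B) (module_End DA ?M)"
    "\<And>b c. b \<in> acarrier DP.B \<Longrightarrow> c \<in> acarrier DP.B \<Longrightarrow> ?\<Psi> (amult DP.B b c) = compose EE (?\<Psi> b) (?\<Psi> c)"
    "\<And>b c x. b \<in> acarrier DP.B \<Longrightarrow> c \<in> acarrier DP.B \<Longrightarrow> x \<in> EE \<Longrightarrow> ?\<Psi> (b + c) x = ?\<Psi> b x + ?\<Psi> c x"
    "\<And>z b x. b \<in> acarrier DP.B \<Longrightarrow> x \<in> EE \<Longrightarrow> ?\<Psi> (ascale DP.B z b) x = mscale ?M z (?\<Psi> b x)"
    unfolding End_iso_def DM_simps(1) by blast+
  note IB = bij_betw_apply[OF lift_corner_bij]
  have "End_iso B.DA DA ?M (\<lambda>b. ?\<Psi> (lift_corner b))"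
    unfolding End_iso_def DM_simps(1) B.DA_simps
  proof (intro conjI ballI allI)
    show "bij_betw (\<lambda>b. ?\<Psi> (lift_corner b)) BB (module_End DA ?M)"
      using bij_betw_trans[OF lift_corner_bij \<Psi>(1)] by (simp add: comp_def)
    fix b c assume b: "b \<in> BB" and c: "c \<in> BB"
    show "?\<Psi> (lift_corner (fps_extend2 D b c)) = compose EE (?\<Psi> (lift_corner b)) (?\<Psi> (lift_corner c))"
      using \<Psi>(2)[OF IB[OF b] IB[OF c]] D(2) b c unfolding DP.B_simps(2) by simp
    show "?\<Psi> (lift_corner (b + c)) x = ?\<Psi> (lift_corner b) x + ?\<Psi> (lift_corner c) x" if x: "x \<in> EE" for x
      using \<Psi>(3)[OF IB[OF b] IB[OF c] x] linear_mapD(2)[OF lift_corner_linear b c] by simp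
  next
    fix z b x assume b: "b \<in> BB" and x: "x \<in> EE"
    show "?\<Psi> (lift_corner (fps_scale (ascale B) z b)) x = mscale ?M z (?\<Psi> (lift_corner b) x)"
      using \<Psi>(4)[OF IB[OF b] x, of z] linear_mapD(3)[OF lift_corner_linear b, of z] by simp
  qed
  moreover have "fps_nth (?\<Psi> (lift_corner b) x) 0 = mat_vec A (fps_nth b 0) (fps_nth x 0)" if b: "b \<in> BB" and x: "x \<in> EE" for b x
  proof -
    have y: "mat_vec DA (lift_corner b) (Q x) \<in> mcarrier DP.E" by (rule DP.mat_vec_B_in[OF IB[OF b] q(3)[OF x]])
    have "lift_corner b \<in> DA.mats" using IB[OF b] by (simp add: DP.B_simps(1))
    from vec_head_mat_vec[OF this DP_vecs[OF q(3)[OF x]]]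
    have "vec_head (mat_vec DA (lift_corner b) (Q x)) = mat_vec A (fps_nth b 0) (fps_nth x 0)"
      using lift_corner_head[OF b] q(5)[OF x] by simp
    then show ?thesis
      using q(5)[OF bij_betw_apply[OF bij_betw_inv_into[OF q(6)] y]] bij_betw_inv_into_right[OF q(6) y] q(3)[OF x] x
      by simp
  qed
  ultimately have "deformed_bimodule B D (mat_vec A) A C E \<rho>"
    unfolding deformed_bimodule_def by blast
  then show thesis using that D(1) by blast
qed

text \<open>The equivalence is \<open>\<Phi>'\<^sup>-\<^sup>1 \<Phi>\<close>, for the isomorphisms \<open>\<Phi>\<close>, \<open>\<Phi>'\<close> onto the endomorphisms of the deformed module. It is
  \<open>id + O(\<lambda>)\<close> because \<open>B\<close> acts faithfully on \<open>E\<close>.\<close>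

lemma deformed_bimodule_unique:
  assumes D: "formal_deformation B D" "deformed_bimodule B D (mat_vec A) A C E \<rho>"
    and D': "formal_deformation B D'" "deformed_bimodule B D' (mat_vec A) A C E \<rho>"
  shows "equivalent_deformations B D D'"
proof -
  interpret B: star_alg_on B by unfold_locales (rule star_algebra_B)
  let ?M = "deformed_module E \<rho>"
  have d: "acarrier (deformed_algebra B X) = BB" "amult (deformed_algebra B X) = fps_extend2 X"
    "ascale (deformed_algebra B X) = fps_scale (ascale B)" for X by (simp_all add: deformed_algebra_def)
  have *: "\<exists>\<Phi>. bij_betw \<Phi> BB (module_End DA ?M) \<and>
     (\<forall>b\<in>BB. \<forall>c\<in>BB. \<Phi> (fps_extend2 X b c) = compose EE (\<Phi> b) (\<Phi> c)) \<and>
     (\<forall>b\<in>BB. \<forall>c\<in>BB. \<forall>x\<in>EE. \<Phi> (b + c) x = \<Phi> b x + \<Phi> c x) \<and>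
     (\<forall>z. \<forall>b\<in>BB. \<forall>x\<in>EE. \<Phi> (fps_scale (ascale B) z b) x = fps_scale (mscale E) z (\<Phi> b x)) \<and>
     (\<forall>b\<in>BB. \<forall>x\<in>EE. fps_nth (\<Phi> b x) 0 = mat_vec A (fps_nth b 0) (fps_nth x 0))"
    if "deformed_bimodule B X (mat_vec A) A C E \<rho>" for X
    using that unfolding deformed_bimodule_def End_iso_def d DM_simps by blast
  obtain \<Phi> where \<Phi>: "bij_betw \<Phi> BB (module_End DA ?M)"
     "\<forall>b\<in>BB. \<forall>c\<in>BB. \<Phi> (fps_extend2 D b c) = compose EE (\<Phi> b) (\<Phi> c)"
     "\<forall>b\<in>BB. \<forall>c\<in>BB. \<forall>x\<in>EE. \<Phi> (b + c) x = \<Phi> b x + \<Phi> c x"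
     "\<forall>z. \<forall>b\<in>BB. \<forall>x\<in>EE. \<Phi> (fps_scale (ascale B) z b) x = fps_scale (mscale E) z (\<Phi> b x)"
     "\<forall>b\<in>BB. \<forall>x\<in>EE. fps_nth (\<Phi> b x) 0 = mat_vec A (fps_nth b 0) (fps_nth x 0)"
    using *[OF D(2)] by blast
  obtain \<Phi>' where \<Phi>': "bij_betw \<Phi>' BB (module_End DA ?M)"
     "\<forall>b\<in>BB. \<forall>c\<in>BB. \<Phi>' (fps_extend2 D' b c) = compose EE (\<Phi>' b) (\<Phi>' c)"
     "\<forall>b\<in>BB. \<forall>c\<in>BB. \<forall>x\<in>EE. \<Phi>' (b + c) x = \<Phi>' b x + \<Phi>' c x"
     "\<forall>z. \<forall>b\<in>BB. \<forall>x\<in>EE. \<Phi>' (fps_scale (ascale B) z b) x = fps_scale (mscale E) z (\<Phi>' b x)"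
     "\<forall>b\<in>BB. \<forall>x\<in>EE. fps_nth (\<Phi>' b x) 0 = mat_vec A (fps_nth b 0) (fps_nth x 0)"
    using *[OF D'(2)] by blast
  define S where "S b = inv_into BB \<Phi>' (\<Phi> b)" for b
  have S: "S b \<in> BB" "\<Phi>' (S b) = \<Phi> b" if "b \<in> BB" for b
    using bij_betw_apply[OF bij_betw_inv_into[OF \<Phi>'(1)] bij_betw_apply[OF \<Phi>(1) that]]
      bij_betw_inv_into_right[OF \<Phi>'(1) bij_betw_apply[OF \<Phi>(1) that]] by (auto simp: S_def)
  have ext: "f = g" if "f \<in> BB" "g \<in> BB" "\<And>x. x \<in> EE \<Longrightarrow> \<Phi>' f x = \<Phi>' g x" for f g
  proof (rule inj_onD[OF bij_betw_imp_inj_on[OF \<Phi>'(1)] _ that(1,2)])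
    have "\<Phi>' f \<in> extensional EE" "\<Phi>' g \<in> extensional EE"
      using bij_betw_apply[OF \<Phi>'(1) that(1)] bij_betw_apply[OF \<Phi>'(1) that(2)]
      by (auto simp: module_End_def DM_simps)
    then show "\<Phi>' f = \<Phi>' g" using that(3) by (rule extensionalityI)
  qed
  note BBm = c_module_fps[OF B.c_module]
  have prod_in: "fps_extend2 X b c \<in> BB" if "formal_deformation B X" "b \<in> BB" "c \<in> BB" for X b c
    using bilinear_map_fps_extend2[OF B.c_module B.c_module B.c_module, of X] that
    by (auto simp: formal_deformation_def bilinear_map_def linear_map_def)
  have "perturbs_id (acarrier B) (ascale B) S"
    unfolding perturbs_id_def
  proof (intro conjI ballI linear_mapI)
    fix b c z assume b: "b \<in> BB"
    show "S b \<in> BB" by (rule S(1)[OF b])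
    have zb: "fps_scale (ascale B) z b \<in> BB" "fps_scale (ascale B) z (S b) \<in> BB"
      using c_moduleD(5)[OF BBm] b S(1)[OF b] by auto
    show "S (fps_scale (ascale B) z b) = fps_scale (ascale B) z (S b)"
      by (rule ext) (use S[OF zb(1)] zb S[OF b] \<Phi>(4) \<Phi>'(4) b in auto)
    show "S (b + c) = S b + S c" if c: "c \<in> BB"
    proof -
      have bc: "b + c \<in> BB" "S b + S c \<in> BB" using c_moduleD(2)[OF BBm] b c S(1) by auto
      show ?thesis by (rule ext) (use S[OF bc(1)] bc S[OF b] S[OF c] \<Phi>(3) \<Phi>'(3) b c in auto)
    qed
    show "fps_nth (S b) 0 = fps_nth b 0"
    proof (rule B_faithful)
      fix x assume x: "x \<in> mcarrier E"
      then have "fps_const x \<in> EE" by (rule fps_const_in[OF c_moduleD(1)[OF c_moduleE]])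
      then show "mat_vec A (fps_nth (S b) 0) x = mat_vec A (fps_nth b 0) x"
        using \<Phi>(5) \<Phi>'(5) S[OF b] b by (metis fps_nth_fps_const)
    qed (use fps_carrierD S(1)[OF b] b in auto)
  qed
  then obtain T where T: "formal_perturbation_of_id (acarrier B) (ascale B) T" "\<And>f. f \<in> BB \<Longrightarrow> fps_extend T f = S f"
    by (rule perturbs_id_coeffs[OF B.c_module]) (rule that, simp_all)
  have "S (fps_extend2 D b c) = fps_extend2 D' (S b) (S c)" if b: "b \<in> BB" and c: "c \<in> BB" for b c
  proof (rule inj_onD[OF bij_betw_imp_inj_on[OF \<Phi>'(1)]])
    show "\<Phi>' (S (fps_extend2 D b c)) = \<Phi>' (fps_extend2 D' (S b) (S c))"
      using S(2)[OF prod_in[OF D(1) b c]] \<Phi>(2) \<Phi>'(2) S[OF b] S[OF c] b c by simp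
  qed (use S(1)[OF prod_in[OF D(1) b c]] prod_in[OF D'(1) S(1)[OF b] S(1)[OF c]] in auto)
  then show ?thesis
    unfolding equivalent_deformations_def using T prod_in[OF D(1)] by (intro exI[of _ T]) auto
qed

end

lemma contains_rat_half:
  assumes "contains_rat TYPE('r::linordered_idom)"
  obtains c :: "'r::linordered_idom fps cext" where "c + c = 1" "cconj c = c"
proof -
  obtain \<iota> :: "rat \<Rightarrow> 'r" where \<iota>: "\<iota> 1 = 1" "\<And>p q. \<iota> (p + q) = \<iota> p + \<iota> q"
    using assms by (auto simp: contains_rat_def)
  have half: "\<iota> (1/2) + \<iota> (1/2) = 1" using \<iota>(2)[of "1/2" "1/2"] \<iota>(1) by simp
  let ?c = "CExt (fps_const (\<iota> (1/2))) 0 :: 'r fps cext"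
  have "?c + ?c = 1" using half by (simp add: plus_cext_def one_cext_def fps_const_add)
  moreover have "cconj ?c = ?c" by (simp add: cconj_def)
  ultimately show thesis by (rule that)
qed

theorem theorem8p1:
  fixes A :: "('r::linordered_idom, 'a::ab_group_add) star_alg"
    and P\<^sub>0 :: "'a^'n^'n"
    and C :: "nat \<Rightarrow> 'a \<Rightarrow> 'a \<Rightarrow> 'a"
    and E :: "('r, 'a, 'a^'n) right_mod"
    and h\<^sub>0 :: "'a^'n \<Rightarrow> 'a^'n \<Rightarrow> 'a"
    and B :: "('r, 'a^'n^'n) star_alg"
  assumes "contains_rat TYPE('r)"
    and "unital_star_algebra A"
    and "P\<^sub>0 \<in> acarrier (matrix_algebra A)"
    and "P\<^sub>0 = amult (matrix_algebra A) P\<^sub>0 P\<^sub>0"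
    and "P\<^sub>0 = astar (matrix_algebra A) P\<^sub>0"
    and "E = projection_module A P\<^sub>0"
    and "h\<^sub>0 = canonical_inner_product A"
    and "B = corner_algebra A P\<^sub>0"
    and "hermitian_deformation A C"
  shows
    "((\<exists>\<rho> h. module_deformation A C E \<rho> \<and> inner_product_deformation A C E h\<^sub>0 \<rho> h) \<and>
      (\<forall>\<rho> h \<rho>' h'.
         module_deformation A C E \<rho> \<and> inner_product_deformation A C E h\<^sub>0 \<rho> h \<and>
         module_deformation A C E \<rho>' \<and> inner_product_deformation A C E h\<^sub>0 \<rho>' h' \<longrightarrow>
         isometrically_equivalent A E \<rho> h \<rho>' h') \<and>
      (\<forall>\<rho> \<rho>'. module_deformation A C E \<rho> \<and> module_deformation A C E \<rho>' \<longrightarrow>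
         equivalent_module_deformations A E \<rho> \<rho>')) \<and>
     (\<forall>\<rho>. module_deformation A C E \<rho> \<longrightarrow>
        finitely_generated (deformed_algebra A C) (deformed_module E \<rho>) \<and>
        projective_wrt TYPE('k::ab_group_add) TYPE('l::ab_group_add)
          (deformed_algebra A C) (deformed_module E \<rho>)) \<and>
     (\<forall>\<rho>. module_deformation A C E \<rho> \<longrightarrow>
        (\<exists>D. hermitian_deformation B D \<and> deformed_bimodule B D (mat_vec A) A C E \<rho>) \<and>
        (\<forall>D D'.
           formal_deformation B D \<and> deformed_bimodule B D (mat_vec A) A C E \<rho> \<and>
           formal_deformation B D' \<and> deformed_bimodule B D' (mat_vec A) A C E \<rho> \<longrightarrow>
           equivalent_deformations B D D'))"
proof -
  have A: "star_algebra A" using assms(2) by (simp add: unital_star_algebra_def)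
  obtain e where e: "is_one A e" using assms(2) by (auto simp: unital_star_algebra_def)
  interpret hermitian_deform A C by unfold_locales (rule A, rule assms(9))
  have p: "projection A P\<^sub>0"
    using assms(3-5) by unfold_locales (simp_all add: matrix_algebra_simps)
  obtain P where P: "projection DA P" "mat_head P = P\<^sub>0" by (rule lift_matrix_projection[OF p])
  interpret p: projection A P\<^sub>0 by (rule p)
  interpret d: deformed_projection A C P\<^sub>0 P
    by (intro deformed_projection.intro deformed_projection_axioms.intro p P) unfold_locales
  obtain c :: "'r fps cext" where c: "c + c = 1" "cconj c = c" by (rule contains_rat_half[OF assms(1)])
  have existence: "\<exists>\<rho> h. module_deformation A C p.E \<rho> \<and> inner_product_deformation A C p.E (canonical_inner_product A) \<rho> h"
    using d.module_deformation_exists d.inner_product_deformation_exists by metis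
  have isometry: "isometrically_equivalent A p.E \<rho> h \<rho>' h'"
    if \<rho>: "module_deformation A C p.E \<rho>" and h: "inner_product_deformation A C p.E (canonical_inner_product A) \<rho> h"
      and \<rho>': "module_deformation A C p.E \<rho>'" and h': "inner_product_deformation A C p.E (canonical_inner_product A) \<rho>' h'"
    for \<rho> h \<rho>' h'
  proof -
    obtain G where G: "d.trivialization \<rho> G"
      "\<forall>x\<in>d.EE. \<forall>y\<in>d.EE. canonical_inner_product DA (G x) (G y) = fps_extend2 h x y"
      by (rule d.isometric_trivialization[OF \<rho> h c])
    obtain G' where G': "d.trivialization \<rho>' G'"
      "\<forall>x\<in>d.EE. \<forall>y\<in>d.EE. canonical_inner_product DA (G' x) (G' y) = fps_extend2 h' x y"
      by (rule d.isometric_trivialization[OF \<rho>' h' c])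
    show ?thesis
    proof (rule d.trivializations_equivalence[OF G(1) G'(1) \<rho>' \<rho>])
      fix T assume T: "formal_perturbation_of_id (mcarrier p.E) (mscale p.E) T"
        "\<And>x a. x \<in> d.EE \<Longrightarrow> a \<in> acarrier DA \<Longrightarrow> fps_extend T (fps_extend2 \<rho> x a) = fps_extend2 \<rho>' (fps_extend T x) a"
        "\<And>x. x \<in> d.EE \<Longrightarrow> fps_extend T x \<in> d.EE" "\<And>x. x \<in> d.EE \<Longrightarrow> G' (fps_extend T x) = G x"
      have "fps_extend2 h' (fps_extend T x) (fps_extend T y) = fps_extend2 h x y" if "x \<in> d.EE" "y \<in> d.EE" for x y
        using G(2) G'(2) T(3,4) that by metis
      then show ?thesis
        unfolding isometrically_equivalent_def using T(1,2) by (auto simp: DA_simps(1))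
    qed
  qed
  have equivalence: "equivalent_module_deformations A p.E \<rho> \<rho>'"
    if \<rho>: "module_deformation A C p.E \<rho>" and \<rho>': "module_deformation A C p.E \<rho>'" for \<rho> \<rho>'
  proof -
    obtain Q where Q: "d.trivialization \<rho> Q" by (rule d.trivialization_exists[OF \<rho>])
    obtain Q' where Q': "d.trivialization \<rho>' Q'" by (rule d.trivialization_exists[OF \<rho>'])
    show ?thesis
      by (rule d.trivializations_equivalence[OF Q Q' \<rho>' \<rho>])
        (auto simp: equivalent_module_deformations_def DA_simps(1))
  qed
  have bimodule: "\<exists>D. hermitian_deformation p.B D \<and> deformed_bimodule p.B D (mat_vec A) A C p.E \<rho>"
    if "module_deformation A C p.E \<rho>" for \<rho>
    using d.deformed_bimodule_exists[OF that e] by blast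
  show ?thesis
    unfolding assms(6-8)
    by (intro conjI allI impI; (elim conjE)?; rule existence isometry equivalence
        d.deformed_module_dual_basis bimodule d.deformed_bimodule_unique; assumption)
qed

end
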